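(* Let $x$ be an abstract vector variable, $Y=\{y_1,\dots,y_N\}$ a finite set of further abstract vector variables, and $\partial^{Y,\mathrm R}_{x,q}$ the finite relative right $q$-vector derivative on $R_{\mathbb B}(\{x\}\cup Y)$. Let $M$ be a positive integer and specialize $Q=q^M$. Then the limit $q\to1$ of $\partial^{Y,\mathrm R}_{x,q}$ exists and is the radial-algebra operator $\partial^{\mathrm R}_x$ characterized on the decomposition $\bigoplus_I y_I\mathcal A\oplus\bigoplus_I(x\wedge y_I)\mathcal A$ (with $\mathcal A$ the algebra of scalar polynomials in $r,s_i,c_{ij}$) by $$\partial^{\mathrm R}_x(y_IA)=y_I\Bigl(2x\frac{\partial A}{\partial r}+2\sum_{i=1}^Ny_i\frac{\partial A}{\partial s_i}\Bigr),$$ $$\partial^{\mathrm R}_x((x\wedge y_I)B)=(-1)^{|I|}(M-|I|)\,y_IB+(x\wedge y_I)\Bigl(2x\frac{\partial B}{\partial r}+2\sum_{i=1}^Ny_i\frac{\partial B}{\partial s_i}\Bigr).$$ Moreover, under every $M$-dimensional Clifford realization of the radial algebra, this operator agrees with the standard right Clifford derivative $[F]\partial_x=-\sum_{j=1}^M\frac{\partial F}{\partial x_j}e_j$.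
   Context: **Radial algebra.** For a set $S$ of abstract vector variables, $R(S)$ is the associative unital $\mathbb R$-algebra generated by $S$ subject to $[\{u,v\},w]=0$ for all $u,v,w\in S$, where $\{a,b\}=ab+ba$, $[a,b]=ab-ba$. The wedge is the antisymmetrized product $u_1\wedge\cdots\wedge u_p=\frac1{p!}\sum_{\pi}\operatorname{sgn}(\pi)u_{\pi(1)}\cdots u_{\pi(p)}$ (empty wedge $=1$). **Coefficients.** $q,Q$ are algebraically independent indeterminates, $\mathbb B=\mathbb R[q,q^{-1},Q,(1-q)^{-1}]$, $R_{\mathbb B}(S)=\mathbb B\otimes_{\mathbb R}R(S)$. For integers $n,a$: $[n]_q=\frac{1-q^n}{1-q}$, $q^{m+a}:=Qq^a$, $[m+a]_q:=\frac{1-Qq^a}{1-q}$ ($m$ is only a formal symbol). **Scalars.** $r=x^2$, $s_i=\{x,y_i\}$, $c_{ij}=\{y_i,y_j\}=c_{ji}$ are central and $\mathcal A_x(Y)=\mathbb B[r,s_1,\dots,s_N,c_{ij}:1\le i\le j\le N]$ is a polynomial algebra. For $I=\{i_1<\cdots<i_p\}\subset\{1,\dots,N\}$, $y_I=y_{i_1}\wedge\cdots\wedge y_{i_p}$, $y_\varnothing=1$. It is known that $R_{\mathbb B}(\{x\}\cup Y)=\bigoplus_I y_I\mathcal A_x(Y)\oplus\bigoplus_I(x\wedge y_I)\mathcal A_x(Y)$, free over $\mathcal A_x(Y)$ on the elements $y_I,\ x\wedge y_I$. **Jackson operators.** For a scalar variable $u$ and parameter $P$: $\delta^{(u)}_Pf=\frac{f(u)-f(Pu)}{(1-P)u}$,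 $T^{(u)}_Pf(u)=f(Pu)$. The scalar-input operator is $$\partial^{\mathrm{sc},Y}_{x,q}A=(1+q)\,x\,\delta^{(r)}_{q^2}A+2\sum_{i=1}^N y_i\,T^{(r)}_{q^2}\delta^{(s_i)}_qA,\qquad A\in\mathcal A_x(Y).$$ **Finite relative right $q$-vector derivative.** $\partial^{Y,\mathrm R}_{x,q}$ is the $\mathbb B$-linear operator on $R_{\mathbb B}(\{x\}\cup Y)$ defined, for $p=|I|$ and $A,B\in\mathcal A_x(Y)$, by $$\partial^{Y,\mathrm R}_{x,q}(y_IA)=y_I\,\partial^{\mathrm{sc},Y}_{x,q}(A),\qquad \partial^{Y,\mathrm R}_{x,q}((x\wedge y_I)B)=(-1)^p[m-p]_q\,y_IB+q^{m-p}(x\wedge y_I)\,\partial^{\mathrm{sc},Y}_{x,q}(B).$$ **Limit.** The classical limit means: on elements with real coefficients (i.e. of $R(\{x\}\cup Y)$, with $A,B$ real polynomials in $r,s_i,c_{ij}$), first set $Q=q^M$, then let $q\to1$ in the coefficients, which are rational functions of $q$. **Clifford realization.** An $M$-dimensional Clifford realization is the algebra homomorphism from the real radial algebra to Clifford-algebra-valued polynomials (generators $e_1,\dots,e_M$, $e_ie_j+e_je_i=-2\delta_{ij}$) with $x\mapsto\sum_{j=1}^Mx_je_j$ and $y_i\mapsto\sum_{j=1}^My_{ij}e_j$, where the coordinates commute with everything and the $y_{ij}$ do not depend on the variables $x_1,\dots,x_M$. *)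

theory Defs
  imports
    Complex_Main
    "HOL-Library.Poly_Mapping"
    "HOL-Library.Cardinality"
    "HOL-Computational_Algebra.Polynomial"
    "HOL-Computational_Algebra.Fraction_Field"
    "HOL-Combinatorics.Permutations"
begin

section \<open>Free algebras and two-sided ideals\<close>

text \<open>
  The type \<open>'g mword\<close> is the free monoid on \<open>'g\<close>, written additively because the convolution
  product of \<^theory>\<open>HOL-Library.Poly_Mapping\<close> is indexed by additive monoids.  Hence
  \<open>'g mword \<Rightarrow>\<^sub>0 'k\<close> is the free associative unital \<open>'k\<close>-algebra on the generators \<open>'g\<close>.
\<close>

datatype 'g mword = MWord (letters: "'g list")

instantiation mword :: (type) monoid_add
begin
definition zero_mword :: "'g mword" where "zero_mword = MWord []"
definition plus_mword :: "'g mword \<Rightarrow> 'g mword \<Rightarrow> 'g mword"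
  where "plus_mword u v = MWord (letters u @ letters v)"
instance by standard (simp_all add: zero_mword_def plus_mword_def)
end

definition letter :: "'g \<Rightarrow> 'g mword \<Rightarrow>\<^sub>0 'k::comm_ring_1"
  where "letter g = Poly_Mapping.single (MWord [g]) 1"

lemma poly_mapping_single_induct [case_names single add]:
  fixes p :: "'a \<Rightarrow>\<^sub>0 'b::comm_monoid_add"
  assumes single: "\<And>k v. P (Poly_Mapping.single k v)"
    and add: "\<And>p q. P p \<Longrightarrow> P q \<Longrightarrow> P (p + q)"
  shows "P p"
proof (induction p rule: update_induct)
  case const
  show ?case using single[of undefined 0] by simp
next
  case (update f a b)
  have "Poly_Mapping.update a b f = f + Poly_Mapping.single a b"
    using update(1)
    by (intro poly_mapping_eqI) (auto simp: lookup_update lookup_add lookup_single when_def in_keys_iff)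
  then show ?case using add[OF update(3) single] by simp
qed

lemma poly_mapping_mult_hom:
  fixes L :: "('a::monoid_add \<Rightarrow>\<^sub>0 'b::semiring_0) \<Rightarrow> 'c::semiring_0"
  assumes add: "\<And>p q. L (p + q) = L p + L q"
    and mult: "\<And>j k u v. L (Poly_Mapping.single j u * Poly_Mapping.single k v)
                = L (Poly_Mapping.single j u) * L (Poly_Mapping.single k v)"
  shows "L (p * q) = L p * L q"
proof (induction p rule: poly_mapping_single_induct)
  case (single j u)
  show ?case
    by (induction q rule: poly_mapping_single_induct) (simp_all only: mult add distrib_left)
qed (simp add: add distrib_right)

inductive_set two_sided_ideal :: "'a::ring_1 set \<Rightarrow> 'a set" for G where
  zero: "0 \<in> two_sided_ideal G"
| gen: "g \<in> G \<Longrightarrow> a * g * b \<in> two_sided_ideal G"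
| add: "u \<in> two_sided_ideal G \<Longrightarrow> v \<in> two_sided_ideal G \<Longrightarrow> u + v \<in> two_sided_ideal G"

lemma two_sided_ideal_mult_left: "u \<in> two_sided_ideal G \<Longrightarrow> c * u \<in> two_sided_ideal G"
proof (induction rule: two_sided_ideal.induct)
  case (gen g a b)
  have "(c * a) * g * b \<in> two_sided_ideal G" using gen by (rule two_sided_ideal.gen)
  then show ?case by (simp add: mult.assoc)
qed (auto simp: distrib_left intro: two_sided_ideal.intros)

lemma two_sided_ideal_mult_right: "u \<in> two_sided_ideal G \<Longrightarrow> u * c \<in> two_sided_ideal G"
proof (induction rule: two_sided_ideal.induct)
  case (gen g a b)
  have "a * g * (b * c) \<in> two_sided_ideal G" using gen by (rule two_sided_ideal.gen)
  then show ?case by (simp add: mult.assoc)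
qed (auto simp: distrib_right intro: two_sided_ideal.intros)

lemma two_sided_ideal_uminus: "u \<in> two_sided_ideal G \<Longrightarrow> - u \<in> two_sided_ideal G"
  using two_sided_ideal_mult_left[of u G "- 1"] by simp

definition ideal_cong :: "'a::ring_1 set \<Rightarrow> 'a \<Rightarrow> 'a \<Rightarrow> bool"
  where "ideal_cong G u v \<longleftrightarrow> u - v \<in> two_sided_ideal G"

lemma equivp_ideal_cong: "equivp (ideal_cong G)"
proof (rule equivpI)
  show "reflp (ideal_cong G)"
    by (auto simp: reflp_def ideal_cong_def intro: two_sided_ideal.zero)
  show "symp (ideal_cong G)"
    by (auto simp: symp_def ideal_cong_def dest: two_sided_ideal_uminus)
  show "transp (ideal_cong G)"
  proof (rule transpI)
    fix u v w assume "ideal_cong G u v" "ideal_cong G v w"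
    then have "(u - v) + (v - w) \<in> two_sided_ideal G"
      unfolding ideal_cong_def by (rule two_sided_ideal.add)
    then show "ideal_cong G u w" by (simp add: ideal_cong_def)
  qed
qed

lemma ideal_cong_refl: "ideal_cong G u u"
  by (simp add: ideal_cong_def two_sided_ideal.zero)

lemma ideal_cong_add:
  assumes "ideal_cong G u u'" "ideal_cong G v v'"
  shows "ideal_cong G (u + v) (u' + v')"
proof -
  have "(u - u') + (v - v') \<in> two_sided_ideal G"
    using assms unfolding ideal_cong_def by (rule two_sided_ideal.add)
  then show ?thesis by (simp add: ideal_cong_def algebra_simps)
qed

lemma ideal_cong_uminus: "ideal_cong G u u' \<Longrightarrow> ideal_cong G (- u) (- u')"
  using two_sided_ideal_uminus[of "u - u'" G] by (simp add: ideal_cong_def)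

lemma ideal_cong_diff:
  "ideal_cong G u u' \<Longrightarrow> ideal_cong G v v' \<Longrightarrow> ideal_cong G (u - v) (u' - v')"
  using ideal_cong_add[OF _ ideal_cong_uminus, of G u u' v v'] by simp

lemma ideal_cong_mult:
  assumes "ideal_cong G u u'" "ideal_cong G v v'"
  shows "ideal_cong G (u * v) (u' * v')"
proof -
  have "(u - u') * v + u' * (v - v') \<in> two_sided_ideal G"
    using assms unfolding ideal_cong_def
    by (intro two_sided_ideal.add two_sided_ideal_mult_left two_sided_ideal_mult_right)
  then show ?thesis by (simp add: ideal_cong_def algebra_simps)
qed

section \<open>The radial algebra\<close>

text \<open>
  \<open>('v, 'k) radial\<close> is \<open>R\<^sub>k(S)\<close> for \<open>S\<close> the set of all elements of \<open>'v\<close>: the associative unital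
  \<open>'k\<close>-algebra generated by \<open>S\<close> subject to \<open>[{u,v},w] = 0\<close>.  For \<open>'k = real\<close> this is \<open>R(S)\<close>; for a
  commutative \<open>\<real>\<close>-algebra \<open>'k\<close> it is \<open>'k \<otimes> R(S)\<close>, the canonical map \<open>F \<mapsto> 1 \<otimes> F\<close> being
  \<open>base_change\<close> below.
\<close>

definition radial_relations :: "('v mword \<Rightarrow>\<^sub>0 'k::comm_ring_1) set" where
  "radial_relations =
     {(letter u * letter v + letter v * letter u) * letter w
      - letter w * (letter u * letter v + letter v * letter u) | u v w. True}"

quotient_type (overloaded) ('v, 'k) radial = "'v mword \<Rightarrow>\<^sub>0 'k::comm_ring_1" / "ideal_cong radial_relations"
  by (rule equivp_ideal_cong)

instantiation radial :: (type, comm_ring_1) ring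
begin
lift_definition zero_radial :: "('v, 'k::comm_ring_1) radial" is 0 .
lift_definition plus_radial :: "('v, 'k::comm_ring_1) radial \<Rightarrow> ('v, 'k) radial \<Rightarrow> ('v, 'k) radial"
  is "(+)" by (rule ideal_cong_add)
lift_definition uminus_radial :: "('v, 'k::comm_ring_1) radial \<Rightarrow> ('v, 'k) radial"
  is uminus by (rule ideal_cong_uminus)
lift_definition minus_radial :: "('v, 'k::comm_ring_1) radial \<Rightarrow> ('v, 'k) radial \<Rightarrow> ('v, 'k) radial"
  is "(-)" by (rule ideal_cong_diff)
lift_definition times_radial :: "('v, 'k::comm_ring_1) radial \<Rightarrow> ('v, 'k) radial \<Rightarrow> ('v, 'k) radial"
  is "(*)" by (rule ideal_cong_mult)
instance by standard (transfer, simp add: algebra_simps ideal_cong_refl)+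
end

lemma lookup_zero_mword_mult:
  fixes p q :: "'g mword \<Rightarrow>\<^sub>0 'k::comm_ring_1"
  shows "Poly_Mapping.lookup (p * q) 0 = Poly_Mapping.lookup p 0 * Poly_Mapping.lookup q 0"
proof (rule poly_mapping_mult_hom[where L = "\<lambda>p. Poly_Mapping.lookup p 0"])
  fix j k :: "'g mword" and u v :: 'k
  have "j + k = 0 \<longleftrightarrow> j = 0 \<and> k = 0"
    by (cases j; cases k) (auto simp: zero_mword_def plus_mword_def)
  then show "Poly_Mapping.lookup (Poly_Mapping.single j u * Poly_Mapping.single k v) 0 =
      Poly_Mapping.lookup (Poly_Mapping.single j u) 0 *
      Poly_Mapping.lookup (Poly_Mapping.single k v) 0"
    by (auto simp: mult_single lookup_single when_def)
qed (simp add: lookup_add)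

lemma radial_ideal_proper:
  assumes "p \<in> two_sided_ideal (radial_relations :: ('v mword \<Rightarrow>\<^sub>0 'k::comm_ring_1) set)"
  shows "Poly_Mapping.lookup p 0 = 0"
  using assms
proof (induction rule: two_sided_ideal.induct)
  case (gen g a b)
  have "Poly_Mapping.lookup (letter u :: 'v mword \<Rightarrow>\<^sub>0 'k) 0 = 0" for u
    by (simp add: letter_def lookup_single zero_mword_def)
  then have "Poly_Mapping.lookup g 0 = 0"
    using gen by (auto simp: radial_relations_def lookup_minus lookup_zero_mword_mult)
  then show ?case by (simp add: lookup_zero_mword_mult)
qed (simp_all add: lookup_add)

instantiation radial :: (type, comm_ring_1) ring_1
begin
lift_definition one_radial :: "('v, 'k::comm_ring_1) radial" is 1 .
instance
proof
  show "(0 :: ('v, 'k::comm_ring_1) radial) \<noteq> 1"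
  proof (transfer, rule notI)
    assume "ideal_cong radial_relations (0 :: 'v mword \<Rightarrow>\<^sub>0 'k) 1"
    then show False
      using radial_ideal_proper[of "0 - 1 :: 'v mword \<Rightarrow>\<^sub>0 'k"]
      by (simp add: ideal_cong_def lookup_minus)
  qed
qed (transfer, simp add: ideal_cong_refl)+
end

lift_definition vgen :: "'v \<Rightarrow> ('v, 'k::comm_ring_1) radial" is letter .

lift_definition rconst :: "'k \<Rightarrow> ('v, 'k::comm_ring_1) radial" is "Poly_Mapping.single 0" .

lemma map_of_real_add:
  fixes p q :: "'a \<Rightarrow>\<^sub>0 real"
  shows "Poly_Mapping.map (of_real :: real \<Rightarrow> 'k::real_algebra_1) (p + q)
       = Poly_Mapping.map of_real p + Poly_Mapping.map of_real q"
  by (intro poly_mapping_eqI) (auto simp: map.rep_eq lookup_add when_def simp flip: of_real_add)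

lemma map_of_real_minus:
  fixes p q :: "'a \<Rightarrow>\<^sub>0 real"
  shows "Poly_Mapping.map (of_real :: real \<Rightarrow> 'k::real_algebra_1) (p - q)
       = Poly_Mapping.map of_real p - Poly_Mapping.map of_real q"
  using map_of_real_add[of "p - q" q, where 'k = 'k] by simp

lemma map_of_real_mult:
  fixes p q :: "'a::monoid_add \<Rightarrow>\<^sub>0 real"
  shows "Poly_Mapping.map (of_real :: real \<Rightarrow> 'k::real_algebra_1) (p * q)
       = Poly_Mapping.map of_real p * Poly_Mapping.map of_real q"
  by (rule poly_mapping_mult_hom) (simp_all add: map_of_real_add mult_single map_single)

lemma map_of_real_radial_ideal:
  assumes "p \<in> two_sided_ideal (radial_relations :: ('v mword \<Rightarrow>\<^sub>0 real) set)"
  shows "Poly_Mapping.map (of_real :: real \<Rightarrow> 'k::{comm_ring_1,real_algebra_1}) p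
         \<in> two_sided_ideal radial_relations"
  using assms
proof (induction rule: two_sided_ideal.induct)
  case zero
  have "Poly_Mapping.map (of_real :: real \<Rightarrow> 'k) (0 :: 'v mword \<Rightarrow>\<^sub>0 real) = 0"
    by (simp add: map_eq_zero_iff)
  then show ?case by (simp add: two_sided_ideal.zero)
next
  case (gen g a b)
  have "Poly_Mapping.map (of_real :: real \<Rightarrow> 'k) g \<in> radial_relations"
    using gen unfolding radial_relations_def
    by (force simp: map_of_real_add map_of_real_minus map_of_real_mult letter_def map_single)
  then show ?case
    unfolding map_of_real_mult by (rule two_sided_ideal.gen)
next
  case (add u v)
  then show ?case unfolding map_of_real_add by (intro two_sided_ideal.add)
qed

lift_definition base_change ::
  "('v, real) radial \<Rightarrow> ('v, 'k::{comm_ring_1,real_algebra_1}) radial"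
  is "Poly_Mapping.map of_real"
  using map_of_real_radial_ideal by (simp add: ideal_cong_def flip: map_of_real_minus)

definition acomm :: "'a::ring \<Rightarrow> 'a \<Rightarrow> 'a"
  where "acomm a b = a * b + b * a"

definition wedge ::
  "('v, 'k) radial list \<Rightarrow> ('v, 'k::{comm_ring_1,real_algebra_1}) radial" where
  "wedge us = rconst (of_real (1 / fact (length us))) *
     (\<Sum>\<pi> | \<pi> permutes {..<length us}.
        of_int (sign \<pi>) * prod_list (map (\<lambda>i. us ! \<pi> i) [0..<length us]))"

section \<open>The decomposition over the scalar polynomials\<close>

text \<open>
  From here on, \<open>x\<close> is one of the generators and \<open>y 1, \<dots>, y N\<close> enumerates all the others.  The
  polynomial algebra \<open>k[r, s\<^sub>i, c\<^sub>i\<^sub>j : 1 \<le> i \<le> j \<le> N]\<close> consists of the polynomials in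
  the indeterminates \<open>VR\<close>, \<open>VS i\<close>, \<open>VC i j\<close> that satisfy \<open>scalar_polys N\<close>; \<open>scal\<close> substitutes
  \<open>r = x\<^sup>2\<close>, \<open>s\<^sub>i = {x,y\<^sub>i}\<close>, \<open>c\<^sub>i\<^sub>j = {y\<^sub>i,y\<^sub>j}\<close>.  These elements are central, so the order of the
  factors fixed in \<open>scal_monom\<close> is immaterial.
\<close>

datatype svar = VR | VS nat | VC nat nat

type_synonym ('i, 'k) mpoly = "('i \<Rightarrow>\<^sub>0 nat) \<Rightarrow>\<^sub>0 'k"

definition scalar_polys :: "nat \<Rightarrow> (svar, 'k::comm_ring_1) mpoly set" where
  "scalar_polys N = {A. \<forall>m\<in>Poly_Mapping.keys A. Poly_Mapping.keys m \<subseteq>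
     {VR} \<union> {VS i | i. 1 \<le> i \<and> i \<le> N} \<union> {VC i j | i j. 1 \<le> i \<and> i \<le> j \<and> j \<le> N}}"

definition scal_monom ::
  "'v \<Rightarrow> (nat \<Rightarrow> 'v) \<Rightarrow> nat \<Rightarrow> (svar \<Rightarrow>\<^sub>0 nat) \<Rightarrow> ('v, 'k::comm_ring_1) radial" where
  "scal_monom x y N m =
     (vgen x * vgen x) ^ Poly_Mapping.lookup m VR *
     prod_list (map (\<lambda>i. acomm (vgen x) (vgen (y i)) ^ Poly_Mapping.lookup m (VS i)) [1..<N+1]) *
     prod_list (map (\<lambda>(i, j). acomm (vgen (y i)) (vgen (y j)) ^ Poly_Mapping.lookup m (VC i j))
       [(i, j). i \<leftarrow> [1..<N+1], j \<leftarrow> [i..<N+1]])"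

definition scal ::
  "'v \<Rightarrow> (nat \<Rightarrow> 'v) \<Rightarrow> nat \<Rightarrow> (svar, 'k) mpoly \<Rightarrow> ('v, 'k::comm_ring_1) radial" where
  "scal x y N A =
     (\<Sum>m\<in>Poly_Mapping.keys A. rconst (Poly_Mapping.lookup A m) * scal_monom x y N m)"

definition yI :: "(nat \<Rightarrow> 'v) \<Rightarrow> nat set \<Rightarrow> ('v, 'k::{comm_ring_1,real_algebra_1}) radial"
  where "yI y I = wedge (map (\<lambda>i. vgen (y i)) (sorted_list_of_set I))"

definition xyI ::
  "'v \<Rightarrow> (nat \<Rightarrow> 'v) \<Rightarrow> nat set \<Rightarrow> ('v, 'k::{comm_ring_1,real_algebra_1}) radial"
  where "xyI x y I = wedge (vgen x # map (\<lambda>i. vgen (y i)) (sorted_list_of_set I))"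

definition from_components ::
  "'v \<Rightarrow> (nat \<Rightarrow> 'v) \<Rightarrow> nat \<Rightarrow> (nat set \<Rightarrow> (svar, 'k) mpoly) \<Rightarrow> (nat set \<Rightarrow> (svar, 'k) mpoly)
     \<Rightarrow> ('v, 'k::{comm_ring_1,real_algebra_1}) radial" where
  "from_components x y N A B =
     (\<Sum>I\<in>Pow {1..N}. yI y I * scal x y N (A I) + xyI x y I * scal x y N (B I))"

section \<open>The coefficient ring\<close>

text \<open>
  \<open>\<bbbB> = \<real>[q, q\<^sup>-\<^sup>1, Q, (1-q)\<^sup>-\<^sup>1]\<close> as a subring of the fraction field of \<open>\<real>[q][Q]\<close>: in
  \<open>real poly poly\<close> the inner variable is \<open>q\<close> and the outer one is \<open>Q\<close>.
\<close>

definition qden :: "nat \<Rightarrow> nat \<Rightarrow> real poly poly"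
  where "qden a b = [:[:0, 1:] ^ a * [:1, -1:] ^ b:]"

lemma qden_nonzero: "qden a b \<noteq> 0"
  by (simp add: qden_def)

lemma qden_mult: "qden a b * qden c d = qden (a + c) (b + d)"
  by (simp add: qden_def power_add algebra_simps)

lemma qden_0_0: "qden 0 0 = 1"
  by (simp add: qden_def one_pCons)

typedef bcoeff = "{f :: real poly poly fract. \<exists>p a b. f = Fract p (qden a b)}"
  morphisms fract_of_bcoeff bcoeff_of_fract
  by blast

setup_lifting type_definition_bcoeff

lemma bcoeff_add_closed:
  assumes "\<exists>p a b. f = Fract p (qden a b)" "\<exists>p a b. g = Fract p (qden a b)"
  shows "\<exists>p a b. f + g = Fract p (qden a b)"
proof -
  obtain p a b p' a' b' where "f = Fract p (qden a b)" "g = Fract p' (qden a' b')"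
    using assms by blast
  then have "f + g = Fract (p * qden a' b' + p' * qden a b) (qden (a + a') (b + b'))"
    by (simp add: qden_nonzero qden_mult)
  then show ?thesis by blast
qed

lemma bcoeff_mult_closed:
  assumes "\<exists>p a b. f = Fract p (qden a b)" "\<exists>p a b. g = Fract p (qden a b)"
  shows "\<exists>p a b. f * g = Fract p (qden a b)"
proof -
  obtain p a b p' a' b' where "f = Fract p (qden a b)" "g = Fract p' (qden a' b')"
    using assms by blast
  then have "f * g = Fract (p * p') (qden (a + a') (b + b'))"
    by (simp add: qden_mult)
  then show ?thesis by blast
qed

lemma bcoeff_poly_closed: "\<exists>p' a b. Fract p 1 = Fract p' (qden a b)"
  by (metis qden_0_0)

lemma bcoeff_uminus_closed:
  assumes "\<exists>p a b. f = Fract p (qden a b)"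
  shows "\<exists>p a b. - f = Fract p (qden a b)"
  using assms by (metis minus_fract)

instantiation bcoeff :: idom
begin
lift_definition zero_bcoeff :: bcoeff is 0
  unfolding Zero_fract_def by (rule bcoeff_poly_closed)
lift_definition one_bcoeff :: bcoeff is 1
  unfolding One_fract_def by (rule bcoeff_poly_closed)
lift_definition plus_bcoeff :: "bcoeff \<Rightarrow> bcoeff \<Rightarrow> bcoeff" is "(+)"
  by (rule bcoeff_add_closed)
lift_definition times_bcoeff :: "bcoeff \<Rightarrow> bcoeff \<Rightarrow> bcoeff" is "(*)"
  by (rule bcoeff_mult_closed)
lift_definition uminus_bcoeff :: "bcoeff \<Rightarrow> bcoeff" is uminus
  by (rule bcoeff_uminus_closed)
lift_definition minus_bcoeff :: "bcoeff \<Rightarrow> bcoeff \<Rightarrow> bcoeff" is "(-)"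
  unfolding diff_fract_def by (rule bcoeff_add_closed[OF _ bcoeff_uminus_closed])
instance by standard (transfer, simp add: algebra_simps)+
end

instantiation bcoeff :: real_algebra_1
begin
lift_definition scaleR_bcoeff :: "real \<Rightarrow> bcoeff \<Rightarrow> bcoeff" is "\<lambda>c f. Fract [:[:c:]:] 1 * f"
  by (rule bcoeff_mult_closed[OF bcoeff_poly_closed])
instance
proof
  have add: "Fract [:[:a + b:]:] 1 = Fract [:[:a:]:] 1 + Fract [:[:b:]:] (1 :: real poly poly)"
    for a b :: real by simp
  have mult: "Fract [:[:a * b:]:] 1 = Fract [:[:a:]:] 1 * Fract [:[:b:]:] (1 :: real poly poly)"
    for a b :: real by simp
  have one: "Fract [:[:1 :: real:]:] 1 = 1"
    by (simp add: One_fract_def one_pCons)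
  fix a b :: real and u v :: bcoeff
  show "a *\<^sub>R (u + v) = a *\<^sub>R u + a *\<^sub>R v" by transfer (simp add: distrib_left)
  show "(a + b) *\<^sub>R u = a *\<^sub>R u + b *\<^sub>R u" by transfer (simp only: add distrib_right)
  show "a *\<^sub>R b *\<^sub>R u = (a * b) *\<^sub>R u" by transfer (simp only: mult mult.assoc)
  show "1 *\<^sub>R u = u" by transfer (simp add: one)
  show "a *\<^sub>R u * v = a *\<^sub>R (u * v)" by transfer (simp add: mult.assoc)
  show "u * a *\<^sub>R v = a *\<^sub>R (u * v)" by transfer (simp add: mult.left_commute)
qed
end

lift_definition bq :: bcoeff is "Fract [:[:0, 1:]:] 1" by (rule bcoeff_poly_closed)

lift_definition bQ :: bcoeff is "Fract [:0, 1:] 1" by (rule bcoeff_poly_closed)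

lift_definition bq_inv :: bcoeff is "Fract 1 (qden 1 0)" by blast

lift_definition one_minus_bq_inv :: bcoeff is "Fract 1 (qden 0 1)" by blast

lemma bq_units: "bq * bq_inv = 1" "(1 - bq) * one_minus_bq_inv = 1"
  by (transfer, simp add: qden_def One_fract_def eq_fract one_pCons)+

text \<open>\<open>q_m_plus a\<close> is \<open>q\<^sup>m\<^sup>+\<^sup>a = Q q\<^sup>a\<close> and \<open>bracket_m_plus a\<close> is \<open>[m+a]\<^sub>q = (1 - Q q\<^sup>a) / (1 - q)\<close>.\<close>

definition q_m_plus :: "int \<Rightarrow> bcoeff"
  where "q_m_plus a = bQ * (if 0 \<le> a then bq ^ nat a else bq_inv ^ nat (- a))"

definition bracket_m_plus :: "int \<Rightarrow> bcoeff"
  where "bracket_m_plus a = (1 - q_m_plus a) * one_minus_bq_inv"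

text \<open>
  \<open>specialize M f\<close> is the rational function of \<open>q\<close> obtained from \<open>f\<close> by setting \<open>Q = q\<^sup>M\<close>, as a
  function on \<open>\<real> - {0, 1}\<close>; there the value does not depend on the chosen fraction.
\<close>

definition specialize :: "nat \<Rightarrow> bcoeff \<Rightarrow> real \<Rightarrow> real" where
  "specialize M f t = (THE v. \<forall>p a b. fract_of_bcoeff f = Fract p (qden a b) \<longrightarrow>
     v = poly (poly p (monom 1 M)) t / (t ^ a * (1 - t) ^ b))"

section \<open>The relative right \<open>q\<close>-vector derivative\<close>

definition mvar :: "'i \<Rightarrow> ('i, 'k::comm_ring_1) mpoly"
  where "mvar u = Poly_Mapping.single (Poly_Mapping.single u 1) 1"

text \<open>The operator \<open>T\<close> substitutes \<open>P u\<close> for \<open>u\<close>.\<close>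

definition q_shift :: "'i \<Rightarrow> 'k \<Rightarrow> ('i, 'k::comm_ring_1) mpoly \<Rightarrow> ('i, 'k) mpoly" where
  "q_shift u P f = (\<Sum>m\<in>Poly_Mapping.keys f.
     Poly_Mapping.single m (P ^ Poly_Mapping.lookup m u * Poly_Mapping.lookup f m))"

text \<open>The quotient by \<open>(1 - P) u\<close> is the exact quotient in the polynomial ring.\<close>

definition jackson :: "'i \<Rightarrow> 'k \<Rightarrow> ('i, 'k::comm_ring_1) mpoly \<Rightarrow> ('i, 'k) mpoly" where
  "jackson u P f =
     (THE g. Poly_Mapping.single 0 (1 - P) * mvar u * g = f - q_shift u P f)"

definition scalar_q_derivative ::
  "'v \<Rightarrow> (nat \<Rightarrow> 'v) \<Rightarrow> nat \<Rightarrow> (svar, bcoeff) mpoly \<Rightarrow> ('v, bcoeff) radial" where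
  "scalar_q_derivative x y N A =
     rconst (1 + bq) * vgen x * scal x y N (jackson VR (bq ^ 2) A) +
     2 * (\<Sum>i = 1..N. vgen (y i) * scal x y N (q_shift VR (bq ^ 2) (jackson (VS i) bq A)))"

definition radial_linear :: "(('v, 'k) radial \<Rightarrow> ('v, 'k::comm_ring_1) radial) \<Rightarrow> bool" where
  "radial_linear D \<longleftrightarrow> (\<forall>F G. D (F + G) = D F + D G) \<and> (\<forall>c F. D (rconst c * F) = rconst c * D F)"

text \<open>
  Existence and uniqueness of the operator described here are the freeness and the spanning
  property, respectively, of the \<open>y\<^sub>I\<close> and \<open>x \<and> y\<^sub>I\<close> over the scalar polynomials.
\<close>

definition relative_q_derivative ::
  "'v \<Rightarrow> (nat \<Rightarrow> 'v) \<Rightarrow> nat \<Rightarrow> ('v, bcoeff) radial \<Rightarrow> ('v, bcoeff) radial" where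
  "relative_q_derivative x y N = (THE D. radial_linear D \<and>
     (\<forall>I A. I \<subseteq> {1..N} \<and> A \<in> scalar_polys N \<longrightarrow>
        D (yI y I * scal x y N A) = yI y I * scalar_q_derivative x y N A) \<and>
     (\<forall>I B. I \<subseteq> {1..N} \<and> B \<in> scalar_polys N \<longrightarrow>
        D (xyI x y I * scal x y N B) =
          (- 1) ^ card I * rconst (bracket_m_plus (- int (card I))) * yI y I * scal x y N B +
          rconst (q_m_plus (- int (card I))) * xyI x y I * scalar_q_derivative x y N B))"

text \<open>
  \<open>has_classical_limit M x y N G L\<close>: in the components of \<open>G\<close> over \<open>\<bbbB>[r, s\<^sub>i, c\<^sub>i\<^sub>j]\<close>, every coefficient,
  specialized at \<open>Q = q\<^sup>M\<close>, converges as \<open>q \<rightarrow> 1\<close>, and the limits are the coefficients of the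
  components of \<open>L\<close>.  The components are unique, since the decomposition is free.
\<close>

definition has_classical_limit ::
  "nat \<Rightarrow> 'v \<Rightarrow> (nat \<Rightarrow> 'v) \<Rightarrow> nat \<Rightarrow> ('v, bcoeff) radial \<Rightarrow> ('v, real) radial \<Rightarrow> bool" where
  "has_classical_limit M x y N G L \<longleftrightarrow>
     (\<exists>A B A' B'.
        range A \<subseteq> scalar_polys N \<and> range B \<subseteq> scalar_polys N \<and>
        range A' \<subseteq> scalar_polys N \<and> range B' \<subseteq> scalar_polys N \<and>
        G = from_components x y N A B \<and> L = from_components x y N A' B' \<and>
        (\<forall>I\<in>Pow {1..N}. \<forall>m.
           (specialize M (Poly_Mapping.lookup (A I) m) \<longlongrightarrow> Poly_Mapping.lookup (A' I) m) (at 1) \<and>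
           (specialize M (Poly_Mapping.lookup (B I) m) \<longlongrightarrow> Poly_Mapping.lookup (B' I) m) (at 1)))"

section \<open>The radial-algebra right derivative\<close>

definition mpderiv :: "'i \<Rightarrow> ('i, 'a::ring_1) mpoly \<Rightarrow> ('i, 'a) mpoly" where
  "mpderiv u f = (\<Sum>m\<in>Poly_Mapping.keys f.
     Poly_Mapping.single (m - Poly_Mapping.single u 1)
       (of_nat (Poly_Mapping.lookup m u) * Poly_Mapping.lookup f m))"

definition scalar_derivative ::
  "'v \<Rightarrow> (nat \<Rightarrow> 'v) \<Rightarrow> nat \<Rightarrow> (svar, real) mpoly \<Rightarrow> ('v, real) radial" where
  "scalar_derivative x y N A =
     2 * vgen x * scal x y N (mpderiv VR A) +
     2 * (\<Sum>i = 1..N. vgen (y i) * scal x y N (mpderiv (VS i) A))"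

definition is_radial_right_derivative ::
  "nat \<Rightarrow> 'v \<Rightarrow> (nat \<Rightarrow> 'v) \<Rightarrow> nat \<Rightarrow> (('v, real) radial \<Rightarrow> ('v, real) radial) \<Rightarrow> bool" where
  "is_radial_right_derivative M x y N D \<longleftrightarrow> radial_linear D \<and>
     (\<forall>I A. I \<subseteq> {1..N} \<and> A \<in> scalar_polys N \<longrightarrow>
        D (yI y I * scal x y N A) = yI y I * scalar_derivative x y N A) \<and>
     (\<forall>I B. I \<subseteq> {1..N} \<and> B \<in> scalar_polys N \<longrightarrow>
        D (xyI x y I * scal x y N B) =
          (- 1) ^ card I * rconst (real M - real (card I)) * yI y I * scal x y N B +
          xyI x y I * scalar_derivative x y N B)"

section \<open>Clifford realizations\<close>

text \<open>
  \<open>'m clifford\<close> is the real Clifford algebra on generators \<open>e\<^sub>j\<close> indexed by \<open>'m\<close>, of dimension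
  \<open>M = CARD('m)\<close>.
\<close>

definition clifford_relations :: "('m mword \<Rightarrow>\<^sub>0 real) set" where
  "clifford_relations =
     {letter i * letter j + letter j * letter i + (if i = j then 2 else 0) | i j. True}"

quotient_type (overloaded) 'm clifford = "'m::finite mword \<Rightarrow>\<^sub>0 real" / "ideal_cong clifford_relations"
  by (rule equivp_ideal_cong)

text \<open>
  The Clifford algebra is nontrivial: \<open>e\<^sub>i\<close> acts on functions on subsets by toggling \<open>i\<close>, up to a sign
  given by an enumeration \<open>n\<close> of the index type.
\<close>

definition cl_sgn :: "('m::finite \<Rightarrow> nat) \<Rightarrow> 'm \<Rightarrow> 'm set \<Rightarrow> real" where
  "cl_sgn n i K = (if i \<in> K then 1 else - 1) * (\<Prod>j\<in>K. if n j < n i then - 1 else 1)"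

definition cl_toggle :: "'m \<Rightarrow> 'm set \<Rightarrow> 'm set"
  where "cl_toggle i K = (if i \<in> K then K - {i} else insert i K)"

definition cl_op :: "('m::finite \<Rightarrow> nat) \<Rightarrow> 'm \<Rightarrow> ('m set \<Rightarrow> real) \<Rightarrow> 'm set \<Rightarrow> real"
  where "cl_op n i f = (\<lambda>K. cl_sgn n i K * f (cl_toggle i K))"

definition cl_act ::
  "('m::finite \<Rightarrow> nat) \<Rightarrow> ('m mword \<Rightarrow>\<^sub>0 real) \<Rightarrow> ('m set \<Rightarrow> real) \<Rightarrow> 'm set \<Rightarrow> real" where
  "cl_act n p f = (\<lambda>K. \<Sum>w\<in>Poly_Mapping.keys p.
     Poly_Mapping.lookup p w * foldr (cl_op n) (letters w) f K)"

lemma cl_sgn_toggle: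
  assumes "i \<noteq> j"
  shows "cl_sgn n j (cl_toggle i K) = (if n i < n j then - 1 else 1) * cl_sgn n j K"
proof (cases "i \<in> K")
  case True
  have "(\<Prod>l\<in>K. if n l < n j then - 1 else 1 :: real) =
      (if n i < n j then - 1 else 1) * (\<Prod>l\<in>K - {i}. if n l < n j then - 1 else 1)"
    using True by (intro prod.remove) auto
  then show ?thesis using True assms by (auto simp: cl_sgn_def cl_toggle_def)
next
  case False
  then have "(\<Prod>l\<in>insert i K. if n l < n j then - 1 else 1 :: real) =
      (if n i < n j then - 1 else 1) * (\<Prod>l\<in>K. if n l < n j then - 1 else 1)"
    by (intro prod.insert) auto
  then show ?thesis using False assms by (auto simp: cl_sgn_def cl_toggle_def)
qed

lemma cl_sgn_square: "cl_sgn n i K * cl_sgn n i (cl_toggle i K) = - 1"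
proof -
  define s where "s L = (\<Prod>l\<in>L. if n l < n i then - 1 else 1 :: real)" for L
  have s_sq: "s L * s L = 1" for L
    unfolding s_def by (subst prod.distrib[symmetric]) (rule prod.neutral, auto)
  have "s (cl_toggle i K) = s K"
  proof (cases "i \<in> K")
    case True
    then show ?thesis using prod.remove[of K i "\<lambda>l. if n l < n i then - 1 else 1 :: real"]
      by (simp add: s_def cl_toggle_def)
  qed (simp add: s_def cl_toggle_def)
  moreover have "cl_sgn n i L = (if i \<in> L then 1 else - 1) * s L" for L
    by (simp add: cl_sgn_def s_def)
  ultimately show ?thesis using s_sq[of K] by (auto simp: cl_toggle_def)
qed

lemma cl_op_anticommute:
  assumes "inj n"
  shows "cl_op n i (cl_op n j f) K + cl_op n j (cl_op n i f) K = (if i = j then - 2 * f K else 0)"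
proof (cases "i = j")
  case True
  have "cl_toggle i (cl_toggle i K) = K" by (auto simp: cl_toggle_def)
  then have "cl_op n i (cl_op n i f) K = (cl_sgn n i K * cl_sgn n i (cl_toggle i K)) * f K"
    by (simp add: cl_op_def mult.assoc)
  then show ?thesis using True by (simp only: cl_sgn_square) simp
next
  case False
  have "cl_toggle j (cl_toggle i K) = cl_toggle i (cl_toggle j K)"
    by (auto simp: cl_toggle_def)
  moreover have "n i \<noteq> n j" using False assms by (auto dest: injD)
  ultimately show ?thesis
    using False by (auto simp: cl_op_def cl_sgn_toggle not_less_iff_gr_or_eq)
qed

lemma cl_act_superset:
  assumes "finite W" "Poly_Mapping.keys p \<subseteq> W"
  shows "cl_act n p f K = (\<Sum>w\<in>W. Poly_Mapping.lookup p w * foldr (cl_op n) (letters w) f K)"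
  unfolding cl_act_def using assms
  by (intro sum.mono_neutral_left) (auto simp: in_keys_iff)

lemma cl_act_add: "cl_act n (p + q) f = (\<lambda>K. cl_act n p f K + cl_act n q f K)"
proof
  fix K
  let ?W = "Poly_Mapping.keys p \<union> Poly_Mapping.keys q"
  show "cl_act n (p + q) f K = cl_act n p f K + cl_act n q f K"
    using Poly_Mapping.keys_add[of p q]
    by (simp add: cl_act_superset[of ?W] lookup_add distrib_right sum.distrib)
qed

lemma cl_act_single:
  "cl_act n (Poly_Mapping.single w c) f = (\<lambda>K. c * foldr (cl_op n) (letters w) f K)"
  by (rule ext, subst cl_act_superset[of "{w}"]) auto

lemma cl_op_linear:
  "cl_op n i (\<lambda>K. f K + g K) = (\<lambda>K. cl_op n i f K + cl_op n i g K)"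
  "cl_op n i (\<lambda>K. c * f K) = (\<lambda>K. c * cl_op n i f K)"
  by (auto simp: cl_op_def algebra_simps)

lemma foldr_cl_op_linear:
  "foldr (cl_op n) ws (\<lambda>K. f K + g K) = (\<lambda>K. foldr (cl_op n) ws f K + foldr (cl_op n) ws g K)"
  "foldr (cl_op n) ws (\<lambda>K. c * f K) = (\<lambda>K. c * foldr (cl_op n) ws f K)"
  by (induction ws) (simp_all add: cl_op_linear)

lemma cl_act_linear_arg: "cl_act n p (\<lambda>K. f K + g K) = (\<lambda>K. cl_act n p f K + cl_act n p g K)"
  by (simp add: cl_act_def foldr_cl_op_linear distrib_left sum.distrib)

lemma cl_act_mult: "cl_act n (p * q) f = cl_act n p (cl_act n q f)"
proof (induction p rule: poly_mapping_single_induct)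
  case (single v c)
  show ?case
  proof (induction q rule: poly_mapping_single_induct)
    case (single w d)
    show ?case
      by (simp add: mult_single cl_act_single plus_mword_def foldr_cl_op_linear mult.assoc)
  next
    case (add q1 q2)
    then show ?case by (simp add: distrib_left cl_act_add cl_act_linear_arg)
  qed
next
  case (add p1 p2)
  then show ?case by (simp add: distrib_right cl_act_add)
qed

lemma letters_zero: "letters 0 = []"
  by (simp add: zero_mword_def)

lemma cl_act_ideal:
  assumes "inj n" "p \<in> two_sided_ideal clifford_relations"
  shows "cl_act n p f = (\<lambda>K. 0)"
  using assms(2)
proof (induction arbitrary: f rule: two_sided_ideal.induct)
  case zero
  show ?case by (simp add: cl_act_def)
next
  case (gen g a b)
  have letter: "cl_act n (letter i) h = cl_op n i h" for i h
    by (simp add: letter_def cl_act_single)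
  have two: "cl_act n 2 h = (\<lambda>K. 2 * h K)" for h
    using cl_act_single[of n 0 2 h] by (simp add: letters_zero)
  have null: "cl_act n 0 h = (\<lambda>K. 0)" for h
    by (simp add: cl_act_def)
  have "cl_act n g h = (\<lambda>K. 0)" for h
    using gen cl_op_anticommute[OF assms(1)] unfolding clifford_relations_def
    by (force simp: cl_act_add cl_act_mult letter two null)
  then have "cl_act n (a * g * b) f = cl_act n a (\<lambda>K. 0)"
    by (simp add: cl_act_mult)
  also have "\<dots> = (\<lambda>K. 0)"
    using foldr_cl_op_linear(2)[of n _ 0 "\<lambda>K. 0"] by (simp add: cl_act_def)
  finally show ?case .
next
  case (add u v)
  then show ?case by (simp add: cl_act_add)
qed

lemma one_notin_clifford_ideal: "(1 :: 'm::finite mword \<Rightarrow>\<^sub>0 real) \<notin> two_sided_ideal clifford_relations"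
proof
  assume *: "(1 :: 'm mword \<Rightarrow>\<^sub>0 real) \<in> two_sided_ideal clifford_relations"
  obtain n :: "'m \<Rightarrow> nat" where "inj n"
    using finite_imp_inj_to_nat_seg[of "UNIV :: 'm set"] by auto
  from cl_act_ideal[OF this *, of "\<lambda>K. 1"] have "cl_act n 1 (\<lambda>K. 1) = (\<lambda>K. 0)" .
  moreover have "cl_act n 1 (\<lambda>K. 1) = (\<lambda>K. 1)"
    using cl_act_single[of n 0 1 "\<lambda>K. 1"] by (simp add: letters_zero)
  ultimately show False by (metis zero_neq_one)
qed

instantiation clifford :: (finite) ring_1
begin
lift_definition zero_clifford :: "'m::finite clifford" is 0 .
lift_definition one_clifford :: "'m::finite clifford" is 1 .
lift_definition plus_clifford :: "'m::finite clifford \<Rightarrow> 'm clifford \<Rightarrow> 'm clifford"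
  is "(+)" by (rule ideal_cong_add)
lift_definition uminus_clifford :: "'m::finite clifford \<Rightarrow> 'm clifford"
  is uminus by (rule ideal_cong_uminus)
lift_definition minus_clifford :: "'m::finite clifford \<Rightarrow> 'm clifford \<Rightarrow> 'm clifford"
  is "(-)" by (rule ideal_cong_diff)
lift_definition times_clifford :: "'m::finite clifford \<Rightarrow> 'm clifford \<Rightarrow> 'm clifford"
  is "(*)" by (rule ideal_cong_mult)
instance
proof
  show "(0 :: 'm::finite clifford) \<noteq> 1"
  proof (transfer, rule notI)
    assume "ideal_cong clifford_relations (0 :: 'm mword \<Rightarrow>\<^sub>0 real) 1"
    then show False
      using two_sided_ideal_uminus[of "0 - 1 :: 'm mword \<Rightarrow>\<^sub>0 real" clifford_relations] one_notin_clifford_ideal[where 'm = 'm]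
      by (simp add: ideal_cong_def)
  qed
qed (transfer, simp add: algebra_simps ideal_cong_refl)+
end

lift_definition cgen :: "'m::finite \<Rightarrow> 'm clifford" is letter .

lift_definition cconst :: "real \<Rightarrow> 'm::finite clifford" is "Poly_Mapping.single 0" .

text \<open>
  The coordinates are \<open>x\<^sub>j = Inl j\<close> and arbitrary further variables \<open>Inr w\<close>, so that the
  components \<open>y\<^sub>i\<^sub>j\<close> may be independent indeterminates, real numbers, or polynomials in other
  coordinates.
\<close>

type_synonym ('m, 'w) clifford_poly = "('m + 'w, 'm clifford) mpoly"

definition clifford_realization ::
  "'v \<Rightarrow> (nat \<Rightarrow> 'v) \<Rightarrow> nat \<Rightarrow> (('v, real) radial \<Rightarrow> ('m::finite, 'w) clifford_poly) \<Rightarrow> bool" where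
  "clifford_realization x y N \<phi> \<longleftrightarrow>
     \<phi> 1 = 1 \<and>
     (\<forall>F G. \<phi> (F + G) = \<phi> F + \<phi> G) \<and>
     (\<forall>F G. \<phi> (F * G) = \<phi> F * \<phi> G) \<and>
     (\<forall>c F. \<phi> (rconst c * F) = Poly_Mapping.single 0 (cconst c) * \<phi> F) \<and>
     \<phi> (vgen x) =
       (\<Sum>j\<in>UNIV. Poly_Mapping.single (Poly_Mapping.single (Inl j) 1) 1 *
                    Poly_Mapping.single 0 (cgen j)) \<and>
     (\<exists>yc :: nat \<Rightarrow> 'm \<Rightarrow> ('m + 'w, real) mpoly.
        (\<forall>i\<in>{1..N}. \<forall>j. \<forall>m\<in>Poly_Mapping.keys (yc i j). \<forall>k. Poly_Mapping.lookup m (Inl k) = 0) \<and>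
        (\<forall>i\<in>{1..N}. \<phi> (vgen (y i)) =
           (\<Sum>j\<in>UNIV. Poly_Mapping.map cconst (yc i j) * Poly_Mapping.single 0 (cgen j))))"

definition clifford_right_derivative ::
  "('m::finite, 'w) clifford_poly \<Rightarrow> ('m, 'w) clifford_poly" where
  "clifford_right_derivative F =
     - (\<Sum>j\<in>UNIV. mpderiv (Inl j) F * Poly_Mapping.single 0 (cgen j))"

end

(* The wedges of a set J of generators satisfy the Laplace expansion along their first factor, and
   this recursion alone yields, in any ring where the anticommutators of the generators are central,
   the formula for multiplying a wedge by a generator, the rule for moving a vector past a wedge, and
   the expansion along the last factor. The first formula shows that the wedges span the radial
   algebra over the scalars; they are independent because the formula defines a representation on
   the free module (creation operators plus half the contracted annihilation operators) in which a
   wedge sends the vacuum to the corresponding basis vector. So an operator is determined by, and may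
   be prescribed through, its values on the decomposition. On a monomial the coefficients of the
   q-derivative are q-numbers, whose limits at q = 1 give the radial derivative. In a Clifford
   realization the right derivative is a derivation along the central scalars, and on x wedge y_I it
   is evaluated by moving e_j past y_I in the sum of all e_j y_I e_j. *)

theory Submission
  imports Defs "Jordan_Normal_Form.Determinant"
begin

section \<open>Laplace expansions of wedges\<close>

text \<open>The q-derivative is a definite description, so freeness and spanning have to be proved
  before it can be evaluated at all. Giving x the index 0 merges the two families into wedges
  \<open>E J\<close> with J a subset of {0..N}; as 0 is the least index, x stands in front without a
  sign. The Laplace recursion serves as interface because it uses only ring operations: a unital
  ring homomorphism transports it, so the same formulas hold for images in a Clifford algebra even
  where a realization is not injective. Formulas carry a factor 2 or \<open>card J\<close> that is
  cancelled afterwards, since a general ring has no division. The obstacle for the limit is that y_I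
  times a vector is not a basis element, so its components are not explicit. The way out is that q
  enters only through scalar factors: on a real monomial the q-derivative is a sum of terms c times
  the base change of a real element H. The coordinates of H have real coefficients, so only the
  limit of c matters.\<close>

definition sg :: "nat set \<Rightarrow> nat \<Rightarrow> 'a::ring_1"
  where "sg J j = (- 1) ^ card {i\<in>J. i < j}"

lemma sg_cases: "sg J j = (1 :: 'a::ring_1) \<or> sg J j = (- 1 :: 'a)"
  by (simp add: sg_def minus_one_power_iff)

lemma sg_left_commute: "a * (sg J j * b) = sg J j * (a * b)"
  using sg_cases[of J j, where 'a = 'a] by (elim disjE) simp_all

lemma sg_square: "sg J j * (sg J j * a) = a"
  using sg_cases[of J j, where 'a = 'a] by (elim disjE) simp_all

lemma sg_insert_self: "sg (insert j J) j = (sg J j :: 'a::ring_1)"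
proof -
  have "{i \<in> insert j J. i < j} = {i \<in> J. i < j}" by auto
  then show ?thesis by (simp add: sg_def)
qed

lemma sg_remove_self: "sg (J - {j}) j = (sg J j :: 'a::ring_1)"
proof -
  have "{i \<in> J - {j}. i < j} = {i \<in> J. i < j}" by auto
  then show ?thesis by (simp add: sg_def)
qed

lemma sg_zero: "sg J 0 = 1"
  by (simp add: sg_def)

lemma sg_remove:
  assumes "i \<in> J"
  shows "sg (J - {i}) j = (if i < j then - sg J j else sg J j :: 'a::ring_1)"
proof (cases "i < j")
  case True
  have "{k \<in> J. k < j} = insert i {k \<in> J - {i}. k < j}"
    using True assms by auto
  then have "card {k \<in> J. k < j} = Suc (card {k \<in> J - {i}. k < j})"
    by simp
  then show ?thesis using True by (simp add: sg_def)
next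
  case False
  then have "{k \<in> J - {i}. k < j} = {k \<in> J. k < j}" by auto
  then show ?thesis using False by (simp add: sg_def)
qed

text \<open>Deleting a smaller index flips the sign of a larger one, and exactly one of i < j and j
  < i holds. This minus sign drives the cancellations of double sums below.\<close>

lemma sg_exchange:
  assumes "i \<in> J" "j \<in> J" "i \<noteq> j"
  shows "sg J i * (sg (J - {i}) j * a) = - (sg J j * (sg (J - {j}) i * a))"
  using assms sg_cases[of J i, where 'a = 'a] sg_cases[of J j, where 'a = 'a]
  by (auto simp: sg_remove not_less_iff_gr_or_eq)

lemma sum_swap_remove:
  assumes "finite J"
  shows "(\<Sum>i\<in>J. \<Sum>j\<in>J - {i}. F i j) = (\<Sum>j\<in>J. \<Sum>i\<in>J - {j}. F i j)"
proof -
  have *: "(\<Sum>j\<in>J - {i}. G j) = (\<Sum>j\<in>J. if j = i then 0 else G j)" for i :: 'a and G :: "'a \<Rightarrow> 'b"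
    using assms by (intro sum.mono_neutral_cong_left) auto
  show ?thesis
    unfolding * by (subst sum.swap) (intro sum.cong refl, auto)
qed

section \<open>Central elements of a noncommutative ring\<close>

definition central :: "'a::ring_1 \<Rightarrow> bool"
  where "central z \<longleftrightarrow> (\<forall>a. z * a = a * z)"

lemma centralI: "(\<And>a. z * a = a * z) \<Longrightarrow> central z"
  by (simp add: central_def)

lemma centralD: "central z \<Longrightarrow> z * a = a * z"
  by (simp add: central_def)

lemma central_left_commute: "central z \<Longrightarrow> a * (z * b) = z * (a * b)"
  by (metis centralD mult.assoc)

lemma central_mult: "central z \<Longrightarrow> central w \<Longrightarrow> central (z * w)"
  by (metis centralD centralI mult.assoc)

lemma central_power: "central z \<Longrightarrow> central (z ^ n)"
  by (induction n) (simp_all add: central_mult, simp add: central_def)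

lemma central_prod_list: "(\<And>z. z \<in> set zs \<Longrightarrow> central z) \<Longrightarrow> central (prod_list zs)"
  by (induction zs) (simp_all add: central_mult, simp add: central_def)

lemma add_eq_if_eq_diff: "x = w - z \<Longrightarrow> y = w \<Longrightarrow> x + z = (y :: 'a::ab_group_add)"
  by simp

lemma eq_add_if_diff_eq:
  "u - a = - b - c \<Longrightarrow> d = u + c \<Longrightarrow> a = b + (d :: 'a::ab_group_add)"
  by (metis (no_types, opaque_lifting) add.assoc add.commute diff_add_cancel diff_minus_eq_add
      minus_diff_eq)

text \<open>Laplace expansion along the first factor characterizes the normalized wedges \<open>E J\<close>.\<close>

locale wedge_system =
  fixes g :: "nat \<Rightarrow> 'a::ring_1" and E :: "nat set \<Rightarrow> 'a"
  assumes E_empty: "E {} = 1"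
    and E_laplace: "finite J \<Longrightarrow> of_nat (card J) * E J = (\<Sum>j\<in>J. sg J j * (g j * E (J - {j})))"
    and of_nat_cancel: "0 < n \<Longrightarrow> of_nat n * a = of_nat n * (b :: 'a) \<Longrightarrow> a = b"
    and acomm_central: "central (acomm (g i) (g j))"
begin

lemma mult_of_nat_left: "v * (of_nat n * a) = of_nat n * (v * (a :: 'a))"
  by (metis mult.assoc mult_of_nat_commute)

text \<open>A central weight \<open>c j\<close> leaves the outer factor. Swapping the two sums and
  exchanging the two signs, which costs a minus, leaves for each j a full Laplace sum over J - {j},
  worth card J - 1 copies of its wedge.\<close>

lemma double_laplace:
  assumes "finite J" and c: "\<And>j. j \<in> J \<Longrightarrow> central (c j)"
  shows "(\<Sum>i\<in>J. sg J i * (g i * (\<Sum>j\<in>J - {i}. sg (J - {i}) j * (c j * E (J - {i} - {j})))))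
    = - (of_nat (card J - 1) * (\<Sum>j\<in>J. sg J j * (c j * E (J - {j}))))"
proof -
  have "(\<Sum>i\<in>J. sg J i * (g i * (\<Sum>j\<in>J - {i}. sg (J - {i}) j * (c j * E (J - {i} - {j})))))
      = (\<Sum>i\<in>J. \<Sum>j\<in>J - {i}. - (sg J j * (c j * (sg (J - {j}) i * (g i * E (J - {j} - {i}))))))"
    unfolding sum_distrib_left
  proof (intro sum.cong refl)
    fix i j assume ij: "i \<in> J" "j \<in> J - {i}"
    have "g i * (c j * E (J - {i} - {j})) = c j * (g i * E (J - {i} - {j}))"
      using c[of j] ij by (intro central_left_commute) simp
    moreover have "J - {i} - {j} = J - {j} - {i}" by auto
    ultimately show "sg J i * (g i * (sg (J - {i}) j * (c j * E (J - {i} - {j})))) =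
        - (sg J j * (c j * (sg (J - {j}) i * (g i * E (J - {j} - {i})))))"
      using assms(1) ij sg_exchange[of i J j "c j * (g i * E (J - {j} - {i}))"]
      by (simp add: sg_left_commute[of "g i"] sg_left_commute[of "c j"])
  qed
  also have "\<dots> = (\<Sum>j\<in>J. \<Sum>i\<in>J - {j}. - (sg J j * (c j * (sg (J - {j}) i * (g i * E (J - {j} - {i}))))))"
    by (rule sum_swap_remove[OF assms(1)])
  also have "\<dots> = (\<Sum>j\<in>J. - (sg J j * (c j * (of_nat (card (J - {j})) * E (J - {j})))))"
    using assms(1) by (simp only: E_laplace finite_Diff sum_negf sum_distrib_left)
  also have "\<dots> = (\<Sum>j\<in>J. - (of_nat (card J - 1) * (sg J j * (c j * E (J - {j})))))"
  proof (intro sum.cong refl)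
    fix j assume "j \<in> J"
    then have "card (J - {j}) = card J - 1" using assms(1) by simp
    then show "- (sg J j * (c j * (of_nat (card (J - {j})) * E (J - {j})))) =
        - (of_nat (card J - 1) * (sg J j * (c j * E (J - {j}))))"
      by (simp only: mult_of_nat_left)
  qed
  finally show ?thesis by (simp add: sum_negf sum_distrib_left)
qed

text \<open>Pulling v back in front of the first factor costs one anticommutator per term, and what
  remains is again a Laplace sum. Evaluating the left side a second time by induction yields both
  commutation formulas below.\<close>

lemma sum_mult_swap:
  assumes "finite J"
  shows "(\<Sum>i\<in>J. sg J i * (g i * (v * E (J - {i})))) =
    (\<Sum>i\<in>J. sg J i * (acomm (g i) v * E (J - {i}))) - of_nat (card J) * (v * E J)"
proof -
  have "g i * (v * b) = acomm (g i) v * b - v * (g i * b)" for i b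
    by (simp add: acomm_def algebra_simps)
  then have "(\<Sum>i\<in>J. sg J i * (g i * (v * E (J - {i})))) =
      (\<Sum>i\<in>J. sg J i * (acomm (g i) v * E (J - {i}))) - (\<Sum>i\<in>J. v * (sg J i * (g i * E (J - {i}))))"
    by (simp add: right_diff_distrib sum_subtractf sg_left_commute[of v])
  also have "(\<Sum>i\<in>J. v * (sg J i * (g i * E (J - {i})))) = of_nat (card J) * (v * E J)"
    by (simp only: E_laplace[OF assms] sum_distrib_left[symmetric] mult_of_nat_left[symmetric])
  finally show ?thesis .
qed

text \<open>The sum with v inserted after the first factor is computed twice: by
  \<open>sum_mult_swap\<close>, and by moving v past the shorter wedge with the induction
  hypothesis. Comparison gives card J times the claim. Allowing any v with central anticommutators
  covers the e_k of a Clifford algebra, which are not among the \<open>g i\<close>.\<close>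

lemma vector_wedge_commute:
  assumes "finite J" "\<And>j. j \<in> J \<Longrightarrow> central (acomm (g j) v)"
  shows "v * E J = (- 1) ^ card J * (E J * v) + (\<Sum>j\<in>J. sg J j * (acomm (g j) v * E (J - {j})))"
  using assms
proof (induction J rule: finite_psubset_induct)
  case (psubset J)
  show ?case
  proof (cases "J = {}")
    case True
    then show ?thesis by (simp add: E_empty)
  next
    case False
    define p where "p = card J"
    have p: "p > 0" using False psubset by (simp add: p_def card_gt_0_iff)
    let ?X = "\<Sum>j\<in>J. sg J j * (acomm (g j) v * E (J - {j}))"
    have "?X - of_nat p * (v * E J) = (\<Sum>i\<in>J. sg J i * (g i * (v * E (J - {i}))))"
      using sum_mult_swap[OF psubset(1), of v] by (simp add: p_def)
    also have "\<dots> = (\<Sum>i\<in>J. sg J i * (g i * ((- 1) ^ (p - 1) * (E (J - {i}) * v) +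
        (\<Sum>j\<in>J - {i}. sg (J - {i}) j * (acomm (g j) v * E (J - {i} - {j}))))))"
    proof (intro sum.cong refl)
      fix i assume i: "i \<in> J"
      have "v * E (J - {i}) = (- 1) ^ (p - 1) * (E (J - {i}) * v) +
        (\<Sum>j\<in>J - {i}. sg (J - {i}) j * (acomm (g j) v * E (J - {i} - {j})))"
        using psubset.IH[of "J - {i}"] psubset.prems i psubset(1) by (auto simp: p_def)
      then show "sg J i * (g i * (v * E (J - {i}))) = sg J i * (g i * ((- 1) ^ (p - 1) * (E (J -
          {i}) * v) +
        (\<Sum>j\<in>J - {i}. sg (J - {i}) j * (acomm (g j) v * E (J - {i} - {j})))))" by simp
    qed
    also have "\<dots> = (\<Sum>i\<in>J. (- 1) ^ (p - 1) * (sg J i * (g i * E (J - {i})) * v)) - of_nat (p - 1) * ?X"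
      using double_laplace[OF psubset(1), of "\<lambda>j. acomm (g j) v"] psubset.prems
      by (simp add: distrib_left sum.distrib p_def, intro sum.cong refl, simp
          add: minus_one_power_iff mult.assoc)
    also have "(\<Sum>i\<in>J. (- 1) ^ (p - 1) * (sg J i * (g i * E (J - {i})) * v)) =
        (- 1) ^ (p - 1) * (of_nat p * (E J * v))"
      by (simp only: sum_distrib_left[symmetric] sum_distrib_right[symmetric] p_def
          E_laplace[OF psubset(1), symmetric]) (simp only: mult.assoc)
    also have "(- 1) ^ (p - 1) * (of_nat p * (E J * v)) = - (of_nat p * ((- 1) ^ p * (E J * v)))"
      using p by (cases p) (simp_all add: minus_one_power_iff)
    finally have "?X - of_nat p * (v * E J) = - (of_nat p * ((- 1) ^ p * (E J * v))) - of_nat (p -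
        1) * ?X" .
    \<comment> \<open>Of the p copies of the contraction, one comes from the direct evaluation and p
      - 1 come from \<open>double_laplace\<close>.\<close>
    moreover have "(of_nat p :: 'a) = 1 + of_nat (p - 1)"
      using p by (cases p) simp_all
    then have "of_nat p * ?X = ?X + of_nat (p - 1) * ?X"
      by (simp only: distrib_right mult_1)
    ultimately have "of_nat p * (v * E J) = of_nat p * ((- 1) ^ p * (E J * v) + ?X)"
      unfolding distrib_left by (rule eq_add_if_diff_eq)
    then show ?thesis using of_nat_cancel[OF p] by (simp add: p_def)
  qed
qed

text \<open>Moving each first factor to the end leaves a double sum S of anticommutators. These are
  symmetric in the two indices while the signs are antisymmetric, so S = - S, and S = 0 because 2
  can be cancelled.\<close>

lemma laplace_last:
  assumes "finite J" "J \<noteq> {}"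
  shows "(\<Sum>j\<in>J. sg J j * (E (J - {j}) * g j)) = (- 1) ^ (card J - 1) * (of_nat (card J) * E J)"
proof -
  define S where "S = (\<Sum>i\<in>J. \<Sum>j\<in>J - {i}. sg J i * (sg (J - {i}) j * (acomm (g j) (g i) * E (J - {i}
      - {j}))))"
  have "S = (\<Sum>j\<in>J. \<Sum>i\<in>J - {j}. sg J i * (sg (J - {i}) j * (acomm (g j) (g i) * E (J - {i} - {j}))))"
    unfolding S_def by (rule sum_swap_remove[OF assms(1)])
  also have "\<dots> = (\<Sum>j\<in>J. \<Sum>i\<in>J - {j}. - (sg J j * (sg (J - {j}) i * (acomm (g i) (g j) * E (J - {j} -
      {i})))))"
  proof (intro sum.cong refl)
    fix i j assume ij: "j \<in> J" "i \<in> J - {j}"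
    have "J - {i} - {j} = J - {j} - {i}" by auto
    then show "sg J i * (sg (J - {i}) j * (acomm (g j) (g i) * E (J - {i} - {j}))) =
        - (sg J j * (sg (J - {j}) i * (acomm (g i) (g j) * E (J - {j} - {i}))))"
      using ij assms(1) by (subst sg_exchange) (auto simp: acomm_def add.commute)
  qed
  also have "\<dots> = - S"
    by (simp add: S_def sum_negf)
  finally have "of_nat 2 * S = of_nat 2 * 0"
    by (metis add.right_inverse mult_2 mult_zero_right of_nat_numeral)
  then have S0: "S = 0" using of_nat_cancel[of 2 S 0] by simp
  have "of_nat (card J) * E J = (\<Sum>i\<in>J. sg J i * (g i * E (J - {i})))"
    by (rule E_laplace[OF assms(1)])
  also have "\<dots> = (\<Sum>i\<in>J. (- 1) ^ (card J - 1) * (sg J i * (E (J - {i}) * g i)) +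
      (\<Sum>j\<in>J - {i}. sg J i * (sg (J - {i}) j * (acomm (g j) (g i) * E (J - {i} - {j})))))"
  proof (intro sum.cong refl)
    fix i assume i: "i \<in> J"
    show "sg J i * (g i * E (J - {i})) = (- 1) ^ (card J - 1) * (sg J i * (E (J - {i}) * g i)) +
      (\<Sum>j\<in>J - {i}. sg J i * (sg (J - {i}) j * (acomm (g j) (g i) * E (J - {i} - {j}))))"
      using assms(1) i acomm_central
      by (subst vector_wedge_commute) (auto simp: distrib_left sum_distrib_left minus_one_power_iff)
  qed
  also have "\<dots> = (- 1) ^ (card J - 1) * (\<Sum>i\<in>J. sg J i * (E (J - {i}) * g i)) + S"
    by (simp add: sum.distrib S_def sum_distrib_left)
  finally show ?thesis using S0 by (simp add: minus_one_power_iff)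
qed

text \<open>The exterior product of \<open>g a\<close> with the wedge over J: zero for a repeated
  factor, otherwise the sign sorts a into place.\<close>

definition E_ext :: "nat \<Rightarrow> nat set \<Rightarrow> 'a"
  where "E_ext a J = (if a \<in> J then 0 else sg J a * E (insert a J))"

text \<open>In the expansion of the wedge over insert a J, the term of a is the bare product, and
  every other term changes sign as a moves past the removed factor. For a in J both sides vanish:
  only i = a contributes to the sum, and it returns \<open>g a * E J\<close>.\<close>

lemma E_ext_laplace:
  assumes "finite J"
  shows "of_nat (Suc (card J)) * E_ext a J = g a * E J - (\<Sum>i\<in>J. sg J i * (g i * E_ext a (J - {i})))"
proof (cases "a \<in> J")
  case True
  have "(\<Sum>i\<in>J. sg J i * (g i * E_ext a (J - {i}))) = (\<Sum>i\<in>{a}. sg J i * (g i * E_ext a (J - {i})))"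
    using True assms by (intro sum.mono_neutral_right) (auto simp: E_ext_def)
  also have "\<dots> = g a * E J"
    using True by (simp add: E_ext_def sg_remove_self sg_left_commute[of "g a"] sg_square insert_absorb)
  finally show ?thesis using True by (simp add: E_ext_def)
next
  case False
  let ?K = "insert a J"
  have "of_nat (Suc (card J)) * E_ext a J = sg J a * (of_nat (card ?K) * E ?K)"
    using False assms by (simp add: E_ext_def algebra_simps sg_left_commute[of "of_nat n" for n])
  also have "\<dots> = sg J a * (sg ?K a * (g a * E J)) +
      (\<Sum>i\<in>J. sg J a * (sg ?K i * (g i * E (?K - {i}))))"
    using False assms by (subst E_laplace) (auto simp: distrib_left sum_distrib_left)
  also have "sg J a * (sg ?K a * (g a * E J)) = g a * E J"
    by (simp add: sg_insert_self sg_square)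
  also have "(\<Sum>i\<in>J. sg J a * (sg ?K i * (g i * E (?K - {i})))) =
      (\<Sum>i\<in>J. - (sg J i * (g i * E_ext a (J - {i}))))"
  proof (intro sum.cong refl)
    fix i assume i: "i \<in> J"
    then have *: "?K - {i} = insert a (J - {i})" "a \<noteq> i" using False by auto
    have exch: "sg J a * (sg ?K i * b) = - (sg J i * (sg (J - {i}) a * b))" for b
    proof -
      have "?K - {a} = J" using False by auto
      then have "sg J a * (sg J i * (sg (J - {i}) a * b)) = - (sg ?K i * b)"
        using sg_exchange[of a ?K i "sg (J - {i}) a * b"] assms i *
        by (simp add: sg_insert_self sg_square)
      then have "sg J a * (sg J a * (sg J i * (sg (J - {i}) a * b))) = - (sg J a * (sg ?K i * b))"
        by simp
      then show ?thesis by (simp add: sg_square)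
    qed
    show "sg J a * (sg ?K i * (g i * E (?K - {i}))) = - (sg J i * (g i * E_ext a (J - {i})))"
      using exch[of "g i * E (insert a (J - {i}))"] * False
          by (simp add: E_ext_def sg_left_commute[of "g i"])
  qed
  finally show ?thesis by (simp add: sum_negf)
qed

text \<open>The Clifford product formula, exterior product plus half the contraction, doubled to
  avoid division. The induction hypothesis rewrites \<open>E_ext a (J - {i})\<close> inside
  \<open>E_ext_laplace\<close>; \<open>sum_mult_swap\<close> and \<open>double_laplace\<close>
  evaluate the two sums that result.\<close>

lemma vector_mult_wedge:
  assumes "finite J"
  shows "2 * (g a * E J) = 2 * E_ext a J + (\<Sum>j\<in>J. sg J j * (acomm (g j) (g a) * E (J - {j})))"
  using assms
proof (induction J rule: finite_psubset_induct)
  case (psubset J)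
  let ?X = "\<Sum>j\<in>J. sg J j * (acomm (g j) (g a) * E (J - {j}))"
  let ?p = "of_nat (card J) :: 'a"
  have "2 * (of_nat (Suc (card J)) * E_ext a J) =
      2 * (g a * E J) - (\<Sum>i\<in>J. sg J i * (g i * (2 * E_ext a (J - {i}))))"
    unfolding E_ext_laplace[OF psubset(1)]
    by (simp add: right_diff_distrib sum_distrib_left distrib_left mult_2)
  also have "(\<Sum>i\<in>J. sg J i * (g i * (2 * E_ext a (J - {i})))) =
      (\<Sum>i\<in>J. sg J i * (g i * (2 * (g a * E (J - {i})) -
        (\<Sum>j\<in>J - {i}. sg (J - {i}) j * (acomm (g j) (g a) * E (J - {i} - {j}))))))"
  proof (intro sum.cong refl)
    fix i assume i: "i \<in> J"
    have "2 * E_ext a (J - {i}) = 2 * (g a * E (J - {i})) -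
        (\<Sum>j\<in>J - {i}. sg (J - {i}) j * (acomm (g j) (g a) * E (J - {i} - {j})))"
    proof -
      have "J - {i} \<subset> J" using i by auto
      from psubset.IH[OF this] show ?thesis by (simp only: eq_diff_eq)
    qed
    then show "sg J i * (g i * (2 * E_ext a (J - {i}))) = sg J i * (g i * (2 * (g a * E (J - {i})) -
        (\<Sum>j\<in>J - {i}. sg (J - {i}) j * (acomm (g j) (g a) * E (J - {i} - {j})))))" by simp
  qed
  also have "\<dots> = 2 * (\<Sum>i\<in>J. sg J i * (g i * (g a * E (J - {i})))) + of_nat (card J - 1) * ?X"
    using double_laplace[OF psubset(1), of "\<lambda>j. acomm (g j) (g a)"] acomm_central
    by (simp add: right_diff_distrib sum_subtractf)
      (simp add: mult_2 distrib_left sum.distrib)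
  also have "\<dots> = 2 * ?X - 2 * (?p * (g a * E J)) + of_nat (card J - 1) * ?X"
    using sum_mult_swap[OF psubset(1), of "g a"] by (simp add: right_diff_distrib)
  \<comment> \<open>The coefficient 2 + (card J - 1) equals card J + 1 only for nonempty J. For
    empty J the truncated difference gives 2 instead of 1, but then \<open>?X\<close> is 0.\<close>
  also have "2 * ?X + of_nat (card J - 1) * ?X = of_nat (Suc (card J)) * ?X"
  proof (cases "card J")
    case 0
    then have "J = {}" using psubset(1) by simp
    then show ?thesis by simp
  next
    case (Suc n)
    then show ?thesis by (simp add: algebra_simps mult_2)
  qed
  then have "2 * ?X - 2 * (?p * (g a * E J)) + of_nat (card J - 1) * ?X =
      of_nat (Suc (card J)) * ?X - 2 * (?p * (g a * E J))"
    by (simp add: algebra_simps)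
  finally have "of_nat (Suc (card J)) * (2 * E_ext a J) =
      2 * (g a * E J) + ?p * (2 * (g a * E J)) - of_nat (Suc (card J)) * ?X"
    by (simp only: mult_of_nat_left[of 2]) (simp only: diff_diff_eq2 add.commute)
  moreover have "of_nat (Suc (card J)) * (2 * (g a * E J)) = 2 * (g a * E J) + ?p * (2 * (g a * E J))"
    by (simp only: of_nat_Suc distrib_right mult_1)
  ultimately have "of_nat (Suc (card J)) * (2 * E_ext a J) + of_nat (Suc (card J)) * ?X =
      of_nat (Suc (card J)) * (2 * (g a * E J))"
    by (rule add_eq_if_eq_diff)
  then have "of_nat (Suc (card J)) * (2 * (g a * E J)) = of_nat (Suc (card J)) * (2 * E_ext a J + ?X)"
    by (simp only: distrib_left)
  then show ?case by (rule of_nat_cancel[rotated]) simp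
qed

text \<open>It expresses the wedge with x through products and anticommutators, to which the product
  rule applies.\<close>

lemma wedge_insert_zero:
  assumes "finite J" "0 \<notin> J"
  shows "2 * E (insert 0 J) = 2 * (g 0 * E J) - (\<Sum>j\<in>J. sg J j * (acomm (g j) (g 0) * E (J - {j})))"
  using vector_mult_wedge[OF assms(1), of 0] assms(2) by (simp add: E_ext_def sg_zero)

end

section \<open>Structure of the radial algebra\<close>

lemma rconst_0: "rconst 0 = 0"
  by transfer (simp add: ideal_cong_refl)

lemma rconst_1: "rconst 1 = 1"
  by transfer (simp add: ideal_cong_refl)

lemma rconst_add: "rconst (a + b) = rconst a + rconst b"
  by transfer (simp add: ideal_cong_refl single_add)

lemma rconst_mult: "rconst (a * b) = rconst a * rconst b"
  by transfer (simp add: ideal_cong_refl mult_single)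

lemma rconst_uminus: "rconst (- a) = - rconst a"
  by transfer (simp add: ideal_cong_refl single_uminus)

lemma rconst_diff: "rconst (a - b) = rconst a - rconst b"
  by transfer (simp add: ideal_cong_refl single_diff)

lemma rconst_of_nat: "rconst (of_nat n) = of_nat n"
  by (induction n) (simp_all add: rconst_0 rconst_1 rconst_add)

lemma rconst_of_int: "rconst (of_int n) = of_int n"
  by (cases n rule: int_diff_cases) (simp add: rconst_diff rconst_of_nat)

lemma rconst_numeral: "rconst (numeral n) = numeral n"
  using rconst_of_nat[of "numeral n"] by simp

lemma mword_const_central:
  "Poly_Mapping.single (0 :: 'g mword) c * p = p * Poly_Mapping.single 0 (c :: 'k::comm_ring_1)"
  by (induction p rule: poly_mapping_single_induct) (simp_all add: mult_single algebra_simps)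

lemma rconst_central: "rconst c * F = F * rconst c"
  by transfer (simp add: mword_const_central ideal_cong_refl)

lemma rconst_left_commute: "F * (rconst c * G) = rconst c * (F * G)"
  by (metis mult.assoc rconst_central)

lemma abs_radial_single:
  "abs_radial (Poly_Mapping.single (MWord vs) c) = rconst c * prod_list (map vgen vs)"
proof (induction vs)
  case Nil
  then show ?case by (simp add: rconst.abs_eq zero_mword_def)
next
  case (Cons v vs)
  have "Poly_Mapping.single (MWord (v # vs)) c = letter v * Poly_Mapping.single (MWord vs) c"
    by (simp add: letter_def mult_single plus_mword_def)
  then have "abs_radial (Poly_Mapping.single (MWord (v # vs)) c) =
      vgen v * abs_radial (Poly_Mapping.single (MWord vs) c)"
    by (simp add: vgen.abs_eq times_radial.abs_eq)
  then show ?case using Cons by (simp add: rconst_left_commute)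
qed

text \<open>Words are built by left multiplication, so left multiplication by generators is the only
  product to be handled. This matches a representation that is given on generators.\<close>

lemma radial_induct [case_names one vgen const add]:
  assumes one: "P 1"
    and vgen: "\<And>v F. P F \<Longrightarrow> P (vgen v * F)"
    and const: "\<And>c F. P F \<Longrightarrow> P (rconst c * F)"
    and add: "\<And>F G. P F \<Longrightarrow> P G \<Longrightarrow> P (F + G)"
  shows "P F"
proof -
  have "P (abs_radial p)" for p
  proof (induction p rule: poly_mapping_single_induct)
    case (single w c)
    have "P (prod_list (map vgen vs))" for vs
      by (induction vs) (auto intro: one vgen)
    then show ?case
      by (cases w) (simp add: abs_radial_single const)
  next
    case (add p q)
    then show ?case by (simp add: plus_radial.abs_eq[symmetric] assms(4))
  qed
  then have "P (abs_radial (rep_radial F))" .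
  then show ?thesis by (simp add: Quotient3_abs_rep[OF Quotient3_radial])
qed

lemma acomm_commutes_vgen:
  "acomm (vgen u) (vgen v) * vgen w = vgen w * acomm (vgen u) (vgen v)"
  unfolding acomm_def
proof transfer
  fix u v w :: 'a
  let ?r = "(letter u * letter v + letter v * letter u) * letter w
      - letter w * (letter u * letter v + letter v * letter u) :: 'a mword \<Rightarrow>\<^sub>0 'b"
  have "?r \<in> radial_relations" by (auto simp: radial_relations_def)
  then have "1 * ?r * 1 \<in> two_sided_ideal radial_relations" by (rule two_sided_ideal.gen)
  then show "ideal_cong radial_relations ((letter u * letter v + letter v * letter u) * letter w)
      (letter w * (letter u * letter v + letter v * letter u) :: 'a mword \<Rightarrow>\<^sub>0 'b)"
    by (simp add: ideal_cong_def)
qed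

lemma acomm_vgen_central:
  "central (acomm (vgen u) (vgen v) :: ('v, 'k::comm_ring_1) radial)"
proof (rule centralI)
  fix F :: "('v, 'k) radial"
  show "acomm (vgen u) (vgen v) * F = F * acomm (vgen u) (vgen v)"
  proof (induction F rule: radial_induct)
    case (vgen w F)
    then show ?case
      by (simp only: mult.assoc[symmetric] acomm_commutes_vgen) (simp only: mult.assoc)
  next
    case (const c F)
    then show ?case by (simp add: rconst_left_commute mult.assoc)
  qed (simp_all add: algebra_simps)
qed

lemma radial_of_nat_cancel:
  fixes a b :: "('v, 'k::{comm_ring_1,real_algebra_1}) radial"
  assumes "0 < n" "of_nat n * a = of_nat n * b"
  shows "a = b"
proof -
  have "1 / real n * real n = 1"
    using assms(1) by simp
  then have "rconst (of_real (1 / real n) :: 'k) * of_nat n = (1 :: ('v, 'k) radial)"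
    by (metis of_real_1 of_real_mult of_real_of_nat_eq rconst_1 rconst_mult rconst_of_nat)
  then show ?thesis using assms(2) by (metis mult.assoc mult_1)
qed

lemma vgen_square_central:
  "central (vgen u * vgen u :: ('v, 'k::{comm_ring_1,real_algebra_1}) radial)"
proof (rule centralI)
  fix F :: "('v, 'k) radial"
  have "of_nat 2 * (vgen u * vgen u * F) = of_nat 2 * (F * (vgen u * vgen u))"
    using centralD[OF acomm_vgen_central[of u u], where a = F] by (simp add: acomm_def mult_2
        distrib_right distrib_left)
  then show "vgen u * vgen u * F = F * (vgen u * vgen u)"
    by (rule radial_of_nat_cancel[rotated]) simp
qed

section \<open>Wedges\<close>

text \<open>Kept apart from the factor 1 / p!, so that the coefficients of its Laplace expansion are
  mere signs.\<close>

definition antisym :: "'a::ring_1 list \<Rightarrow> 'a" where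
  "antisym us = (\<Sum>\<pi> | \<pi> permutes {..<length us}.
     of_int (sign \<pi>) * prod_list (map (\<lambda>i. us ! \<pi> i) [0..<length us]))"

text \<open>Permutations are grouped by their value k at 0. Those with a given k arise from
  permutations of n points by \<open>permutation_insert 0 k\<close>, which contributes the sign
  (-1)^k, and \<open>us ! k\<close> is then the leftmost factor; the order of the factors is kept
  throughout.\<close>

lemma antisym_laplace:
  assumes "us \<noteq> []"
  shows "antisym us =
    (\<Sum>k<length us. (- 1) ^ k * (us ! k * antisym (take k us @ drop (Suc k) us)))"
proof -
  obtain n where n: "length us = Suc n"
    using assms by (cases us) auto
  define f where "f \<pi> = of_int (sign \<pi>) * prod_list (map (\<lambda>i. us ! \<pi> i) [0..<Suc n])" for \<pi>
  have ins: "f (permutation_insert 0 k q) = (- 1) ^ k * (us ! k * (of_int (sign q) *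
      prod_list (map (\<lambda>i. (take k us @ drop (Suc k) us) ! q i) [0..<n])))"
    if k: "k < Suc n" and q: "q permutes {0..<n}" for k q
  proof -
    \<comment> \<open>Inserting the value k raises the values from k on by one, which matches the
      list with entry k left out.\<close>
    have entry: "us ! permutation_insert 0 k q (Suc i) = (take k us @ drop (Suc k) us) ! q i"
      if "i < n" for i
    proof -
      have "q i < n" using permutes_in_image[OF q] that by simp
      then show ?thesis using k n
        by (auto simp: permutation_insert_expand nth_append min_def)
    qed
    have "map (\<lambda>i. us ! permutation_insert 0 k q i) [0..<Suc n] =
        us ! k # map (\<lambda>i. us ! permutation_insert 0 k q (Suc i)) [0..<n]"
      by (simp add: map_upt_Suc del: upt_Suc)
    also have "map (\<lambda>i. us ! permutation_insert 0 k q (Suc i)) [0..<n] =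
        map (\<lambda>i. (take k us @ drop (Suc k) us) ! q i) [0..<n]"
      by (rule map_cong) (simp_all add: entry)
    finally have "f (permutation_insert 0 k q) = (- 1) ^ (0 + k) * of_int (sign q) *
        (us ! k * prod_list (map (\<lambda>i. (take k us @ drop (Suc k) us) ! q i) [0..<n]))"
      unfolding f_def using signof_permutation_insert[OF q _ k, of 0, where 'a = 'a] by simp
    moreover have "us ! k * (of_int z * P) = of_int z * (us ! k * P)" for z P
      by (metis mult.assoc mult_of_int_commute)
    ultimately show ?thesis by (simp add: mult.assoc)
  qed
  have "antisym us = sum f {\<pi>. \<pi> permutes {0..<Suc n}}"
    by (simp add: antisym_def f_def n atLeast0LessThan)
  also have "\<dots> = (\<Sum>k\<in>{0..<Suc n}. \<Sum>\<pi> | \<pi> \<in> {\<pi>. \<pi> permutes {0..<Suc n}} \<and> \<pi> 0 = k. f \<pi>)"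
  proof (rule sum.group[symmetric])
    show "(\<lambda>\<pi>. \<pi> 0) ` {\<pi>. \<pi> permutes {0..<Suc n}} \<subseteq> {0..<Suc n}"
    proof
      fix k assume "k \<in> (\<lambda>\<pi>. \<pi> 0) ` {\<pi>. \<pi> permutes {0..<Suc n}}"
      then obtain \<pi> where "\<pi> permutes {0..<Suc n}" "k = \<pi> 0" by auto
      then show "k \<in> {0..<Suc n}" using permutes_in_image[of \<pi> "{0..<Suc n}" 0] by simp
    qed
  qed (simp_all add: finite_permutations)
  also have "\<dots> = (\<Sum>k\<in>{0..<Suc n}. (- 1) ^ k * (us ! k * antisym (take k us @ drop (Suc k) us)))"
  proof (intro sum.cong refl)
    fix k assume "k \<in> {0..<Suc n}"
    then have k: "k < Suc n" by simp
    have len: "length (take k us @ drop (Suc k) us) = n" using k n by simp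
    have "(\<Sum>\<pi> | \<pi> \<in> {\<pi>. \<pi> permutes {0..<Suc n}} \<and> \<pi> 0 = k. f \<pi>) =
        sum f (permutation_insert 0 k ` {q. q permutes {0..<n}})"
      using permutation_fix[of 0 n k] k by simp
    also have "\<dots> = (\<Sum>q | q permutes {0..<n}. f (permutation_insert 0 k q))"
      by (subst sum.reindex) (use permutation_insert_inj_on[of 0 n k] k in auto)
    also have "\<dots> = (- 1) ^ k * (us ! k * antisym (take k us @ drop (Suc k) us))"
      unfolding antisym_def len sum_distrib_left atLeast0LessThan[symmetric]
      by (intro sum.cong refl) (simp add: ins k)
    finally show "(\<Sum>\<pi> | \<pi> \<in> {\<pi>. \<pi> permutes {0..<Suc n}} \<and> \<pi> 0 = k. f \<pi>) =
        (- 1) ^ k * (us ! k * antisym (take k us @ drop (Suc k) us))" .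
  qed
  finally show ?thesis by (simp add: n atLeast0LessThan)
qed

lemma wedge_antisym: "wedge us = rconst (of_real (1 / fact (length us))) * antisym us"
  by (simp add: wedge_def antisym_def)

lemma wedge_laplace:
  assumes "us \<noteq> []"
  shows "of_nat (length us) * wedge us =
    (\<Sum>k<length us. (- 1) ^ k * (us ! k * wedge (take k us @ drop (Suc k) us)))"
proof -
  obtain n where n: "length us = Suc n"
    using assms by (cases us) auto
  have "of_nat (Suc n) * wedge us = rconst (of_nat (Suc n) * of_real (1 / fact (Suc n))) * antisym us"
    by (simp only: wedge_antisym n rconst_mult rconst_of_nat mult.assoc)
  also have "of_nat (Suc n) * of_real (1 / fact (Suc n)) = (of_real (1 / fact n) :: 'b)"
  proof -
    have "real (Suc n) * (1 / fact (Suc n)) = 1 / fact n"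
      by (simp add: fact_Suc del: of_nat_Suc)
    then show ?thesis by (metis of_real_mult of_real_of_nat_eq)
  qed
  also have "rconst (of_real (1 / fact n)) * antisym us =
      (\<Sum>k<length us. (- 1) ^ k * (us ! k * wedge (take k us @ drop (Suc k) us)))"
    unfolding antisym_laplace[OF assms] sum_distrib_left
    by (intro sum.cong refl) (simp add: wedge_antisym n rconst_left_commute)
  finally show ?thesis by (simp add: n)
qed

text \<open>In an increasing list the position counts the smaller elements; this turns the sign
  (-1)^k of a list expansion into \<open>sg\<close>.\<close>

lemma sorted_list_of_set_nth_below:
  assumes "finite J" "k < card J"
  shows "{i \<in> J. i < sorted_list_of_set J ! k} = set (take k (sorted_list_of_set J))"
proof -
  let ?xs = "sorted_list_of_set J"
  have s: "sorted_wrt (<) ?xs" and l: "length ?xs = card J" and J: "J = set ?xs"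
    using assms by simp_all
  show ?thesis
  proof (intro equalityI subsetI)
    fix i assume "i \<in> {i \<in> J. i < ?xs ! k}"
    then obtain l where l: "l < length ?xs" "?xs ! l = i" "i < ?xs ! k"
      using J by (metis (mono_tags, lifting) in_set_conv_nth mem_Collect_eq)
    have "l < k"
    proof (rule ccontr)
      assume "\<not> l < k"
      then have "?xs ! k \<le> ?xs ! l"
        using l assms by (intro sorted_nth_mono) auto
      then show False using l by simp
    qed
    then show "i \<in> set (take k ?xs)" using l by (auto simp: in_set_conv_nth)
  next
    fix i assume "i \<in> set (take k ?xs)"
    then obtain l where l': "l < k" "?xs ! l = i" "l < length ?xs" by (auto simp: in_set_conv_nth)
    then have "i < ?xs ! k"
      using sorted_wrt_nth_less[OF s, of l k] assms l by simp
    then show "i \<in> {i \<in> J. i < ?xs ! k}" using l' J by (metis (mono_tags, lifting) mem_Collect_eq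
        nth_mem)
  qed
qed

lemma remove1_nth: "distinct xs \<Longrightarrow> k < length xs \<Longrightarrow> remove1 (xs ! k) xs = take k xs @ drop (Suc k) xs"
proof (induction xs arbitrary: k)
  case (Cons a xs)
  then show ?case by (cases k) (auto simp: nth_mem)
qed simp

definition wedge_set :: "(nat \<Rightarrow> ('v, 'k) radial) \<Rightarrow> nat set \<Rightarrow> ('v, 'k::{comm_ring_1,real_algebra_1})
    radial"
  where "wedge_set g J = wedge (map g (sorted_list_of_set J))"

lemma wedge_set_empty: "wedge_set g {} = 1"
  by (simp add: wedge_set_def wedge_antisym antisym_def rconst_1)

lemma wedge_set_laplace:
  assumes "finite J"
  shows "of_nat (card J) * wedge_set g J = (\<Sum>j\<in>J. sg J j * (g j * wedge_set g (J - {j})))"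
proof (cases "J = {}")
  case False
  let ?xs = "sorted_list_of_set J"
  have bij: "bij_betw (\<lambda>k. ?xs ! k) {..<card J} J"
    using assms by (intro bij_betw_nth) auto
  have "of_nat (card J) * wedge_set g J =
      (\<Sum>k<card J. (- 1) ^ k * (map g ?xs ! k * wedge (take k (map g ?xs) @ drop (Suc k) (map g ?xs))))"
    using wedge_laplace[of "map g ?xs"] False assms by (simp add: wedge_set_def)
  also have "\<dots> = (\<Sum>k<card J. sg J (?xs ! k) * (g (?xs ! k) * wedge_set g (J - {?xs ! k})))"
  proof (intro sum.cong refl)
    fix k assume "k \<in> {..<card J}"
    then have k: "k < card J" by simp
    have "card (set (take k ?xs)) = k"
      using k assms by (simp add: distinct_card)
    then have "(- 1) ^ k = (sg J (?xs ! k) :: ('a, 'b) radial)"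
      unfolding sg_def sorted_list_of_set_nth_below[OF assms k] by simp
    moreover have "sorted_list_of_set (J - {?xs ! k}) = take k ?xs @ drop (Suc k) ?xs"
      using assms k by (simp add: sorted_list_of_set_remove remove1_nth)
    ultimately show "(- 1) ^ k * (map g ?xs ! k * wedge (take k (map g ?xs) @ drop (Suc k) (map g
        ?xs))) =
        sg J (?xs ! k) * (g (?xs ! k) * wedge_set g (J - {?xs ! k}))"
      using k assms by (simp add: wedge_set_def take_map drop_map)
  qed
  also have "\<dots> = (\<Sum>j\<in>J. sg J j * (g j * wedge_set g (J - {j})))"
    by (rule sum.reindex_bij_betw[OF bij])
  finally show ?thesis .
qed simp

lemma wedge_system_radial: "wedge_system (\<lambda>i. vgen (h i)) (wedge_set (\<lambda>i. vgen (h i)))"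
  by (unfold_locales) (use acomm_vgen_central wedge_set_laplace radial_of_nat_cancel
      in \<open>auto simp: wedge_set_empty\<close>)

section \<open>Base change\<close>

lemma base_change_add: "base_change (F + G) = base_change F + base_change G"
  by transfer (simp add: map_of_real_add ideal_cong_refl)

lemma base_change_mult: "base_change (F * G) = base_change F * base_change G"
  by transfer (simp add: map_of_real_mult ideal_cong_refl)

lemma base_change_vgen: "base_change (vgen v) = vgen v"
  by transfer (simp add: letter_def map_single ideal_cong_refl)

lemma base_change_rconst: "base_change (rconst c) = rconst (of_real c)"
  by transfer (simp add: map_single ideal_cong_refl)

lemma base_change_0: "base_change 0 = 0"
  using base_change_rconst[of 0] by (simp add: rconst_0)

lemma base_change_1: "base_change 1 = 1"
  using base_change_rconst[of 1] by (simp add: rconst_1)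

lemma base_change_sum: "base_change (sum f I) = (\<Sum>i\<in>I. base_change (f i))"
  by (induction I rule: infinite_finite_induct) (simp_all add: base_change_0 base_change_add)

lemma base_change_power: "base_change (F ^ n) = base_change F ^ n"
  by (induction n) (simp_all add: base_change_1 base_change_mult)

lemma base_change_prod_list: "base_change (prod_list Fs) = prod_list (map base_change Fs)"
  by (induction Fs) (simp_all add: base_change_1 base_change_mult)

lemma base_change_of_int: "base_change (of_int n) = of_int n"
  by (simp add: rconst_of_int[symmetric] base_change_rconst)

lemma base_change_wedge: "base_change (wedge us) = wedge (map base_change us)"
proof -
  have eq: "map base_change (map (\<lambda>i. us ! \<pi> i) [0..<length us]) = map (\<lambda>i. map base_change us ! \<pi>
      i) [0..<length us]"
    if "\<pi> permutes {..<length us}" for \<pi>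
    using permutes_in_image[OF that] by auto
  show ?thesis
    unfolding wedge_def base_change_mult base_change_rconst base_change_sum base_change_of_int
      base_change_prod_list length_map
    by (intro arg_cong2[where f = times] refl sum.cong) (simp_all add: eq del: map_map)
qed

section \<open>Substitution of the scalars\<close>

lemma prod_list_power_add:
  fixes f :: "'i \<Rightarrow> 'a::ring_1"
  assumes "\<And>i. central (f i)"
  shows "prod_list (map (\<lambda>i. f i ^ (a i + b i)) xs) =
    prod_list (map (\<lambda>i. f i ^ a i) xs) * prod_list (map (\<lambda>i. f i ^ b i) xs)"
proof (induction xs)
  case (Cons i xs)
  let ?A = "prod_list (map (\<lambda>i. f i ^ a i) xs)" and ?B = "prod_list (map (\<lambda>i. f i ^ b i) xs)"
  have "?A * (f i ^ b i * z) = f i ^ b i * (?A * z)" for z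
    by (rule central_left_commute[OF central_power[OF assms]])
  then show ?case using Cons by (simp add: power_add mult.assoc)
qed simp

lemma prod_list_power_delta:
  assumes "distinct xs"
  shows "prod_list (map (\<lambda>i. f i ^ (if i = a then Suc 0 else 0)) xs) = (if a \<in> set xs then f a else 1)"
  using assms
proof (induction xs)
  case (Cons b xs)
  then show ?case by (cases "b = a") auto
qed simp

lemma prod_list_map_1: "prod_list (map (\<lambda>i. 1) xs) = (1 :: 'a::monoid_mult)"
  by (induction xs) auto

lemma distinct_pair_list:
  assumes "distinct xs" "\<And>i. distinct (f i)"
  shows "distinct [(i, j). i \<leftarrow> xs, j \<leftarrow> f i]"
  using assms(1) by (induction xs) (auto simp: distinct_map inj_on_def assms(2))

text \<open>A monomial is a product of three ordered blocks. Each block is multiplicative, and the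
  blocks can be regrouped because their factors are central.\<close>

lemma scal_monom_add:
  "scal_monom x y N (m + m') = (scal_monom x y N m * scal_monom x y N m' :: ('v,
      'k::{comm_ring_1,real_algebra_1}) radial)"
proof -
  let ?c = "\<lambda>i. acomm (vgen x) (vgen (y i)) :: ('v, 'k) radial"
  let ?d = "\<lambda>p. acomm (vgen (y (fst p))) (vgen (y (snd p))) :: ('v, 'k) radial"
  define L :: "(nat \<times> nat) list" where "L = [(i, j). i \<leftarrow> [1..<N+1], j \<leftarrow> [i..<N+1]]"
  define R S T where "R = (\<lambda>m. (vgen x * vgen x :: ('v, 'k) radial) ^ Poly_Mapping.lookup m VR)"
    and "S = (\<lambda>m. prod_list (map (\<lambda>i. ?c i ^ Poly_Mapping.lookup m (VS i)) [1..<N+1]))"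
    and "T = (\<lambda>m. prod_list (map (\<lambda>p. ?d p ^ Poly_Mapping.lookup m (VC (fst p) (snd p))) L))"
  have eq: "scal_monom x y N m = R m * S m * T m" for m
    by (simp add: scal_monom_def R_def S_def T_def L_def case_prod_unfold)
  have "R (m + m') = R m * R m'"
    by (simp add: R_def lookup_add power_add)
  moreover have "S (m + m') = S m * S m'"
    unfolding S_def lookup_add by (rule prod_list_power_add) (rule acomm_vgen_central)
  moreover have "T (m + m') = T m * T m'"
    unfolding T_def lookup_add by (rule prod_list_power_add) (rule acomm_vgen_central)
  moreover have "R m * R m' * (S m * S m') * (T m * T m') = R m * S m * T m * (R m' * S m' * T m')"
  proof -
    have S: "central (S m)" for m
      unfolding S_def by (rule central_prod_list) (auto intro!: central_power acomm_vgen_central)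
    have R: "central (R m')"
      unfolding R_def by (rule central_power[OF vgen_square_central])
    have "R m' * (S m * z) = S m * (R m' * z)" "T m * (R m' * z) = R m' * (T m * z)"
      "T m * (S m' * z) = S m' * (T m * z)" for z
      using central_left_commute[OF S] central_left_commute[OF R] by blast+
    then show ?thesis by (simp only: mult.assoc)
  qed
  ultimately show ?thesis unfolding eq by simp
qed

lemma scal_monom_0: "scal_monom x y N 0 = 1"
  by (simp add: scal_monom_def case_prod_unfold prod_list_map_1 del: upt_Suc)

lemma scal_monom_central:
  "central (scal_monom x y N m :: ('v, 'k::{comm_ring_1,real_algebra_1}) radial)"
  unfolding scal_monom_def
  by (intro central_mult central_prod_list central_power vgen_square_central;
      auto intro!: central_power acomm_vgen_central)

lemma scal_add: "scal x y N (A + B) = scal x y N A + scal x y N B"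
  unfolding scal_def
  by (rule setsum_keys_plus_distrib) (simp_all add: rconst_0 rconst_add distrib_right)

lemma scal_0: "scal x y N 0 = 0"
  by (simp add: scal_def)

lemma scal_single: "scal x y N (Poly_Mapping.single m c) = rconst c * scal_monom x y N m"
  by (simp add: scal_def rconst_0)

lemma scal_const: "scal x y N (Poly_Mapping.single 0 c) = rconst c"
  by (simp add: scal_single scal_monom_0)

lemma scal_mult:
  fixes A B :: "(svar, 'k::{comm_ring_1,real_algebra_1}) mpoly"
  shows "scal x y N (A * B) = scal x y N A * scal x y N B"
  by (rule poly_mapping_mult_hom)
    (simp_all add: scal_add mult_single scal_single scal_monom_add rconst_mult mult.assoc
      rconst_left_commute[of "scal_monom x y N m" for m])

lemma scal_sum: "scal x y N (sum f I) = (\<Sum>i\<in>I. scal x y N (f i))"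
  by (induction I rule: infinite_finite_induct) (simp_all add: scal_0 scal_add)

lemma scal_1: "scal x y N 1 = 1"
  using scal_const[of x y N 1] by (simp add: rconst_1)

lemma scal_central: "central (scal x y N (A :: (svar, 'k::{comm_ring_1,real_algebra_1}) mpoly))"
proof (rule centralI)
  fix F
  have "rconst c * scal_monom x y N m * F = F * (rconst c * scal_monom x y N m)" for c :: 'k and m
    using centralD[OF scal_monom_central, of x y N m F] by (simp add: mult.assoc rconst_left_commute)
  then show "scal x y N A * F = F * scal x y N A"
    by (simp add: scal_def sum_distrib_left sum_distrib_right)
qed

lemma scal_VR: "scal x y N (mvar VR) = vgen x * vgen x"
  by (simp add: mvar_def scal_single rconst_1 scal_monom_def lookup_single when_def case_prod_unfold
      prod_list_map_1 del: upt_Suc)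

lemma scal_VS:
  assumes "1 \<le> i" "i \<le> N"
  shows "scal x y N (mvar (VS i)) = acomm (vgen x) (vgen (y i))"
proof -
  have "prod_list (map (\<lambda>j. acomm (vgen x) (vgen (y j)) ^ (if j = i then Suc 0 else 0)) [1..<N+1]) =
      (acomm (vgen x) (vgen (y i)) :: ('a, 'b) radial)"
    using assms by (subst prod_list_power_delta) auto
  then show ?thesis
    by (simp add: mvar_def scal_single rconst_1 scal_monom_def lookup_single when_def case_prod_unfold
        prod_list_map_1 eq_commute[of i] del: upt_Suc)
qed

lemma scal_VC:
  assumes "1 \<le> i" "i \<le> j" "j \<le> N"
  shows "scal x y N (mvar (VC i j)) = acomm (vgen (y i)) (vgen (y j))"
proof -
  let ?L = "[(i, j). i \<leftarrow> [1..<N+1], j \<leftarrow> [i..<N+1]]"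
  let ?f = "\<lambda>p. acomm (vgen (y (fst p))) (vgen (y (snd p))) :: ('a, 'b) radial"
  have "prod_list (map (\<lambda>p. ?f p ^ (if p = (i, j) then Suc 0 else 0)) ?L) = ?f (i, j)"
    using assms by (subst prod_list_power_delta) (auto intro!: distinct_pair_list simp: image_iff
        simp del: upt_Suc)
  moreover have "(VC i j = VC (fst p) (snd p)) = (p = (i, j))" for p
    by (cases p) auto
  ultimately show ?thesis
    by (simp add: mvar_def scal_single rconst_1 scal_monom_def lookup_single when_def case_prod_unfold
        prod_list_map_1 del: upt_Suc)
qed

lemma base_change_scal_monom: "base_change (scal_monom x y N m) = scal_monom x y N m"
  by (simp add: scal_monom_def base_change_mult base_change_power base_change_prod_list base_change_vgen
      acomm_def base_change_add o_def case_prod_unfold del: upt_Suc)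

section \<open>Scalar polynomials\<close>

definition svars :: "nat \<Rightarrow> svar set" where
  "svars N = {VR} \<union> {VS i | i. 1 \<le> i \<and> i \<le> N} \<union> {VC i j | i j. 1 \<le> i \<and> i \<le> j \<and> j \<le> N}"

lemma scalar_polys_iff: "A \<in> scalar_polys N \<longleftrightarrow> (\<forall>m\<in>Poly_Mapping.keys A. Poly_Mapping.keys m \<subseteq> svars N)"
  by (simp add: scalar_polys_def svars_def)

lemma scalar_polys_0: "0 \<in> scalar_polys N"
  by (simp add: scalar_polys_iff)

lemma scalar_polys_single: "Poly_Mapping.keys m \<subseteq> svars N \<Longrightarrow> Poly_Mapping.single m c \<in> scalar_polys N"
  by (auto simp: scalar_polys_iff split: if_splits)

lemma scalar_polys_const: "Poly_Mapping.single 0 c \<in> scalar_polys N"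
  by (rule scalar_polys_single) simp

lemma scalar_polys_1: "1 \<in> scalar_polys N"
  using scalar_polys_const[of 1 N] by simp

lemma scalar_polys_mvar: "v \<in> svars N \<Longrightarrow> mvar v \<in> scalar_polys N"
  unfolding mvar_def by (rule scalar_polys_single) auto

lemma scalar_polys_add: "A \<in> scalar_polys N \<Longrightarrow> B \<in> scalar_polys N \<Longrightarrow> A + B \<in> scalar_polys N"
  unfolding scalar_polys_iff using Poly_Mapping.keys_add[of A B] by blast

lemma scalar_polys_mult:
  fixes A B :: "(svar, 'k::comm_ring_1) mpoly"
  assumes "A \<in> scalar_polys N" "B \<in> scalar_polys N"
  shows "A * B \<in> scalar_polys N"
  unfolding scalar_polys_iff
proof
  fix m assume "m \<in> Poly_Mapping.keys (A * B)"
  then obtain a b where "a \<in> Poly_Mapping.keys A" "b \<in> Poly_Mapping.keys B" "m = a + b"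
    using Poly_Mapping.keys_mult[of A B] by blast
  then show "Poly_Mapping.keys m \<subseteq> svars N"
    using assms Poly_Mapping.keys_add[of a b] unfolding scalar_polys_iff by blast
qed

lemma scalar_polys_uminus: "A \<in> scalar_polys N \<Longrightarrow> - A \<in> scalar_polys N"
  using scalar_polys_mult[OF scalar_polys_const[of "- 1"], of A N] by (simp add: single_uminus)

lemma scalar_polys_sum: "(\<And>i. i \<in> I \<Longrightarrow> f i \<in> scalar_polys N) \<Longrightarrow> sum f I \<in> scalar_polys N"
  by (induction I rule: infinite_finite_induct) (auto intro: scalar_polys_0 scalar_polys_add)

lemma poly_mapping_eq_sum_single: "A = (\<Sum>m\<in>Poly_Mapping.keys A. Poly_Mapping.single m
    (Poly_Mapping.lookup A m))"
proof (rule poly_mapping_eqI)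
  fix m
  have "(\<Sum>k\<in>Poly_Mapping.keys A. Poly_Mapping.lookup A k when k = m) =
      (\<Sum>k\<in>Poly_Mapping.keys A. if k = m then Poly_Mapping.lookup A m else 0)"
    by (intro sum.cong) auto
  then show "Poly_Mapping.lookup A m =
      Poly_Mapping.lookup (\<Sum>m\<in>Poly_Mapping.keys A. Poly_Mapping.single m (Poly_Mapping.lookup A m)) m"
    by (simp add: lookup_sum lookup_single in_keys_iff)
qed

lemma scalar_polys_single_induct [consumes 1, case_names zero single add]:
  assumes "A \<in> scalar_polys N"
    and "P 0"
    and "\<And>m c. Poly_Mapping.keys m \<subseteq> svars N \<Longrightarrow> P (Poly_Mapping.single m c)"
    and "\<And>A B. P A \<Longrightarrow> P B \<Longrightarrow> P (A + B)"
  shows "P A"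
proof -
  have "P (\<Sum>m\<in>M. Poly_Mapping.single m (Poly_Mapping.lookup A m))"
    if "finite M" "M \<subseteq> Poly_Mapping.keys A" for M
    using that
  proof (induction M rule: finite_induct)
    case (insert m M)
    then have "Poly_Mapping.keys m \<subseteq> svars N"
      using assms(1) by (auto simp: scalar_polys_iff)
    then show ?case using insert assms by simp
  qed (simp add: assms)
  from this[of "Poly_Mapping.keys A"] show ?thesis
    using poly_mapping_eq_sum_single[of A] by simp
qed

text \<open>Constants and variables generate the scalar polynomials as an algebra, so a claim
  compatible with sums and products needs to be checked only on r, s_i, c_ij and constants.\<close>

lemma scalar_polys_induct [consumes 1, case_names const mvar add mult]:
  fixes A :: "(svar, 'k::comm_ring_1) mpoly"
  assumes A: "A \<in> scalar_polys N"
    and const: "\<And>c. P (Poly_Mapping.single 0 c)"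
    and mvar: "\<And>v. v \<in> svars N \<Longrightarrow> P (mvar v)"
    and add: "\<And>A B. P A \<Longrightarrow> P B \<Longrightarrow> P (A + B)"
    and mult: "\<And>A B. P A \<Longrightarrow> P B \<Longrightarrow> P (A * B)"
  shows "P A"
  using A
proof (induction rule: scalar_polys_single_induct)
  case zero
  show ?case using const[of 0] by simp
next
  case (single m c)
  have "P (Poly_Mapping.single m 1)" if "Poly_Mapping.keys m \<subseteq> svars N" for m :: "svar \<Rightarrow>\<^sub>0 nat"
    using that
  proof (induction m rule: poly_mapping_single_induct)
    case (single v n)
    show ?case
    proof (cases "n = 0")
      case True
      then show ?thesis using const[of 1] by simp
    next
      case False
      then have v: "v \<in> svars N" using single by simp
      have "P (Poly_Mapping.single (Poly_Mapping.single v n) 1)"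
      proof (induction n)
        case 0
        show ?case using const[of 1] by simp
      next
        case (Suc n)
        have "Poly_Mapping.single (Poly_Mapping.single v (Suc n)) 1 =
            mvar v * Poly_Mapping.single (Poly_Mapping.single v n) (1 :: 'k)"
          by (simp add: mvar_def mult_single flip: single_add)
        then show ?case using mult[OF mvar[OF v] Suc] by simp
      qed
      then show ?thesis .
    qed
  next
    case (add p q)
    have "Poly_Mapping.keys (p + q) = Poly_Mapping.keys p \<union> Poly_Mapping.keys q"
      by (auto simp: in_keys_iff lookup_add)
    then have "P (Poly_Mapping.single p 1 * Poly_Mapping.single q 1)"
      using add by (intro mult) auto
    then show ?case by (simp add: mult_single)
  qed
  from mult[OF const[of c] this[OF single]] show ?case by (simp add: mult_single)
next
  case (add A B)
  then show ?case by (intro assms)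
qed

text \<open>The matrix of anticommutators in terms of the indeterminates. The factor 2 sits only at
  (0,0): r is x^2, half of {x,x}, whereas c_ii is {y_i,y_i} itself. Sorting by \<open>min\<close>
  and \<open>max\<close> keeps to the indeterminates c_ij with i \<le> j.\<close>

definition gram :: "nat \<Rightarrow> nat \<Rightarrow> (svar, 'k::comm_ring_1) mpoly" where
  "gram a b = (if a = 0 then (if b = 0 then 2 * mvar VR else mvar (VS b))
    else if b = 0 then mvar (VS a) else mvar (VC (min a b) (max a b)))"

lemma gram_commute: "gram a b = gram b a"
  by (simp add: gram_def min.commute max.commute)

lemma gram_scalar_polys:
  "a \<le> N \<Longrightarrow> b \<le> N \<Longrightarrow> gram a b \<in> (scalar_polys N :: (svar, 'a::comm_ring_1) mpoly set)"
proof -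
  assume "a \<le> N" "b \<le> N"
  moreover have "2 * mvar VR \<in> (scalar_polys N :: (svar, 'a) mpoly set)"
    unfolding mult_2 by (intro scalar_polys_add scalar_polys_mvar) (auto simp: svars_def)
  ultimately show ?thesis
    unfolding gram_def by (auto intro!: scalar_polys_mvar simp: svars_def min_def max_def)
qed

definition frame :: "'v \<Rightarrow> (nat \<Rightarrow> 'v) \<Rightarrow> nat \<Rightarrow> 'v"
  where "frame x y i = (if i = 0 then x else y i)"

lemma acomm_commute: "acomm a b = acomm b a"
  by (simp add: acomm_def add.commute)

lemma scal_gram:
  assumes "a \<le> N" "b \<le> N"
  shows "scal x y N (gram a b) =
    (acomm (vgen (frame x y a)) (vgen (frame x y b)) :: ('v, 'k::{comm_ring_1,real_algebra_1}) radial)"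
proof -
  have "scal x y N (2 * mvar VR) = (acomm (vgen x) (vgen x) :: ('v, 'k) radial)"
    by (simp only: mult_2 scal_add scal_VR acomm_def)
  then show ?thesis using assms
    by (auto simp: gram_def frame_def scal_VS scal_VC min_def max_def acomm_commute[of "vgen (y a)"])
qed

section \<open>The Fock representation\<close>

text \<open>
  On coefficient families indexed by subsets of \<open>{0,\<dots>,N}\<close>, left multiplication by a generator is a
  creation operator plus half the annihilation operators weighted by the Gram entries.
\<close>

definition creation :: "nat \<Rightarrow> (nat set \<Rightarrow> 'a::ring_1) \<Rightarrow> nat set \<Rightarrow> 'a"
  where "creation a f K = (if a \<in> K then sg K a * f (K - {a}) else 0)"

definition annihilation :: "nat \<Rightarrow> (nat set \<Rightarrow> 'a::ring_1) \<Rightarrow> nat set \<Rightarrow> 'a"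
  where "annihilation j f K = (if j \<in> K then 0 else sg K j * f (insert j K))"

lemma creation_anticommute: "creation a (creation b f) K + creation b (creation a f) K = 0"
proof (cases "a \<in> K \<and> b \<in> K \<and> a \<noteq> b")
  case True
  moreover have "K - {a} - {b} = K - {b} - {a}" by auto
  ultimately show ?thesis
    using sg_exchange[of a K b "f (K - {a} - {b})"] by (simp add: creation_def)
qed (auto simp: creation_def)

lemma annihilation_anticommute: "annihilation a (annihilation b f) K + annihilation b (annihilation
    a f) K = 0"
proof (cases "a \<notin> K \<and> b \<notin> K \<and> a \<noteq> b")
  case True
  let ?J = "insert a (insert b K)"
  have "?J - {a} = insert b K" "?J - {b} = insert a K" "insert b (insert a K) = ?J" using True by auto
  moreover have "sg ?J a = (sg (insert b K) a :: 'a)" by (rule sg_insert_self)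
  moreover have "sg ?J b = (sg (insert a K) b :: 'a)"
    using sg_insert_self[of b "insert a K"] calculation(3) by metis
  ultimately show ?thesis
    using True sg_exchange[of a ?J b "f ?J"] sg_insert_self[of b K, where 'a = 'a]
      sg_insert_self[of a K, where 'a = 'a]
      sg_left_commute[of "sg (insert b K) a" K b "f ?J"] sg_left_commute[of "sg (insert a K) b" K a
          "f ?J"]
    by (simp add: annihilation_def)
qed (auto simp: annihilation_def)

text \<open>The canonical anticommutation relation. For distinct a in K and b outside K the two
  terms cancel by \<open>sg_exchange\<close> in insert b K.\<close>

lemma creation_annihilation:
  "creation a (annihilation b f) K + annihilation b (creation a f) K = (if a = b then f K else 0)"
proof (cases "a = b")
  case True
  then show ?thesis
    by (auto simp: creation_def annihilation_def sg_remove_self sg_insert_self sg_square insert_absorb)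
next
  case False
  show ?thesis
  proof (cases "a \<in> K \<and> b \<notin> K")
    case True
    let ?J = "insert b K" and ?z = "f (insert b (K - {a}))"
    have J: "?J - {b} = K" "?J - {a} = insert b (K - {a})" using True False by auto
    have "sg ?J a * (sg (K - {a}) b * z) = - (sg K b * (sg K a * z))" for z :: 'a
      using sg_exchange[of a ?J b z] True False
      by (simp add: J sg_insert_self)
    then have "sg ?J a * (sg ?J a * (sg (K - {a}) b * (sg K a * ?z))) = - (sg ?J a * (sg K b * (sg K
        a * (sg K a * ?z))))"
      by simp
    then have "sg (K - {a}) b * (sg K a * ?z) = - (sg ?J a * (sg K b * ?z))"
      by (simp add: sg_square)
    then have "sg K a * (sg (K - {a}) b * ?z) = - (sg K b * (sg ?J a * ?z))"
      by (simp only: sg_left_commute[of "sg (K - {a}) b" K a] sg_left_commute[of "sg ?J a" K b])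
    then show ?thesis using True False J by (simp add: creation_def annihilation_def)
  qed (use False in \<open>auto simp: creation_def annihilation_def\<close>)
qed

definition half :: "('i, 'k::{comm_ring_1,real_algebra_1}) mpoly"
  where "half = Poly_Mapping.single 0 (of_real (1 / 2))"

lemma half_add_half: "half * a + half * a = a"
proof -
  have "of_real (1 / 2) + of_real (1 / 2) = (1 :: 'b)"
    by (metis field_sum_of_halves of_real_1 of_real_add)
  then show ?thesis
    by (simp add: half_def flip: distrib_right single_add)
qed

definition fock_mult :: "nat \<Rightarrow> nat \<Rightarrow> (nat set \<Rightarrow> (svar, 'k) mpoly) \<Rightarrow> nat set \<Rightarrow> (svar,
    'k::{comm_ring_1,real_algebra_1}) mpoly"
  where "fock_mult N a f K = creation a f K + half * (\<Sum>j\<le>N. gram a j * annihilation j f K)"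

lemma creation_add: "creation a (\<lambda>K. f K + g K) K = creation a f K + creation a g K"
  by (simp add: creation_def distrib_left)

lemma annihilation_add: "annihilation a (\<lambda>K. f K + g K) K = annihilation a f K + annihilation a g K"
  by (simp add: annihilation_def distrib_left)

lemma creation_scale: "creation a (\<lambda>K. c * f K) K = c * (creation a f K :: 'a::comm_ring_1)"
  by (simp add: creation_def mult.left_commute)

lemma annihilation_scale: "annihilation a (\<lambda>K. c * f K) K = c * (annihilation a f K :: 'a::comm_ring_1)"
  by (simp add: annihilation_def mult.left_commute)

lemma creation_sum: "creation a (\<lambda>K. \<Sum>i\<in>I. c i * f i K) K = (\<Sum>i\<in>I. c i * (creation a (f i) K
    :: 'a::comm_ring_1))"
  by (simp add: creation_def sum_distrib_left mult.left_commute)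

lemma annihilation_sum: "annihilation a (\<lambda>K. \<Sum>i\<in>I. c i * f i K) K = (\<Sum>i\<in>I. c i * (annihilation a (f
    i) K :: 'a::comm_ring_1))"
  by (simp add: annihilation_def sum_distrib_left mult.left_commute)

lemma fock_mult_add: "fock_mult N a (\<lambda>K. f K + g K) = (\<lambda>K. fock_mult N a f K + fock_mult N a g K)"
  by (rule ext) (simp add: fock_mult_def creation_add annihilation_add distrib_left sum.distrib add_ac)

lemma fock_mult_scale: "fock_mult N a (\<lambda>K. c * f K) = (\<lambda>K. c * fock_mult N a f K)"
  by (rule ext) (simp add: fock_mult_def creation_scale annihilation_scale distrib_left
      sum_distrib_left mult.left_commute)

lemma fock_mult_fock_mult:
  "fock_mult N a (fock_mult N b f) K = creation a (creation b f) K
    + half * (\<Sum>j\<le>N. gram b j * creation a (annihilation j f) K)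
    + half * (\<Sum>i\<le>N. gram a i * annihilation i (creation b f) K)
    + half * (half * (\<Sum>i\<le>N. \<Sum>j\<le>N. gram a i * gram b j * annihilation i (annihilation j f) K))"
proof -
  have "fock_mult N b f = (\<lambda>K. creation b f K + half * (\<Sum>j\<le>N. gram b j * annihilation j f K))"
    by (rule ext) (simp add: fock_mult_def)
  then show ?thesis
    unfolding fock_mult_def[of N a]
    by (simp add: creation_add annihilation_add creation_scale annihilation_scale creation_sum
        annihilation_sum
        distrib_left sum.distrib sum_distrib_left mult_ac add_ac)
qed

text \<open>Pairs of creations cancel, and so do pairs of annihilations, because the Gram weights
  commute; each of the two mixed sums yields half a Gram entry. The outcome is multiplication by a
  polynomial, which commutes with every \<open>fock_mult\<close>, and this is what the radial
  relations demand.\<close>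

lemma fock_mult_anticommute:
  assumes "a \<le> N" "b \<le> N"
  shows "fock_mult N a (fock_mult N b f) K + fock_mult N b (fock_mult N a f) K = gram a b * f K"
proof -
  have ca: "(\<Sum>j\<le>N. gram b j * creation a (annihilation j f) K) + (\<Sum>i\<le>N. gram b i * annihilation i
      (creation a f) K)
      = gram b a * f K" if "a \<le> N" for a b
  proof -
    have "(\<Sum>j\<le>N. gram b j * creation a (annihilation j f) K) + (\<Sum>i\<le>N. gram b i * annihilation i
        (creation a f) K)
        = (\<Sum>j\<le>N. gram b j * (if a = j then f K else 0))"
      by (simp add: creation_annihilation[symmetric] distrib_left sum.distrib)
    also have "\<dots> = (\<Sum>j\<le>N. if j = a then gram b a * f K else 0)"
      by (intro sum.cong) auto
    finally show ?thesis using that by simp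
  qed
  have "(\<Sum>i\<le>N. \<Sum>j\<le>N. gram b i * gram a j * annihilation i (annihilation j f) K) =
      (\<Sum>i\<le>N. \<Sum>j\<le>N. gram b j * gram a i * annihilation j (annihilation i f) K)"
    by (rule sum.swap)
  also have "\<dots> = (\<Sum>i\<le>N. \<Sum>j\<le>N. - (gram a i * gram b j * annihilation i (annihilation j f) K))"
    using annihilation_anticommute[of _ _ f K]
    by (intro sum.cong refl) (metis (no_types, lifting) add.commute eq_neg_iff_add_eq_0 mult.commute
        mult_minus_right)
  finally have aa: "(\<Sum>i\<le>N. \<Sum>j\<le>N. gram b i * gram a j * annihilation i (annihilation j f) K) =
      - (\<Sum>i\<le>N. \<Sum>j\<le>N. gram a i * gram b j * annihilation i (annihilation j f) K)"
    by (simp add: sum_negf)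
  have sum_eq: "(c1 + h * p1 + h * q1 + h * (h * r1)) + (c2 + h * p2 + h * q2 + h * (h * r2)) =
      (c1 + c2) + h * (p1 + q2) + h * (p2 + q1) + h * (h * (r1 + r2))"
    for c1 c2 p1 p2 q1 q2 r1 r2 h :: "(svar, 'a) mpoly"
    by (simp add: algebra_simps)
  show ?thesis
    unfolding fock_mult_fock_mult sum_eq
    unfolding creation_anticommute ca[OF assms(1)] ca[OF assms(2)] aa
    by (simp add: gram_commute[of b a] half_add_half)
qed

section \<open>The action of the free algebra and its descent to the quotient\<close>

context
  fixes N :: nat and idx :: "'v \<Rightarrow> nat"
begin

text \<open>Given on representatives in the free algebra, where a word acts as a composition of
  operators; \<open>fock_act_ideal\<close> lets it pass to the quotient.\<close>

definition fock_act ::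
  "('v mword \<Rightarrow>\<^sub>0 'k) \<Rightarrow> (nat set \<Rightarrow> (svar, 'k) mpoly) \<Rightarrow> nat set \<Rightarrow> (svar,
      'k::{comm_ring_1,real_algebra_1}) mpoly" where
  "fock_act p f K = (\<Sum>w\<in>Poly_Mapping.keys p.
     Poly_Mapping.single 0 (Poly_Mapping.lookup p w) * foldr (\<lambda>v. fock_mult N (idx v)) (letters w) f K)"

lemma fock_act_add: "fock_act (p + q) f = (\<lambda>K. fock_act p f K + fock_act q f K)"
  unfolding fock_act_def
  by (rule ext, rule setsum_keys_plus_distrib) (simp_all add: single_add distrib_right)

lemma fock_act_single:
  "fock_act (Poly_Mapping.single w c) f =
    (\<lambda>K. Poly_Mapping.single 0 c * foldr (\<lambda>v. fock_mult N (idx v)) (letters w) f K)"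
  by (rule ext) (auto simp: fock_act_def)

lemma foldr_fock_mult_linear:
  "foldr (\<lambda>v. fock_mult N (idx v)) ws (\<lambda>K. f K + g K) =
    (\<lambda>K. foldr (\<lambda>v. fock_mult N (idx v)) ws f K + foldr (\<lambda>v. fock_mult N (idx v)) ws g K)"
  "foldr (\<lambda>v. fock_mult N (idx v)) ws (\<lambda>K. c * f K) = (\<lambda>K. c * foldr (\<lambda>v. fock_mult N (idx v)) ws f K)"
  by (induction ws) (simp_all add: fock_mult_add fock_mult_scale)

lemma fock_act_arg_add: "fock_act p (\<lambda>K. f K + g K) = (\<lambda>K. fock_act p f K + fock_act p g K)"
  by (rule ext) (simp add: fock_act_def foldr_fock_mult_linear distrib_left sum.distrib)

lemma fock_act_arg_scale: "fock_act p (\<lambda>K. c * f K) = (\<lambda>K. c * fock_act p f K)"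
  by (rule ext) (simp add: fock_act_def foldr_fock_mult_linear sum_distrib_left mult_ac)

lemma fock_act_mult: "fock_act (p * q) f = fock_act p (fock_act q f)"
proof (induction p rule: poly_mapping_single_induct)
  case (single v c)
  show ?case
  proof (induction q rule: poly_mapping_single_induct)
    case (single w d)
    have "Poly_Mapping.single 0 (c * d) = Poly_Mapping.single 0 c * Poly_Mapping.single (0 :: svar
        \<Rightarrow>\<^sub>0 nat) d"
      by (simp only: mult_single add_0_left)
    then show ?case
      by (simp add: mult_single[of v c w d] fock_act_single plus_mword_def foldr_fock_mult_linear
          mult.assoc)
  next
    case (add q1 q2)
    then show ?case by (simp add: distrib_left fock_act_add fock_act_arg_add)
  qed
next
  case (add p1 p2)
  then show ?case by (simp add: distrib_right fock_act_add)
qed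

lemma fock_act_letter: "fock_act (letter v) f = fock_mult N (idx v) f"
  by (simp add: letter_def fock_act_single)

lemma fock_act_uminus: "fock_act (- p) f = (\<lambda>K. - fock_act p f K)"
  by (rule ext) (simp add: fock_act_def single_uminus sum_negf)

lemma fock_act_diff: "fock_act (p - q) f = (\<lambda>K. fock_act p f K - fock_act q f K)"
  using fock_act_add[of p "- q" f] by (simp add: fock_act_uminus)

text \<open>An anticommutator of letters acts as multiplication by a Gram entry, and
  \<open>fock_mult\<close> is linear over polynomials, so each relator acts as zero.\<close>

lemma fock_act_ideal:
  fixes p :: "'v mword \<Rightarrow>\<^sub>0 'k::{comm_ring_1,real_algebra_1}"
  assumes idx: "\<And>v. idx v \<le> N" and p: "p \<in> two_sided_ideal radial_relations"
  shows "fock_act p f = (\<lambda>K. 0)"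
  using p
proof (induction arbitrary: f rule: two_sided_ideal.induct)
  case zero
  show ?case by (rule ext) (simp add: fock_act_def)
next
  case (gen g a b)
  obtain u v w where g: "g = (letter u * letter v + letter v * letter u) * letter w
      - letter w * (letter u * letter v + letter v * letter u)"
    using gen by (auto simp: radial_relations_def)
  have "fock_act (letter u * letter v + letter v * letter u :: 'v mword \<Rightarrow>\<^sub>0 'k) h =
      (\<lambda>K. gram (idx u) (idx v) * h K)" for h
    by (rule ext) (simp add: fock_act_add fock_act_mult fock_act_letter fock_mult_anticommute idx)
  note rel = this
  have "fock_act g h = (\<lambda>K. 0)" for h
    unfolding g fock_act_diff fock_act_mult rel fock_act_letter fock_mult_scale by simp
  then have "fock_act (a * g * b) f = fock_act a (\<lambda>K. 0 * f K)"
    by (simp add: fock_act_mult)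
  then show ?case unfolding fock_act_arg_scale by simp
next
  case (add u v)
  then show ?case by (simp add: fock_act_add)
qed

end

section \<open>Freeness of the wedges\<close>

text \<open>Linear over the coefficient ring only, because the maps in question differentiate the
  scalars.\<close>

definition poly_linear :: "((svar, 'k) mpoly \<Rightarrow> ('v, 'k::comm_ring_1) radial) \<Rightarrow> bool" where
  "poly_linear S \<longleftrightarrow> (\<forall>A B. S (A + B) = S A + S B) \<and> (\<forall>c A. S (Poly_Mapping.single 0 c * A) =
      rconst c * S A)"

locale radial_frame =
  fixes x :: 'v and y :: "nat \<Rightarrow> 'v" and N :: nat
  assumes generators: "bij_betw y {1..N} (UNIV - {x})"
begin

abbreviation gv :: "nat \<Rightarrow> 'v" where "gv \<equiv> frame x y"

lemma gv_bij: "bij_betw gv {..N} UNIV"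
proof -
  have "bij_betw gv {0} {x}" by (simp add: frame_def bij_betw_def)
  moreover have "bij_betw gv {1..N} (UNIV - {x})"
    using generators by (subst bij_betw_cong[of _ _ y]) (auto simp: frame_def)
  ultimately have "bij_betw gv ({0} \<union> {1..N}) ({x} \<union> (UNIV - {x}))"
    by (rule bij_betw_combine) auto
  moreover have "{0} \<union> {1..N} = {..N}" by auto
  ultimately show ?thesis by simp
qed

definition idx :: "'v \<Rightarrow> nat" where "idx = the_inv_into {..N} gv"

lemma idx_le: "idx v \<le> N"
  using the_inv_into_into[of gv "{..N}" v "{..N}"] gv_bij by (simp add: idx_def bij_betw_def)

lemma gv_idx: "gv (idx v) = v"
  using f_the_inv_into_f_bij_betw[OF gv_bij, of v] by (simp add: idx_def)

lemma idx_gv: "a \<le> N \<Longrightarrow> idx (gv a) = a"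
  using the_inv_into_f_f[of gv "{..N}" a] gv_bij by (simp add: idx_def bij_betw_def)

abbreviation E :: "nat set \<Rightarrow> ('v, 'k::{comm_ring_1,real_algebra_1}) radial"
  where "E \<equiv> wedge_set (\<lambda>i. vgen (gv i))"

section \<open>Coordinates through the action on the vacuum, and linear independence\<close>

definition coords :: "('v, 'k::{comm_ring_1,real_algebra_1}) radial \<Rightarrow> nat set \<Rightarrow> (svar, 'k) mpoly"
  where "coords F = fock_act N idx (rep_radial F) (\<lambda>K. if K = {} then 1 else 0)"

text \<open>Two representatives differ by an element of the ideal, which acts as zero, so the chosen
  representative is immaterial.\<close>

lemma coords_abs: "coords (abs_radial p) = fock_act N idx p (\<lambda>K. if K = {} then 1 else 0)"
proof -
  have "ideal_cong radial_relations (rep_radial (abs_radial p)) p"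
    by (metis Quotient3_abs_rep[OF Quotient3_radial] radial.abs_eq_iff)
  then have "rep_radial (abs_radial p) - p \<in> two_sided_ideal radial_relations"
    by (simp add: ideal_cong_def)
  from fock_act_ideal[where idx = idx and N = N, OF idx_le this] show ?thesis
    by (auto simp: coords_def fock_act_diff fun_eq_iff)
qed

lemma radial_cases: obtains p where "F = abs_radial p"
  using Quotient3_abs_rep[OF Quotient3_radial] by metis

lemma coords_add: "coords (F + G) = (\<lambda>K. coords F K + coords G K)"
  by (cases F rule: radial_cases, cases G rule: radial_cases)
    (simp add: plus_radial.abs_eq coords_abs fock_act_add)

lemma coords_rconst: "coords (rconst c * F) = (\<lambda>K. Poly_Mapping.single 0 c * coords F K)"
  by (cases F rule: radial_cases)
    (simp add: rconst.abs_eq times_radial.abs_eq coords_abs fock_act_mult fock_act_single letters_zero)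

lemma coords_vgen: "coords (vgen v * F) = fock_mult N (idx v) (coords F)"
  by (cases F rule: radial_cases)
    (simp add: vgen.abs_eq times_radial.abs_eq coords_abs fock_act_mult fock_act_letter)

lemma coords_1: "coords (1 :: ('v, 'k::{comm_ring_1,real_algebra_1}) radial) K = (if K =
    {} then 1 else 0)"
proof -
  have "coords (1 :: ('v, 'k) radial) = fock_act N idx (Poly_Mapping.single 0 1) (\<lambda>K. if K =
      {} then 1 else 0)"
    by (simp add: one_radial.abs_eq coords_abs)
  then show ?thesis unfolding fock_act_single letters_zero by simp
qed

lemma coords_0: "coords 0 = (\<lambda>K. 0)"
  using coords_rconst[of 0 0] by (simp add: rconst_0)

lemma coords_sum: "coords (sum f I) = (\<lambda>K. \<Sum>i\<in>I. coords (f i) K)"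
  by (induction I rule: infinite_finite_induct) (simp_all add: coords_0 coords_add)

lemma coords_acomm:
  assumes "a \<le> N" "b \<le> N"
  shows "coords (acomm (vgen (gv a)) (vgen (gv b)) * F) = (\<lambda>K. gram a b * coords F K)"
  using assms by (auto simp: acomm_def distrib_right mult.assoc coords_add coords_vgen idx_gv
      fock_mult_anticommute)

text \<open>Up to a factor 2 at r, the generating scalars are anticommutators, and these act on
  coordinates by Gram entries.\<close>

lemma coords_scal:
  fixes A :: "(svar, 'k::{comm_ring_1,real_algebra_1}) mpoly"
  assumes "A \<in> scalar_polys N"
  shows "coords (scal x y N A * F) = (\<lambda>K. A * coords F K)"
  using assms
proof (induction arbitrary: F rule: scalar_polys_induct)
  case (const c)
  then show ?case by (simp add: scal_const coords_rconst)
next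
  case (mvar v)
  \<comment> \<open>Only 2 x^2 is an anticommutator; multiplying by \<open>half\<close> removes the
    2.\<close>
  have VR: "coords (vgen x * vgen x * F) K = mvar VR * coords F K" for K
  proof -
    have "coords (acomm (vgen (gv 0)) (vgen (gv 0)) * F) K = 2 * mvar VR * coords F K"
      by (simp add: coords_acomm gram_def)
    then have "coords (vgen x * vgen x * F) K + coords (vgen x * vgen x * F) K =
        mvar VR * coords F K + mvar VR * coords F K"
      by (simp only: acomm_def frame_def refl if_True distrib_right coords_add mult_2)
    then have "half * (coords (vgen x * vgen x * F) K + coords (vgen x * vgen x * F) K) =
        half * (mvar VR * coords F K + mvar VR * coords F K)" by simp
    then show ?thesis unfolding distrib_left half_add_half .
  qed
  have VS: "coords (scal x y N (mvar (VS i)) * F) = (\<lambda>K. mvar (VS i) * coords F K)"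
      if "1 \<le> i" "i \<le> N" for i
    using coords_acomm[of 0 i F] that by (simp add: scal_VS frame_def gram_def)
  have VC: "coords (scal x y N (mvar (VC i j)) * F) = (\<lambda>K. mvar (VC i j) * coords F K)"
    if "1 \<le> i" "i \<le> j" "j \<le> N" for i j
    using coords_acomm[of i j F] that by (simp add: scal_VC frame_def gram_def min_def max_def)
  show ?case using mvar VR VS VC by (auto simp: svars_def scal_VR)
next
  case (add A B)
  then show ?case by (simp add: scal_add distrib_right coords_add)
next
  case (mult A B)
  then show ?case by (simp add: scal_mult mult.assoc)
qed

lemma scal_sg: "scal x y N (sg J j) = (sg J j :: ('v, 'k::{comm_ring_1,real_algebra_1}) radial)"
proof -
  have "scal x y N (- 1) = (- 1 :: ('v, 'k) radial)"
    using scal_const[of x y N "- 1"] by (simp add: single_uminus rconst_uminus rconst_1)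
  then show ?thesis by (simp add: sg_def minus_one_power_iff scal_1)
qed

lemma sg_scalar_polys: "sg J j \<in> scalar_polys N"
  by (simp add: sg_def minus_one_power_iff scalar_polys_1 scalar_polys_uminus)

lemma coords_sg: "coords (sg J j * F) = (\<lambda>K. sg J j * coords F K)"
  using coords_scal[OF sg_scalar_polys, of J j F] by (simp add: scal_sg)

lemma E_wedge_system: "wedge_system (\<lambda>i. vgen (gv i)) E"
  by (rule wedge_system_radial)

text \<open>\<open>vector_mult_wedge\<close> after division by 2, in the shape of
  \<open>fock_mult\<close>.\<close>

lemma vgen_mult_E:
  fixes J :: "nat set"
  assumes "finite J"
  shows "vgen (gv a) * E J = (if a \<in> J then 0 else sg J a * E (insert a J)) +
    rconst (of_real (1 / 2)) * (\<Sum>j\<in>J. sg J j * (acomm (vgen (gv a)) (vgen (gv j)) * (E (J - {j})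
        :: ('v, 'k::{comm_ring_1,real_algebra_1}) radial)))"
proof -
  let ?h = "rconst (of_real (1 / 2)) :: ('v, 'k) radial"
  have "?h * 2 = rconst (of_real (1 / 2) * of_real 2)"
    by (simp only: rconst_mult of_real_numeral rconst_numeral)
  also have "of_real (1 / 2) * of_real 2 = (1 :: 'k)"
    by (metis of_real_1 of_real_mult nonzero_divide_eq_eq zero_neq_numeral)
  finally have h: "?h * (2 * a) = a" for a by (simp add: rconst_1 flip: mult.assoc)
  have "?h * (2 * (vgen (gv a) * E J)) = ?h * (2 * wedge_system.E_ext E a J +
      (\<Sum>j\<in>J. sg J j * (acomm (vgen (gv j)) (vgen (gv a)) * E (J - {j}))))"
    by (simp only: wedge_system.vector_mult_wedge[OF E_wedge_system assms])
  then show ?thesis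
    unfolding distrib_left h wedge_system.E_ext_def[OF E_wedge_system]
        by (simp add: acomm_commute[of "vgen (gv a)"])
qed

text \<open>Linear independence: a wedge sends the vacuum to the basis vector of its index set. For
  a in J, generator a times the wedge over J - {a} is expanded both in the algebra and in the
  representation. By induction the contraction parts agree and cancel, leaving the exterior
  parts.\<close>

lemma coords_E:
  assumes "J \<subseteq> {..N}"
  shows "coords (E J :: ('v, 'k::{comm_ring_1,real_algebra_1}) radial) K = (if K = J then 1 else 0)"
proof -
  have "finite J" using assms by (rule finite_subset) simp
  then show ?thesis using assms
  proof (induction J arbitrary: K rule: finite_psubset_induct)
    case (psubset J)
    show ?case
    proof (cases "J = {}")
      case True
      then show ?thesis by (simp add: wedge_set_empty coords_1)
    next
      case False
      then obtain a where a: "a \<in> J" by auto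
      define I where "I = J - {a}"
      have I: "J = insert a I" "a \<notin> I" "finite I" "I \<subset> J" "I \<subseteq> {..N}" "a \<le> N"
        using a psubset by (auto simp: I_def)
      have IH: "coords (E I :: ('v, 'k) radial) = (\<lambda>K. if K = I then 1 else 0)"
        using psubset.IH[OF I(4) I(5)] by (intro ext)
      have IH': "coords (E (I - {j}) :: ('v, 'k) radial) = (\<lambda>K. if K = I - {j} then 1 else 0)" for j
      proof -
        have "I - {j} \<subset> J" "I - {j} \<subseteq> {..N}" using I by auto
        from psubset.IH[OF this] show ?thesis by (intro ext)
      qed
      let ?X = "\<Sum>j\<in>I. sg I j * (acomm (vgen (gv a)) (vgen (gv j)) * E (I - {j})) :: ('v, 'k) radial"
      have X: "coords ?X K = (\<Sum>j\<le>N. gram a j * annihilation j (\<lambda>K. if K = I then 1 else 0) K)"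
      proof -
        have "coords ?X K = (\<Sum>j\<in>I. sg I j * (gram a j * (if K = I - {j} then 1 else 0)))"
          unfolding coords_sum coords_sg
        proof (intro sum.cong refl)
          fix j assume "j \<in> I"
          then have "j \<le> N" using I(5) by auto
          then show "sg I j * coords (acomm (vgen (gv a)) (vgen (gv j)) * E (I - {j}) :: ('v, 'k)
              radial) K =
              sg I j * (gram a j * (if K = I - {j} then 1 else 0))"
            by (simp add: coords_acomm I(6) IH')
        qed
        also have "\<dots> = (\<Sum>j\<le>N. gram a j * annihilation j (\<lambda>K. if K = I then 1 else 0) K)"
          using I by (intro sum.mono_neutral_cong_left) (auto simp: annihilation_def sg_remove_self
              insert_absorb mult.commute)
        finally show ?thesis .
      qed
      have "coords (vgen (gv a) * E I :: ('v, 'k) radial) K = coords (sg I a * E J :: ('v, 'k)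
          radial) K + half * coords ?X K"
        unfolding vgen_mult_E[OF I(3)] using I by (simp add: coords_add coords_rconst half_def)
      moreover have "coords (vgen (gv a) * E I :: ('v, 'k) radial) K = creation a (\<lambda>K. if K =
          I then 1 else 0) K + half * coords ?X K"
        unfolding coords_vgen idx_gv[OF I(6)] fock_mult_def IH X ..
      ultimately have "sg I a * coords (E J :: ('v, 'k) radial) K = creation a (\<lambda>K. if K =
          I then 1 else 0) K"
        by (simp add: coords_sg)
      then have "sg I a * (sg I a * coords (E J :: ('v, 'k) radial) K) = sg I a * creation a (\<lambda>K.
          if K = I then 1 else 0) K"
        by simp
      moreover have "sg I a * creation a (\<lambda>K. if K = I then 1 else 0) K =
          (if K = J then 1 else 0 :: (svar, 'k) mpoly)"
      proof (cases "a \<in> K \<and> K - {a} = I")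
        case True
        then have "K = J" using I by auto
        then show ?thesis using True sg_square[of I a 1] I sg_insert_self[of a I, where 'a =
            "(svar, 'k) mpoly"]
          by (simp add: creation_def)
      next
        case False
        then have "K \<noteq> J" using I by auto
        then show ?thesis using False by (auto simp: creation_def)
      qed
      ultimately show ?thesis by (simp add: sg_square)
    qed
  qed
qed

section \<open>Spanning: recovering an element from its coordinates\<close>

definition comb :: "(nat set \<Rightarrow> (svar, 'k) mpoly) \<Rightarrow> ('v, 'k::{comm_ring_1,real_algebra_1}) radial"
  where "comb f = (\<Sum>J\<in>Pow {..N}. E J * scal x y N (f J))"

lemma coords_E_scal:
  assumes "J \<subseteq> {..N}" "A \<in> scalar_polys N"
  shows "coords (E J * scal x y N A) = (\<lambda>K. if K = J then A else 0)"
  using coords_scal[OF assms(2), of "E J"] assms(1)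
  by (auto simp: centralD[OF scal_central] coords_E fun_eq_iff)

lemma sum_insert_reindex:
  assumes "a \<le> N"
  shows "(\<Sum>K\<in>Pow {..N}. if a \<in> K then F K else 0) = (\<Sum>J\<in>Pow {..N}. if a \<in> J then 0 else F (insert a J))"
proof -
  have "(\<Sum>K\<in>Pow {..N}. if a \<in> K then F K else 0) = (\<Sum>K\<in>{K\<in>Pow {..N}. a \<in> K}. F K)"
    by (intro sum.mono_neutral_cong_right) auto
  also have "\<dots> = (\<Sum>J\<in>{J\<in>Pow {..N}. a \<notin> J}. F (insert a J))"
    using assms by (intro sum.reindex_bij_witness[of _ "insert a" "\<lambda>K. K - {a}"]) (auto
        simp: insert_absorb)
  also have "\<dots> = (\<Sum>J\<in>Pow {..N}. if a \<in> J then 0 else F (insert a J))"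
    by (intro sum.mono_neutral_cong_left) auto
  finally show ?thesis .
qed

text \<open>The left side collects by target set K, the right side by source set J. Passing between
  them means K = insert a J in the creation part and J = insert j K in the contraction part; the two
  parts together are \<open>vgen_mult_E\<close>.\<close>

lemma comb_fock_mult:
  assumes a: "a \<le> N"
  shows "comb (fock_mult N a f) = vgen (gv a) * comb (f :: nat set \<Rightarrow> (svar,
      'k::{comm_ring_1,real_algebra_1}) mpoly)"
proof -
  let ?h = "rconst (of_real (1 / 2)) :: ('v, 'k) radial"
  let ?s = "scal x y N :: (svar, 'k) mpoly \<Rightarrow> ('v, 'k) radial"
  let ?c = "\<lambda>j. acomm (vgen (gv a)) (vgen (gv j)) :: ('v, 'k) radial"
  have "E K * ?s (fock_mult N a f K) = (if a \<in> K then sg K a * (E K * ?s (f (K - {a}))) else 0) +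
      ?h * (\<Sum>j\<le>N. ?c j * (if j \<in> K then 0 else sg K j * (E K * ?s (f (insert j K)))))" for K
  proof -
    have "?s (creation a f K) = (if a \<in> K then sg K a * ?s (f (K - {a})) else 0)"
      by (simp add: creation_def scal_mult scal_sg scal_0)
    moreover have "?s (half * (\<Sum>j\<le>N. gram a j * annihilation j f K)) =
        ?h * (\<Sum>j\<le>N. ?c j * (if j \<in> K then 0 else sg K j * ?s (f (insert j K))))"
      unfolding half_def scal_mult scal_const scal_sum using a
      by (intro arg_cong2[where f = times] sum.cong refl) (auto simp: scal_gram annihilation_def
          scal_mult scal_sg scal_0)
    ultimately show ?thesis
      unfolding fock_mult_def scal_add distrib_left
      by (auto simp: sg_left_commute[of "E K"] rconst_left_commute[of "E K"] sum_distrib_left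
          central_left_commute[OF acomm_vgen_central] if_distrib[of "\<lambda>z. E K * z"]
              if_distrib[of "\<lambda>z. ?c _ * z"]
          intro!: sum.cong)
  qed
  then have "comb (fock_mult N a f) =
      (\<Sum>K\<in>Pow {..N}. if a \<in> K then sg K a * (E K * ?s (f (K - {a}))) else 0) +
      ?h * (\<Sum>K\<in>Pow {..N}. \<Sum>j\<le>N. ?c j * (if j \<in> K then 0 else sg K j * (E K * ?s (f (insert j K)))))"
    by (simp add: comb_def sum.distrib sum_distrib_left)
  also have "(\<Sum>K\<in>Pow {..N}. if a \<in> K then sg K a * (E K * ?s (f (K - {a}))) else 0) =
      (\<Sum>J\<in>Pow {..N}. (if a \<in> J then 0 else sg J a * E (insert a J)) * ?s (f J))"
    unfolding sum_insert_reindex[OF a]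
    by (intro sum.cong refl) (auto simp: sg_insert_self mult.assoc insert_Diff_if)
  also have "(\<Sum>K\<in>Pow {..N}. \<Sum>j\<le>N. ?c j * (if j \<in> K then 0 else sg K j * (E K * ?s (f (insert j K))))) =
      (\<Sum>j\<le>N. ?c j * (\<Sum>K\<in>Pow {..N}. if j \<in> K then 0 else sg K j * (E K * ?s (f (insert j K)))))"
    by (subst sum.swap) (simp add: sum_distrib_left)
  also have "\<dots> = (\<Sum>j\<le>N. ?c j * (\<Sum>J\<in>Pow {..N}. if j \<in> J then sg J j * (E (J - {j}) * ?s (f J)) else 0))"
    by (intro sum.cong refl, subst sum_insert_reindex) (auto intro!: sum.cong arg_cong2[where f =
        times] simp: sg_insert_self insert_Diff_if)
  also have "\<dots> = (\<Sum>J\<in>Pow {..N}. (\<Sum>j\<le>N. if j \<in> J then sg J j * (?c j * E (J - {j})) else 0) * ?s (f J))"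
    unfolding sum_distrib_left sum_distrib_right
    by (subst sum.swap) (intro sum.cong refl, auto simp: sg_left_commute[of "acomm u v"
        for u v] mult.assoc)
  also have "\<dots> = (\<Sum>J\<in>Pow {..N}. (\<Sum>j\<in>J. sg J j * (?c j * E (J - {j}))) * ?s (f J))"
    by (intro sum.cong refl arg_cong2[where f = times] sum.mono_neutral_cong_right) auto
  also have "(\<Sum>J\<in>Pow {..N}. (if a \<in> J then 0 else sg J a * E (insert a J)) * ?s (f J)) +
      ?h * (\<Sum>J\<in>Pow {..N}. (\<Sum>j\<in>J. sg J j * (?c j * E (J - {j}))) * ?s (f J)) =
      (\<Sum>J\<in>Pow {..N}. ((if a \<in> J then 0 else sg J a * E (insert a J)) +
      ?h * (\<Sum>j\<in>J. sg J j * (?c j * E (J - {j})))) * ?s (f J))"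
    by (subst sum_distrib_left) (simp only: sum.distrib[symmetric] distrib_right mult.assoc)
  finally have "comb (fock_mult N a f) = (\<Sum>J\<in>Pow {..N}. ((if a \<in> J then 0 else sg J a * E (insert a
      J)) +
      ?h * (\<Sum>j\<in>J. sg J j * (?c j * E (J - {j})))) * ?s (f J))"
    .
  also have "\<dots> = (\<Sum>J\<in>Pow {..N}. vgen (gv a) * E J * ?s (f J))"
    by (intro sum.cong refl, subst vgen_mult_E) (auto intro: finite_subset)
  finally show ?thesis by (simp add: comb_def sum_distrib_left mult.assoc)
qed

text \<open>\<open>coords\<close> turns left multiplication by a generator into
  \<open>fock_mult\<close>, and \<open>comb\<close> turns it back, so induction over words
  suffices.\<close>

lemma comb_coords: "comb (coords F) = (F :: ('v, 'a::{comm_ring_1,real_algebra_1}) radial)"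
proof (induction F rule: radial_induct)
  case one
  have "comb (coords (1 :: ('v, 'a) radial)) = (\<Sum>J\<in>Pow {..N}. if J = {} then 1 else 0)"
    unfolding comb_def by (intro sum.cong refl) (auto simp: coords_1 wedge_set_empty scal_1 scal_0)
  then show ?case by simp
next
  case (vgen v F)
  then show ?case by (simp add: coords_vgen comb_fock_mult idx_le gv_idx)
next
  case (const c F)
  have "comb (\<lambda>K. Poly_Mapping.single 0 c * f K) = rconst c * comb f" for f :: "nat set \<Rightarrow> (svar, 'a)
      mpoly"
    by (simp add: comb_def scal_mult scal_const rconst_left_commute sum_distrib_left)
  then show ?case using const by (simp add: coords_rconst)
next
  case (add F G)
  have "comb (\<lambda>K. f K + g K) = comb f + comb g" for f g :: "nat set \<Rightarrow> (svar, 'a) mpoly"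
    by (simp add: comb_def scal_add distrib_left sum.distrib)
  then show ?case using add by (simp add: coords_add)
qed

lemma creation_scalar_polys: "(\<And>K. f K \<in> scalar_polys N) \<Longrightarrow> creation a f K \<in> scalar_polys N"
  by (simp add: creation_def scalar_polys_0 scalar_polys_mult sg_scalar_polys)

lemma annihilation_scalar_polys: "(\<And>K. f K \<in> scalar_polys N) \<Longrightarrow> annihilation a f K \<in> scalar_polys N"
  by (simp add: annihilation_def scalar_polys_0 scalar_polys_mult sg_scalar_polys)

text \<open>Generators have indices at most N, so only Gram entries in the admissible variables
  occur.\<close>

lemma coords_scalar_polys: "coords F K \<in> scalar_polys N"
proof (induction F arbitrary: K rule: radial_induct)
  case one
  then show ?case by (simp add: coords_1 scalar_polys_0 scalar_polys_1)
next
  case (vgen v F)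
  then show ?case
    unfolding coords_vgen fock_mult_def half_def
    by (intro scalar_polys_add scalar_polys_mult scalar_polys_sum scalar_polys_const
        creation_scalar_polys
        annihilation_scalar_polys gram_scalar_polys) (auto simp: idx_le)
qed (simp_all add: coords_rconst coords_add scalar_polys_mult scalar_polys_const scalar_polys_add)

section \<open>Linear operators prescribed on the decomposition\<close>

lemma radial_linear_sum: "radial_linear D \<Longrightarrow> D (sum f I) = (\<Sum>i\<in>I. D (f i))"
proof (induction I rule: infinite_finite_induct)
  case (infinite I)
  then have "D (rconst 0 * 0) = rconst 0 * D 0" unfolding radial_linear_def by blast
  then show ?case using infinite by (simp add: rconst_0)
next
  case empty
  then have "D (rconst 0 * 0) = rconst 0 * D 0" unfolding radial_linear_def by blast
  then show ?case by (simp add: rconst_0)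
qed (simp add: radial_linear_def)

lemma radial_linear_unique:
  assumes "radial_linear D" "radial_linear D'"
    and "\<And>J A. J \<subseteq> {..N} \<Longrightarrow> A \<in> scalar_polys N \<Longrightarrow> D (E J * scal x y N A) = D' (E J * scal x y N A)"
  shows "D = D'"
proof
  fix F
  have "D (comb (coords F)) = D' (comb (coords F))"
    unfolding comb_def radial_linear_sum[OF assms(1)] radial_linear_sum[OF assms(2)]
    by (intro sum.cong refl assms(3)) (auto simp: coords_scalar_polys)
  then show "D F = D' F" by (simp add: comb_coords)
qed

text \<open>The maps \<open>T J\<close> are applied to coordinates and need not be linear over the
  scalars, so derivatives are allowed; freeness makes the prescription consistent.\<close>

definition extend ::
  "(nat set \<Rightarrow> (svar, 'k) mpoly \<Rightarrow> ('v, 'k) radial) \<Rightarrow> ('v, 'k::{comm_ring_1,real_algebra_1}) radial \<Rightarrow>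
      ('v, 'k) radial"
  where "extend T F = (\<Sum>J\<in>Pow {..N}. T J (coords F J))"

lemma extend_linear:
  assumes "\<And>J. poly_linear (T J)"
  shows "radial_linear (extend T)"
  using assms unfolding radial_linear_def poly_linear_def extend_def
  by (simp add: coords_add coords_rconst sum.distrib sum_distrib_left)

lemma extend_basis:
  assumes "\<And>J. poly_linear (T J)" "J \<subseteq> {..N}" "A \<in> scalar_polys N"
  shows "extend T (E J * scal x y N A) = T J A"
proof -
  have "T J (Poly_Mapping.single 0 0 * 0) = rconst 0 * T J 0" for J
    using assms(1) unfolding poly_linear_def by blast
  then have "T J 0 = 0" for J by (simp add: rconst_0)
  then have "extend T (E J * scal x y N A) = (\<Sum>K\<in>Pow {..N}. if K = J then T J A else 0)"
    unfolding extend_def coords_E_scal[OF assms(2,3)] by (intro sum.cong) auto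
  then show ?thesis using assms(2) by simp
qed

end

section \<open>Scalar derivatives\<close>

text \<open>In a cancellative index monoid, multiplying by a single term shifts the indices; this
  lets such a term be cancelled from an equation.\<close>

lemma lookup_single_mult:
  fixes g :: "'a::cancel_comm_monoid_add \<Rightarrow>\<^sub>0 'b::semiring_0"
  shows "Poly_Mapping.lookup (Poly_Mapping.single a c * g) (a + m) = c * Poly_Mapping.lookup g m"
  by (induction g rule: poly_mapping_single_induct)
    (simp_all add: mult_single lookup_single distrib_left lookup_add when_def)

lemma lookup_const_mult:
  fixes g :: "'a::cancel_comm_monoid_add \<Rightarrow>\<^sub>0 'b::semiring_0"
  shows "Poly_Mapping.lookup (Poly_Mapping.single 0 c * g) m = c * Poly_Mapping.lookup g m"
  using lookup_single_mult[of 0 c g m] by simp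

lemma single_add_diff:
  fixes m :: "'i \<Rightarrow>\<^sub>0 nat"
  assumes "Poly_Mapping.lookup m u \<noteq> 0"
  shows "Poly_Mapping.single u 1 + (m - Poly_Mapping.single u 1) = m"
  using assms by (intro poly_mapping_eqI) (auto simp: lookup_add lookup_minus lookup_single when_def)

lemma mpderiv_add: "mpderiv u (f + g) = mpderiv u f + mpderiv u g"
  unfolding mpderiv_def
  by (rule setsum_keys_plus_distrib) (simp_all add: distrib_left single_add)

lemma mpderiv_single:
  "mpderiv u (Poly_Mapping.single m c) = Poly_Mapping.single (m - Poly_Mapping.single u 1) (of_nat
      (Poly_Mapping.lookup m u) * c)"
  by (simp add: mpderiv_def)

lemma mpderiv_const_mult:
  fixes c :: "'a::ring_1"
  shows "mpderiv u (Poly_Mapping.single 0 c * f) = Poly_Mapping.single 0 c * mpderiv u f"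
proof (induction f rule: poly_mapping_single_induct)
  case (single m d)
  have "of_nat n * (c * d) = c * (of_nat n * d)" for n
    by (metis mult.assoc mult_of_nat_commute)
  then show ?case by (simp add: mult_single mpderiv_single)
next
  case (add p q)
  then show ?case by (simp add: distrib_left mpderiv_add)
qed

text \<open>Coefficients need not commute, so the factors keep their order and only the
  natural-number exponents slide past them. Where an exponent is 0 the truncated difference of
  monomials is harmless, as its coefficient is 0.\<close>

lemma mpderiv_mult:
  fixes f g :: "('i, 'a::ring_1) mpoly"
  shows "mpderiv u (f * g) = mpderiv u f * g + f * mpderiv u g"
proof (induction f rule: poly_mapping_single_induct)
  case (single m c)
  show ?case
  proof (induction g rule: poly_mapping_single_induct)
    case (single n d)
    have m: "m + n - Poly_Mapping.single u 1 = (m - Poly_Mapping.single u 1) + n"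
        if "Poly_Mapping.lookup m u \<noteq> 0"
      using that by (intro poly_mapping_eqI) (auto simp: lookup_add lookup_minus lookup_single when_def)
    have n: "m + n - Poly_Mapping.single u 1 = m + (n - Poly_Mapping.single u 1)"
        if "Poly_Mapping.lookup n u \<noteq> 0"
      using that by (intro poly_mapping_eqI) (auto simp: lookup_add lookup_minus lookup_single when_def)
    have "of_nat k * (c * d) = c * (of_nat k * d)" for k
      by (metis mult.assoc mult_of_nat_commute)
    then show ?case
      using m n by (cases "Poly_Mapping.lookup m u = 0"; cases "Poly_Mapping.lookup n u = 0")
        (simp_all add: mult_single mpderiv_single lookup_add distrib_right single_add mult.assoc)
  next
    case (add p q)
    then show ?case by (simp add: distrib_left mpderiv_add add_ac)
  qed
next
  case (add p q)
  then show ?case by (simp add: distrib_right mpderiv_add add_ac)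
qed

section \<open>q-numbers and the Jackson quotient\<close>

definition q_number :: "'k::comm_ring_1 \<Rightarrow> nat \<Rightarrow> 'k"
  where "q_number P n = (\<Sum>k<n. P ^ k)"

lemma q_number_mult: "(1 - P) * q_number P n = 1 - P ^ n"
  unfolding q_number_def by (rule one_diff_power_eq[symmetric])

text \<open>The Jackson quotient in closed form, free of division since \<open>q_number\<close> is a
  geometric sum. If u does not occur in m, the truncated exponent is harmless because
  \<open>q_number P 0 = 0\<close>.\<close>

definition q_difference :: "'i \<Rightarrow> 'k \<Rightarrow> ('i, 'k::comm_ring_1) mpoly \<Rightarrow> ('i, 'k) mpoly" where
  "q_difference u P f = (\<Sum>m\<in>Poly_Mapping.keys f.
     Poly_Mapping.single (m - Poly_Mapping.single u 1)
       (q_number P (Poly_Mapping.lookup m u) * Poly_Mapping.lookup f m))"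

lemma q_difference_add: "q_difference u P (f + g) = q_difference u P f + q_difference u P g"
  unfolding q_difference_def
  by (rule setsum_keys_plus_distrib) (simp_all add: distrib_left single_add)

lemma q_difference_single:
  "q_difference u P (Poly_Mapping.single m c) =
    Poly_Mapping.single (m - Poly_Mapping.single u 1) (q_number P (Poly_Mapping.lookup m u) * c)"
  by (simp add: q_difference_def)

lemma q_difference_const_mult:
  "q_difference u P (Poly_Mapping.single 0 c * f) = Poly_Mapping.single 0 c * q_difference u P f"
proof (induction f rule: poly_mapping_single_induct)
  case (single m d)
  then show ?case by (simp add: mult_single q_difference_single mult.left_commute)
next
  case (add p q)
  then show ?case by (simp add: distrib_left q_difference_add)
qed

lemma q_shift_add: "q_shift u P (f + g) = q_shift u P f + q_shift u P g"
  unfolding q_shift_def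
  by (rule setsum_keys_plus_distrib) (simp_all add: distrib_left single_add)

lemma q_shift_single:
  "q_shift u P (Poly_Mapping.single m c) = Poly_Mapping.single m (P ^ Poly_Mapping.lookup m u * c)"
  by (simp add: q_shift_def)

lemma q_shift_const_mult: "q_shift u P (Poly_Mapping.single 0 c * f) = Poly_Mapping.single 0 c *
    q_shift u P f"
proof (induction f rule: poly_mapping_single_induct)
  case (single m d)
  then show ?case by (simp add: mult_single q_shift_single mult.left_commute)
next
  case (add p q)
  then show ?case by (simp add: distrib_left q_shift_add)
qed

lemma q_difference_quotient:
  "Poly_Mapping.single 0 (1 - P) * mvar u * q_difference u P f = f - q_shift u P f"
proof (induction f rule: poly_mapping_single_induct)
  case (single m c)
  let ?n = "Poly_Mapping.lookup m u"
  have "Poly_Mapping.single 0 (1 - P) * mvar u * q_difference u P (Poly_Mapping.single m c) =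
      Poly_Mapping.single (Poly_Mapping.single u 1 + (m - Poly_Mapping.single u 1)) ((1 - P) *
          q_number P ?n * c)"
    by (simp add: mvar_def mult_single q_difference_single mult.assoc)
  also have "\<dots> = Poly_Mapping.single m ((1 - P ^ ?n) * c)"
    using single_add_diff[of m u] by (cases "?n = 0") (simp_all add: q_number_mult)
  also have "\<dots> = Poly_Mapping.single m c - q_shift u P (Poly_Mapping.single m c)"
    by (simp add: q_shift_single left_diff_distrib single_diff)
  finally show ?case .
next
  case (add p q)
  then show ?case by (simp add: distrib_left q_difference_add q_shift_add)
qed

text \<open>Uniqueness of the quotient: multiplication by the single term (1 - P) u shifts
  monomials, and 1 - P can be cancelled in a domain.\<close>

lemma jackson_eq_q_difference:
  fixes P :: "'k::idom"
  assumes "P \<noteq> 1"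
  shows "jackson u P f = q_difference u P f"
  unfolding jackson_def
proof (rule the_equality)
  show "Poly_Mapping.single 0 (1 - P) * mvar u * q_difference u P f = f - q_shift u P f"
    by (rule q_difference_quotient)
next
  fix g assume "Poly_Mapping.single 0 (1 - P) * mvar u * g = f - q_shift u P f"
  then have eq: "Poly_Mapping.single (Poly_Mapping.single u 1) (1 - P) * g =
      Poly_Mapping.single (Poly_Mapping.single u 1) (1 - P) * q_difference u P f"
    using q_difference_quotient[of P u f] by (simp add: mvar_def mult_single)
  show "g = q_difference u P f"
  proof (rule poly_mapping_eqI)
    fix m
    have "(1 - P) * Poly_Mapping.lookup g m = (1 - P) * Poly_Mapping.lookup (q_difference u P f) m"
      using eq by (metis lookup_single_mult)
    then show "Poly_Mapping.lookup g m = Poly_Mapping.lookup (q_difference u P f) m"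
      using assms by simp
  qed
qed

lemma bq_neq_1: "bq \<noteq> 1"
  using bq_units(2) by auto

text \<open>1 - q^2 = (1 - q)(1 + q), and 1 + q is not zero since q is an indeterminate. So the
  quotient by 1 - q^2 is well defined although only 1 - q is inverted.\<close>

lemma bq_square_neq_1: "bq ^ 2 \<noteq> 1"
proof
  assume "bq ^ 2 = 1"
  then have "(1 - bq) * (1 + bq) = 0" by (simp add: algebra_simps power2_eq_square)
  then have "1 + bq = 0" using bq_neq_1 by auto
  then have "fract_of_bcoeff (1 + bq) = fract_of_bcoeff 0" by simp
  then have "1 + Fract [:[:0, 1:]:] 1 = (0 :: real poly poly fract)"
    by (simp add: plus_bcoeff.rep_eq one_bcoeff.rep_eq bq.rep_eq zero_bcoeff.rep_eq)
  then show False by (simp add: One_fract_def Zero_fract_def eq_fract one_pCons)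
qed

lemma jackson_bq: "jackson u bq f = q_difference u bq f"
  by (rule jackson_eq_q_difference[OF bq_neq_1])

lemma jackson_bq_square: "jackson u (bq ^ 2) f = q_difference u (bq ^ 2) f"
  by (rule jackson_eq_q_difference[OF bq_square_neq_1])

section \<open>Operators given on the decomposition\<close>

lemma poly_linear_scalar_derivative: "poly_linear (scalar_derivative x y N)"
proof -
  have "2 * (rconst c * F) = rconst c * (2 * F)" for c and F :: "('a, real) radial"
    by (rule rconst_left_commute)
  then show ?thesis
    unfolding poly_linear_def scalar_derivative_def
    by (simp add: mpderiv_add mpderiv_const_mult scal_add scal_mult scal_const distrib_left sum.distrib
        rconst_left_commute[of "vgen v" for v] mult.assoc flip: sum_distrib_left)
qed

lemma poly_linear_scalar_q_derivative: "poly_linear (scalar_q_derivative x y N)"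
proof -
  have "2 * (rconst c * F) = rconst c * (2 * F)" "rconst (1 + bq) * (rconst c * F) =
      rconst c * (rconst (1 + bq) * F)"
    for c and F :: "('a, bcoeff) radial"
    by (rule rconst_left_commute)+
  then show ?thesis
    unfolding poly_linear_def scalar_q_derivative_def
    by (simp add: jackson_bq jackson_bq_square q_difference_add q_difference_const_mult q_shift_add
        q_shift_const_mult
        scal_add scal_mult scal_const distrib_left sum.distrib
        rconst_left_commute[of "vgen v" for v] mult.assoc flip: sum_distrib_left)
qed

text \<open>The radial derivative (with \<open>\<beta> = 1\<close>) and the relative \<open>q\<close>-derivative both have this form.\<close>

definition is_twisted_derivative ::
  "'v \<Rightarrow> (nat \<Rightarrow> 'v) \<Rightarrow> nat \<Rightarrow> ((svar, 'k) mpoly \<Rightarrow> ('v, 'k) radial) \<Rightarrow> (nat \<Rightarrow> 'k) \<Rightarrow> (nat \<Rightarrow> 'k)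
     \<Rightarrow> (('v, 'k::{comm_ring_1,real_algebra_1}) radial \<Rightarrow> ('v, 'k) radial) \<Rightarrow> bool" where
  "is_twisted_derivative x y N S \<alpha> \<beta> D \<longleftrightarrow> radial_linear D \<and>
     (\<forall>I A. I \<subseteq> {1..N} \<and> A \<in> scalar_polys N \<longrightarrow> D (yI y I * scal x y N A) = yI y I * S A) \<and>
     (\<forall>I B. I \<subseteq> {1..N} \<and> B \<in> scalar_polys N \<longrightarrow>
        D (xyI x y I * scal x y N B) =
          (- 1) ^ card I * rconst (\<alpha> (card I)) * yI y I * scal x y N B + rconst (\<beta> (card I)) * xyI x
              y I * S B)"

context radial_frame
begin

lemma yI_eq: "I \<subseteq> {1..N} \<Longrightarrow> yI y I = E I"
  unfolding yI_def wedge_set_def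
  by (rule arg_cong[where f = wedge], rule map_cong) (auto simp: frame_def finite_subset)

lemma xyI_eq:
  assumes "I \<subseteq> {1..N}"
  shows "xyI x y I = E (insert 0 I)"
proof -
  have I: "finite I" "0 \<notin> I" using assms finite_subset by auto
  have "sorted_list_of_set (insert 0 I) = insort 0 (sorted_list_of_set I)"
    using I by simp
  also have "\<dots> = 0 # sorted_list_of_set I"
    by (rule insort_is_Cons) simp
  finally have "sorted_list_of_set (insert 0 I) = 0 # sorted_list_of_set I" .
  then show ?thesis
    unfolding xyI_def wedge_set_def
    by (intro arg_cong[where f = wedge]) (use I in \<open>auto simp: frame_def\<close>)
qed

lemma subset_cases:
  assumes "J \<subseteq> {..N}"
  obtains I where "I \<subseteq> {1..N}" "J = I" "0 \<notin> I" | I where "I \<subseteq> {1..N}" "J = insert 0 I" "0 \<notin> I"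
proof (cases "0 \<in> J")
  case True
  then show ?thesis using assms that(2)[of "J - {0}"] by force
next
  case False
  moreover have "J \<subseteq> {1..N}"
  proof
    fix i assume "i \<in> J"
    then show "i \<in> {1..N}" using False assms by (cases i) auto
  qed
  ultimately show ?thesis using that(1)[of J] by simp
qed

text \<open>Membership of 0 decides between the two families, and J - {0} recovers I, whose size
  enters the coefficients.\<close>

definition twisted_term ::
  "((svar, 'k) mpoly \<Rightarrow> ('v, 'k) radial) \<Rightarrow> (nat \<Rightarrow> 'k) \<Rightarrow> (nat \<Rightarrow> 'k) \<Rightarrow> nat set \<Rightarrow> (svar, 'k) mpoly
     \<Rightarrow> ('v, 'k::{comm_ring_1,real_algebra_1}) radial" where
  "twisted_term S \<alpha> \<beta> J A = (if 0 \<in> J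
     then (- 1) ^ card (J - {0}) * rconst (\<alpha> (card (J - {0}))) * E (J - {0}) * scal x y N A
       + rconst (\<beta> (card (J - {0}))) * E J * S A
     else E J * S A)"

lemma poly_linear_twisted_term:
  assumes "poly_linear S"
  shows "poly_linear (twisted_term S \<alpha> \<beta> J)"
  using assms unfolding poly_linear_def twisted_term_def
  by (simp add: scal_add scal_mult scal_const distrib_left rconst_left_commute[of "E K" for K]
      rconst_left_commute[of "(- 1) ^ n" for n] rconst_left_commute[of "rconst (\<alpha> n)" for n]
      rconst_left_commute[of "rconst (\<beta> n)" for n] mult.assoc)

text \<open>Existence and uniqueness at once: \<open>extend\<close> realizes the prescription and
  spanning forces it. This evaluates the definite description of the q-derivative and characterizes
  the radial derivative.\<close>

lemma is_twisted_derivative_iff: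
  assumes "poly_linear S"
  shows "is_twisted_derivative x y N S \<alpha> \<beta> D \<longleftrightarrow> D = extend (twisted_term S \<alpha> \<beta>)"
proof
  note lin = poly_linear_twisted_term[OF assms, of \<alpha> \<beta>]
  let ?D = "extend (twisted_term S \<alpha> \<beta>)"
  {
    assume "is_twisted_derivative x y N S \<alpha> \<beta> D"
    then have D: "radial_linear D"
      and y: "\<And>I A. I \<subseteq> {1..N} \<Longrightarrow> A \<in> scalar_polys N \<Longrightarrow> D (yI y I * scal x y N A) = yI y I * S A"
      and xy: "\<And>I B. I \<subseteq> {1..N} \<Longrightarrow> B \<in> scalar_polys N \<Longrightarrow> D (xyI x y I * scal x y N B) =
          (- 1) ^ card I * rconst (\<alpha> (card I)) * yI y I * scal x y N B + rconst (\<beta> (card I)) * xyI x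
              y I * S B"
      unfolding is_twisted_derivative_def by blast+
    show "D = ?D"
    proof (rule radial_linear_unique[OF D extend_linear[OF lin]])
      fix J A assume J: "J \<subseteq> {..N}" and A: "A \<in> (scalar_polys N :: (svar, 'a) mpoly set)"
      from J show "D (E J * scal x y N A) = ?D (E J * scal x y N A)"
      proof (cases rule: subset_cases)
        case (1 I)
        then show ?thesis using y[OF 1(1) A] J A
          by (simp add: extend_basis[OF lin] twisted_term_def yI_eq)
      next
        case (2 I)
        then have "insert 0 I - {0} = I" by simp
        then show ?thesis using xy[OF 2(1) A] J A 2
          by (simp add: extend_basis[OF lin] twisted_term_def yI_eq xyI_eq)
      qed
    qed
  }
  {
    assume D: "D = ?D"
    have "insert 0 I \<subseteq> {..N}" "I \<subseteq> {..N}" "0 \<notin> I" "insert 0 I - {0} = I" if "I \<subseteq> {1..N}" for I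
      using that by auto
    then show "is_twisted_derivative x y N S \<alpha> \<beta> D"
      unfolding is_twisted_derivative_def D
      by (auto simp: extend_linear[OF lin] yI_eq xyI_eq extend_basis[OF lin] twisted_term_def)
  }
qed

definition radial_derivative :: "nat \<Rightarrow> ('v, real) radial \<Rightarrow> ('v, real) radial" where
  "radial_derivative M =
     extend (twisted_term (scalar_derivative x y N) (\<lambda>p. real M - real p) (\<lambda>p. 1))"

lemma is_radial_right_derivative_iff: "is_radial_right_derivative M x y N D \<longleftrightarrow> D = radial_derivative M"
  using is_twisted_derivative_iff[OF poly_linear_scalar_derivative,
      where \<alpha> = "\<lambda>p. real M - real p" and \<beta> = "\<lambda>p. 1" and D = D]
  unfolding is_radial_right_derivative_def is_twisted_derivative_def radial_derivative_def rconst_1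
      mult_1 .

lemma relative_q_derivative_eq: "relative_q_derivative x y N =
    extend (twisted_term (scalar_q_derivative x y N) (\<lambda>p. bracket_m_plus (- int p)) (\<lambda>p. q_m_plus (-
        int p)))"
  unfolding relative_q_derivative_def
  using is_twisted_derivative_iff[OF poly_linear_scalar_q_derivative,
      where \<alpha> = "\<lambda>p. bracket_m_plus (- int p)" and \<beta> = "\<lambda>p. q_m_plus (- int p)"]
  unfolding is_twisted_derivative_def by simp

end

section \<open>Specialization and limits of coefficients\<close>

lemma poly_qden: "poly (poly (qden a b) (monom 1 M)) t = t ^ a * (1 - t) ^ b"
  by (simp add: qden_def)

text \<open>Two fractions for f agree after cross-multiplication, and their denominators stay
  nonzero at t other than 0 and 1.\<close>

lemma specialize_eq:
  assumes f: "fract_of_bcoeff f = Fract p (qden a b)" and t: "t \<noteq> 0" "t \<noteq> 1"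
  shows "specialize M f t = poly (poly p (monom 1 M)) t / (t ^ a * (1 - t) ^ b)"
  unfolding specialize_def
proof (rule the_equality)
  show "\<forall>p' a' b'. fract_of_bcoeff f = Fract p' (qden a' b') \<longrightarrow>
      poly (poly p (monom 1 M)) t / (t ^ a * (1 - t) ^ b) = poly (poly p' (monom 1 M)) t / (t ^ a' *
          (1 - t) ^ b')"
  proof (intro allI impI)
    fix p' a' b' assume "fract_of_bcoeff f = Fract p' (qden a' b')"
    then have "p * qden a' b' = p' * qden a b"
      using f by (simp add: eq_fract qden_nonzero)
    then have "poly (poly (p * qden a' b') (monom 1 M)) t = poly (poly (p' * qden a b) (monom 1 M)) t"
      by simp
    then show "poly (poly p (monom 1 M)) t / (t ^ a * (1 - t) ^ b) = poly (poly p' (monom 1 M)) t /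
        (t ^ a' * (1 - t) ^ b')"
      using t by (simp add: poly_qden frac_eq_eq)
  qed
qed (use f in blast)

lemma bcoeff_cases: obtains p a b where "fract_of_bcoeff f = Fract p (qden a b)"
  using fract_of_bcoeff[of f] by auto

context
  fixes t :: real and M :: nat
  assumes t: "t \<noteq> 0" "t \<noteq> 1"
begin

lemma specialize_add: "specialize M (f + g) t = specialize M f t + specialize M g t"
proof -
  obtain p a b where f: "fract_of_bcoeff f = Fract p (qden a b)" by (rule bcoeff_cases)
  obtain p' a' b' where g: "fract_of_bcoeff g = Fract p' (qden a' b')" by (rule bcoeff_cases)
  have "fract_of_bcoeff (f + g) = Fract (p * qden a' b' + p' * qden a b) (qden (a + a') (b + b'))"
    by (simp add: plus_bcoeff.rep_eq f g qden_nonzero qden_mult)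
  then show ?thesis
    using t by (simp add: specialize_eq[OF f] specialize_eq[OF g] specialize_eq poly_qden power_add
        field_simps)
qed

lemma specialize_mult: "specialize M (f * g) t = specialize M f t * specialize M g t"
proof -
  obtain p a b where f: "fract_of_bcoeff f = Fract p (qden a b)" by (rule bcoeff_cases)
  obtain p' a' b' where g: "fract_of_bcoeff g = Fract p' (qden a' b')" by (rule bcoeff_cases)
  have "fract_of_bcoeff (f * g) = Fract (p * p') (qden (a + a') (b + b'))"
    by (simp add: times_bcoeff.rep_eq f g qden_mult)
  then show ?thesis
    using t by (simp add: specialize_eq[OF f] specialize_eq[OF g] specialize_eq power_add)
qed

lemma specialize_of_real: "specialize M (of_real c) t = c"
proof -
  have "fract_of_bcoeff (of_real c) = Fract [:[:c:]:] (qden 0 0)"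
    by (simp add: of_real_def scaleR_bcoeff.rep_eq one_bcoeff.rep_eq qden_0_0)
  from specialize_eq[OF this t] show ?thesis by simp
qed

lemma specialize_bq: "specialize M bq t = t"
proof -
  have "fract_of_bcoeff bq = Fract [:[:0, 1:]:] (qden 0 0)"
    by (simp add: bq.rep_eq qden_0_0)
  from specialize_eq[OF this t] show ?thesis by simp
qed

lemma specialize_bQ: "specialize M bQ t = t ^ M"
proof -
  have "fract_of_bcoeff bQ = Fract [:0, 1:] (qden 0 0)"
    by (simp add: bQ.rep_eq qden_0_0)
  from specialize_eq[OF this t] show ?thesis by (simp add: poly_monom)
qed

lemma specialize_bq_inv: "specialize M bq_inv t = 1 / t"
  using specialize_eq[OF bq_inv.rep_eq t] by simp

lemma specialize_one_minus_bq_inv: "specialize M one_minus_bq_inv t = 1 / (1 - t)"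
  using specialize_eq[OF one_minus_bq_inv.rep_eq t] by simp

lemma specialize_1: "specialize M 1 t = 1"
  using specialize_of_real[of 1] by simp

lemma specialize_power: "specialize M (f ^ n) t = specialize M f t ^ n"
  by (induction n) (simp_all add: specialize_1 specialize_mult)

lemma specialize_diff: "specialize M (f - g) t = specialize M f t - specialize M g t"
  using specialize_add[of "f - g" g] by simp

end

section \<open>Limits of coefficients at q = 1\<close>

definition coeff_limit :: "nat \<Rightarrow> bcoeff \<Rightarrow> real \<Rightarrow> bool"
  where "coeff_limit M f l \<longleftrightarrow> (specialize M f \<longlongrightarrow> l) (at 1)"

text \<open>Values of \<open>specialize\<close> are controlled only away from 0 and 1; the limit at
  1 sees just such points.\<close>

lemma eventually_regular: "eventually (\<lambda>t. t \<noteq> 0 \<and> t \<noteq> (1 :: real)) (at 1)"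
proof -
  have "eventually (\<lambda>t. t \<noteq> (0 :: real)) (at 1)"
    by (rule tendsto_imp_eventually_ne[OF tendsto_ident_at]) simp
  moreover have "eventually (\<lambda>t. t \<noteq> (1 :: real)) (at 1)"
    by (simp add: eventually_at_filter)
  ultimately show ?thesis by eventually_elim simp
qed

lemma coeff_limitI:
  assumes "\<And>t. t \<noteq> 0 \<Longrightarrow> t \<noteq> 1 \<Longrightarrow> specialize M f t = h t" "(h \<longlongrightarrow> l) (at 1)"
  shows "coeff_limit M f l"
  unfolding coeff_limit_def
  by (rule Lim_transform_eventually[OF assms(2)])
    (use eventually_regular in \<open>eventually_elim, simp add: assms(1)\<close>)

lemma coeff_limit_add: "coeff_limit M f l \<Longrightarrow> coeff_limit M g k \<Longrightarrow> coeff_limit M (f + g) (l + k)"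
  by (rule coeff_limitI[where h = "\<lambda>t. specialize M f t + specialize M g t"])
    (simp_all add: specialize_add coeff_limit_def tendsto_add)

lemma coeff_limit_mult: "coeff_limit M f l \<Longrightarrow> coeff_limit M g k \<Longrightarrow> coeff_limit M (f * g) (l * k)"
  by (rule coeff_limitI[where h = "\<lambda>t. specialize M f t * specialize M g t"])
    (simp_all add: specialize_mult coeff_limit_def tendsto_mult)

lemma coeff_limit_of_real: "coeff_limit M (of_real c) c"
  by (rule coeff_limitI[where h = "\<lambda>t. c"]) (simp_all add: specialize_of_real)

lemma coeff_limit_1: "coeff_limit M 1 1"
  using coeff_limit_of_real[of M 1] by simp

lemma coeff_limit_0: "coeff_limit M 0 0"
  using coeff_limit_of_real[of M 0] by simp

lemma coeff_limit_bq: "coeff_limit M bq 1"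
  by (rule coeff_limitI[where h = "\<lambda>t. t"]) (simp_all add: specialize_bq)

lemma coeff_limit_power: "coeff_limit M f l \<Longrightarrow> coeff_limit M (f ^ n) (l ^ n)"
  by (induction n) (simp_all add: coeff_limit_1 coeff_limit_mult)

lemma coeff_limit_sum: "(\<And>i. i \<in> I \<Longrightarrow> coeff_limit M (f i) (l i)) \<Longrightarrow> coeff_limit M (sum f I) (sum l I)"
  by (induction I rule: infinite_finite_induct) (simp_all add: coeff_limit_0 coeff_limit_add)

lemma coeff_limit_q_number:
  assumes "coeff_limit M P 1"
  shows "coeff_limit M (q_number P n) (real n)"
proof -
  have "coeff_limit M (q_number P n) (\<Sum>k<n. 1 ^ k)"
    unfolding q_number_def by (intro coeff_limit_sum coeff_limit_power assms)
  then show ?thesis by simp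
qed

lemma q_m_plus_minus: "q_m_plus (- int p) = bQ * bq_inv ^ p"
  by (cases "p = 0") (simp_all add: q_m_plus_def)

lemma specialize_q_m_plus: "t \<noteq> 0 \<Longrightarrow> t \<noteq> 1 \<Longrightarrow> specialize M (q_m_plus (- int p)) t = t ^ M * (1 / t) ^ p"
  by (simp add: q_m_plus_minus specialize_mult specialize_power specialize_bQ specialize_bq_inv)

lemma coeff_limit_q_m_plus: "coeff_limit M (q_m_plus (- int p)) 1"
proof (rule coeff_limitI[where h = "\<lambda>t. t ^ M * (1 / t) ^ p"])
  have "((\<lambda>t :: real. t ^ M * (1 / t) ^ p) \<longlongrightarrow> 1 ^ M * (1 / 1) ^ p) (at 1)"
    by (intro tendsto_intros) simp
  then show "((\<lambda>t :: real. t ^ M * (1 / t) ^ p) \<longlongrightarrow> 1) (at 1)" by simp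
qed (rule specialize_q_m_plus)

text \<open>For p > M the bracket involves a negative power of t. Hence t^(-p) is factored out and
  (1 - t^M) - (1 - t^p) is divided by 1 - t, giving a difference of geometric sums that is
  continuous at 1.\<close>

lemma coeff_limit_bracket: "coeff_limit M (bracket_m_plus (- int p)) (real M - real p)"
proof (rule coeff_limitI[where h = "\<lambda>t. (1 / t) ^ p * ((\<Sum>k<M. t ^ k) - (\<Sum>k<p. t ^ k))"])
  fix t :: real assume t: "t \<noteq> 0" "t \<noteq> 1"
  have "1 - t ^ M * (1 / t) ^ p = (1 / t) ^ p * ((1 - t ^ M) - (1 - t ^ p))"
    using t by (simp add: field_simps)
  also have "\<dots> = (1 - t) * ((1 / t) ^ p * ((\<Sum>k<M. t ^ k) - (\<Sum>k<p. t ^ k)))"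
    unfolding one_diff_power_eq by (simp add: algebra_simps)
  finally show "specialize M (bracket_m_plus (- int p)) t = (1 / t) ^ p * ((\<Sum>k<M. t ^ k) - (\<Sum>k<p. t
      ^ k))"
    using t by (simp add: bracket_m_plus_def specialize_mult specialize_diff specialize_1
        specialize_q_m_plus specialize_one_minus_bq_inv)
next
  have "((\<lambda>t :: real. (1 / t) ^ p * ((\<Sum>k<M. t ^ k) - (\<Sum>k<p. t ^ k))) \<longlongrightarrow>
      (1 / 1) ^ p * ((\<Sum>k<M. 1 ^ k) - (\<Sum>k<p. 1 ^ k))) (at 1)"
    by (intro tendsto_intros) simp
  then show "((\<lambda>t :: real. (1 / t) ^ p * ((\<Sum>k<M. t ^ k) - (\<Sum>k<p. t ^ k))) \<longlongrightarrow> real M - real p) (at 1)"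
    by simp
qed

section \<open>The classical limit\<close>

context radial_frame
begin

lemma comb_eq_from_components: "comb f = from_components x y N f (\<lambda>I. f (insert 0 I))"
proof -
  have Pow: "Pow {..N} = Pow {1..N} \<union> insert 0 ` Pow {1..N}"
  proof (intro equalityI subsetI)
    fix J assume "J \<in> Pow {..N}"
    then have "J \<subseteq> {..N}" by simp
    then show "J \<in> Pow {1..N} \<union> insert 0 ` Pow {1..N}"
      by (cases rule: subset_cases) auto
  qed auto
  have "comb f = (\<Sum>J\<in>Pow {1..N}. E J * scal x y N (f J)) + (\<Sum>J\<in>insert 0 ` Pow {1..N}. E J * scal x y
      N (f J))"
    unfolding comb_def Pow by (rule sum.union_disjoint) auto
  also have "(\<Sum>J\<in>insert 0 ` Pow {1..N}. E J * scal x y N (f J)) =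
      (\<Sum>I\<in>Pow {1..N}. E (insert 0 I) * scal x y N (f (insert 0 I)))"
  proof (subst sum.reindex)
    show "inj_on (insert 0) (Pow {1..N})"
    proof (rule inj_onI)
      fix I K assume *: "I \<in> Pow {1..N}" "K \<in> Pow {1..N}" "insert 0 I = insert 0 K"
      then have "0 \<notin> I" "0 \<notin> K" by auto
      then show "I = K" using *(3) by (metis insert_ident)
    qed
  qed simp
  finally show ?thesis
    by (simp add: from_components_def sum.distrib yI_eq xyI_eq)
qed

lemma base_change_E: "base_change (E J) = E J"
  by (simp add: wedge_set_def base_change_wedge base_change_vgen o_def)

lemma base_change_scal:
  "base_change (scal x y N A) = scal x y N (Poly_Mapping.map of_real A)"
proof (induction A rule: poly_mapping_single_induct)
  case (single m c)
  then show ?case by (simp add: scal_single base_change_mult base_change_rconst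
      base_change_scal_monom map_single)
next
  case (add A B)
  then show ?case by (simp add: scal_add base_change_add map_of_real_add)
qed

lemma base_change_comb: "base_change (comb f) = comb (\<lambda>J. Poly_Mapping.map of_real (f J))"
  by (simp add: comb_def base_change_sum base_change_mult base_change_E base_change_scal)

lemma map_of_real_scalar_polys: "A \<in> scalar_polys N \<Longrightarrow> Poly_Mapping.map of_real A \<in> scalar_polys N"
  by (auto simp: scalar_polys_iff in_keys_iff map.rep_eq when_def)

lemma comb_const_mult: "comb (\<lambda>J. Poly_Mapping.single 0 c * f J) = rconst c * comb f"
  by (simp add: comb_def scal_mult scal_const rconst_left_commute sum_distrib_left)

text \<open>All dependence on q sits in c: base change commutes with the decomposition, and the
  coordinates of H have real coefficients. H can be any real element, without explicit
  components.\<close>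

lemma classical_limit_base_change:
  assumes "coeff_limit M c c'"
  shows "has_classical_limit M x y N (rconst c * base_change H) (rconst c' * H)"
proof -
  define f where "f J = Poly_Mapping.single 0 c * Poly_Mapping.map of_real (coords H J)" for J
  define f' where "f' J = Poly_Mapping.single 0 c' * coords H J" for J
  have "rconst c * base_change H = comb f" "rconst c' * H = comb f'"
    unfolding f_def f'_def comb_const_mult base_change_comb[symmetric] comb_coords by simp_all
  moreover have "f J \<in> scalar_polys N" "f' J \<in> scalar_polys N" for J
    unfolding f_def f'_def
    by (intro scalar_polys_mult scalar_polys_const map_of_real_scalar_polys coords_scalar_polys)+
  moreover have "(specialize M (Poly_Mapping.lookup (f J) m) \<longlongrightarrow> Poly_Mapping.lookup (f' J) m) (at 1)"
      for J m
  proof -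
    have "Poly_Mapping.lookup (f J) m = c * of_real (Poly_Mapping.lookup (coords H J) m)"
      by (simp add: f_def lookup_const_mult map.rep_eq when_def)
    moreover have "Poly_Mapping.lookup (f' J) m = c' * Poly_Mapping.lookup (coords H J) m"
      by (simp add: f'_def lookup_const_mult)
    ultimately show ?thesis
      using coeff_limit_mult[OF assms coeff_limit_of_real] by (simp add: coeff_limit_def)
  qed
  ultimately show ?thesis
    unfolding has_classical_limit_def comb_eq_from_components
    by (intro exI[of _ f] exI[of _ "\<lambda>I. f (insert 0 I)"] exI[of _ f'] exI[of _ "\<lambda>I. f' (insert 0
        I)"]) auto
qed

lemma from_components_add:
  "from_components x y N (\<lambda>I. A I + A' I) (\<lambda>I. B I + B' I) = from_components x y N A B +
      from_components x y N A' B'"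
  by (simp add: from_components_def scal_add distrib_left sum.distrib add_ac)

text \<open>Convergence is asked of some choice of components, so the chosen families can be
  added.\<close>

lemma classical_limit_add:
  assumes "has_classical_limit M x y N G L" "has_classical_limit M x y N G' L'"
  shows "has_classical_limit M x y N (G + G') (L + L')"
proof -
  obtain A B C D where 1: "range A \<subseteq> scalar_polys N" "range B \<subseteq> scalar_polys N"
    "range C \<subseteq> scalar_polys N" "range D \<subseteq> scalar_polys N"
    "G = from_components x y N A B" "L = from_components x y N C D"
    "\<And>I m. I \<in> Pow {1..N} \<Longrightarrow> coeff_limit M (Poly_Mapping.lookup (A I) m) (Poly_Mapping.lookup (C I) m)"
    "\<And>I m. I \<in> Pow {1..N} \<Longrightarrow> coeff_limit M (Poly_Mapping.lookup (B I) m) (Poly_Mapping.lookup (D I) m)"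
    using assms(1) unfolding has_classical_limit_def coeff_limit_def by blast
  obtain A' B' C' D' where 2: "range A' \<subseteq> scalar_polys N" "range B' \<subseteq> scalar_polys N"
    "range C' \<subseteq> scalar_polys N" "range D' \<subseteq> scalar_polys N"
    "G' = from_components x y N A' B'" "L' = from_components x y N C' D'"
    "\<And>I m. I \<in> Pow {1..N} \<Longrightarrow> coeff_limit M (Poly_Mapping.lookup (A' I) m) (Poly_Mapping.lookup (C' I) m)"
    "\<And>I m. I \<in> Pow {1..N} \<Longrightarrow> coeff_limit M (Poly_Mapping.lookup (B' I) m) (Poly_Mapping.lookup (D' I) m)"
    using assms(2) unfolding has_classical_limit_def coeff_limit_def by blast
  show ?thesis
    unfolding has_classical_limit_def
  proof (intro exI conjI ballI allI)
    show "range (\<lambda>I. A I + A' I) \<subseteq> scalar_polys N" "range (\<lambda>I. B I + B' I) \<subseteq> scalar_polys N"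
      "range (\<lambda>I. C I + C' I) \<subseteq> scalar_polys N" "range (\<lambda>I. D I + D' I) \<subseteq> scalar_polys N"
      using 1(1-4) 2(1-4) by (simp_all add: image_subset_iff scalar_polys_add)
    show "G + G' = from_components x y N (\<lambda>I. A I + A' I) (\<lambda>I. B I + B' I)"
      "L + L' = from_components x y N (\<lambda>I. C I + C' I) (\<lambda>I. D I + D' I)"
      by (simp_all add: from_components_add 1(5,6) 2(5,6))
    fix I m assume I: "I \<in> Pow {1..N}"
    show "(specialize M (Poly_Mapping.lookup (A I + A' I) m) \<longlongrightarrow> Poly_Mapping.lookup (C I +
        C' I) m) (at 1)"
      "(specialize M (Poly_Mapping.lookup (B I + B' I) m) \<longlongrightarrow> Poly_Mapping.lookup (D I + D' I) m) (at 1)"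
      using coeff_limit_add[OF 1(7)[OF I] 2(7)[OF I], of m m] coeff_limit_add[OF 1(8)[OF I]
          2(8)[OF I], of m m]
      by (simp_all add: coeff_limit_def lookup_add)
  qed
qed

lemma classical_limit_0: "has_classical_limit M x y N 0 0"
  using classical_limit_base_change[OF coeff_limit_0, of M 0] by (simp add: rconst_0)

lemma classical_limit_sum:
  "(\<And>i. i \<in> I \<Longrightarrow> has_classical_limit M x y N (f i) (g i)) \<Longrightarrow> has_classical_limit M x y N (sum f I)
      (sum g I)"
  by (induction I rule: infinite_finite_induct) (auto intro: classical_limit_0 classical_limit_add)

text \<open>On one monomial, each summand of the q-derivative is a coefficient times the base change
  of a real element; the classical derivative has the same elements with the limiting
  coefficients.\<close>

lemma classical_limit_scalar_derivative_single:
  assumes "coeff_limit M \<beta> \<beta>'"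
  shows "has_classical_limit M x y N
    (rconst \<beta> * base_change H * scalar_q_derivative x y N (Poly_Mapping.single m (of_real c)))
    (rconst \<beta>' * H * scalar_derivative x y N (Poly_Mapping.single m c))"
proof -
  let ?n = "Poly_Mapping.lookup m"
  let ?m = "\<lambda>u. m - Poly_Mapping.single u 1"
  \<comment> \<open>Up to c, \<open>a\<close> is 1 + q times the q^2-number of the exponent of r and
    tends to twice that exponent. In \<open>b\<close> the shift of r adds a power of q^2, which
    tends to 1.\<close>
  define a where "a = (1 + bq) * (q_number (bq ^ 2) (?n VR) * of_real c)"
  define b where "b i = of_real 2 * ((bq ^ 2) ^ ?n VR * (q_number bq (?n (VS i)) * of_real c))" for i
  define a' where "a' = 2 * (real (?n VR) * c)"
  define b' where "b' i = 2 * (1 * (real (?n (VS i)) * c))" for i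
  have lim: "coeff_limit M a a'" "coeff_limit M (b i) (b' i)" for i
  proof -
    have "coeff_limit M (bq ^ 2) (1 ^ 2)" by (intro coeff_limit_power coeff_limit_bq)
    then have sq: "coeff_limit M (bq ^ 2) 1" by simp
    have "coeff_limit M (1 + bq) (1 + 1)" by (intro coeff_limit_add coeff_limit_1 coeff_limit_bq)
    then have "coeff_limit M (1 + bq) 2" by simp
    then show "coeff_limit M a a'"
      unfolding a_def a'_def by (intro coeff_limit_mult coeff_limit_q_number sq coeff_limit_of_real)
    have "coeff_limit M ((bq ^ 2) ^ ?n VR) (1 ^ ?n VR)" by (intro coeff_limit_power sq)
    then have "coeff_limit M ((bq ^ 2) ^ ?n VR) 1" by simp
    then show "coeff_limit M (b i) (b' i)"
      unfolding b_def b'_def by (intro coeff_limit_mult coeff_limit_q_number coeff_limit_bq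
          coeff_limit_of_real)
  qed
  \<comment> \<open>These products are not basis elements; their real components stay
    implicit.\<close>
  define X where "X = H * (vgen x * scal_monom x y N (?m VR))"
  define Y where "Y i = H * (vgen (y i) * scal_monom x y N (?m (VS i)))" for i
  have rc: "F * (rconst k * G) = rconst k * (F * G)" for F G :: "('v, 'k::comm_ring_1) radial" and k
    by (rule rconst_left_commute)
  have two: "2 * G = rconst (of_real 2) * G" for G :: "('v, 'k::{comm_ring_1,real_algebra_1}) radial"
    by (simp add: rconst_numeral)
  have VS: "?n (VS i) = 0 \<Longrightarrow> b i = 0" for i by (simp add: b_def q_number_def)
  have "scalar_q_derivative x y N (Poly_Mapping.single m (of_real c)) =
      rconst a * (vgen x * scal_monom x y N (?m VR)) +
      (\<Sum>i = 1..N. rconst (b i) * (vgen (y i) * scal_monom x y N (?m (VS i))))"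
    unfolding scalar_q_derivative_def jackson_bq jackson_bq_square q_difference_single
        q_shift_single scal_single two
    by (simp add: a_def b_def rconst_mult mult.assoc lookup_minus lookup_single rc[of "vgen v"
        for v] sum_distrib_left)
  then have 1: "rconst \<beta> * base_change H * scalar_q_derivative x y N (Poly_Mapping.single m (of_real
      c)) =
      rconst (\<beta> * a) * base_change X + (\<Sum>i = 1..N. rconst (\<beta> * b i) * base_change (Y i))"
    by (simp add: X_def Y_def base_change_mult base_change_vgen base_change_scal_monom distrib_left
        sum_distrib_left
        mult.assoc rc[of "base_change H"] rconst_mult)
  have "scalar_derivative x y N (Poly_Mapping.single m c) =
      rconst a' * (vgen x * scal_monom x y N (?m VR)) +
      (\<Sum>i = 1..N. rconst (b' i) * (vgen (y i) * scal_monom x y N (?m (VS i))))"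
    unfolding scalar_derivative_def mpderiv_single scal_single two
    by (simp add: a'_def b'_def rconst_mult mult.assoc rc[of "vgen v" for v] sum_distrib_left)
  then have 2: "rconst \<beta>' * H * scalar_derivative x y N (Poly_Mapping.single m c) =
      rconst (\<beta>' * a') * X + (\<Sum>i = 1..N. rconst (\<beta>' * b' i) * Y i)"
    by (simp add: X_def Y_def distrib_left sum_distrib_left mult.assoc rc[of H] rconst_mult)
  show ?thesis
    unfolding 1 2 by (intro classical_limit_add classical_limit_sum classical_limit_base_change
        coeff_limit_mult assms lim)
qed

lemma classical_limit_twisted_term:
  assumes "A \<in> scalar_polys N"
  shows "has_classical_limit M x y N
    (twisted_term (scalar_q_derivative x y N) (\<lambda>p. bracket_m_plus (- int p)) (\<lambda>p. q_m_plus (- int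
        p)) J (Poly_Mapping.map of_real A))
    (twisted_term (scalar_derivative x y N) (\<lambda>p. real M - real p) (\<lambda>p. 1) J A)"
    (is "has_classical_limit M x y N (?Q (Poly_Mapping.map of_real A)) (?R A)")
  using assms
proof (induction rule: scalar_polys_single_induct)
  case zero
  have "?Q (Poly_Mapping.single 0 0 * 0) = rconst 0 * ?Q 0" "?R (Poly_Mapping.single 0 0 * 0) =
      rconst 0 * ?R 0"
    using poly_linear_twisted_term[OF poly_linear_scalar_q_derivative]
      poly_linear_twisted_term[OF poly_linear_scalar_derivative] unfolding poly_linear_def by blast+
  moreover have "Poly_Mapping.map of_real (0 :: (svar, real) mpoly) = (0 :: (svar, bcoeff) mpoly)"
    by (simp add: map_eq_zero_iff)
  ultimately show ?case using classical_limit_0 by (simp add: rconst_0)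
next
  case (add A B)
  have "?Q (P + P') = ?Q P + ?Q P'" "?R (F + F') = ?R F + ?R F'" for P P' F F'
    using poly_linear_twisted_term[OF poly_linear_scalar_q_derivative]
      poly_linear_twisted_term[OF poly_linear_scalar_derivative] unfolding poly_linear_def by blast+
  then show ?case using classical_limit_add[OF add] by (simp add: map_of_real_add)
next
  case (single m c)
  have map: "Poly_Mapping.map of_real (Poly_Mapping.single m c) = Poly_Mapping.single m (of_real c
      :: bcoeff)"
    by (simp add: map_single)
  show ?case
  proof (cases "0 \<in> J")
    case False
    then show ?thesis
      using classical_limit_scalar_derivative_single[OF coeff_limit_1, of M "E J" m c]
      by (simp add: twisted_term_def map base_change_E rconst_1)
  next
    case True
    define I where "I = J - {0}"
    define H :: "('v, real) radial" where "H = E I * scal_monom x y N m"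
    have "coeff_limit M ((- 1) ^ card I * (bracket_m_plus (- int (card I)) * of_real c))
        ((- 1) ^ card I * ((real M - real (card I)) * c))"
      using coeff_limit_of_real[of M "- 1"]
      by (intro coeff_limit_mult coeff_limit_power coeff_limit_bracket coeff_limit_of_real) simp
    note 1 = classical_limit_base_change[OF this, of H]
    have "rconst ((- 1) ^ n) = (- 1 :: ('v, 'k::comm_ring_1) radial) ^ n" for n
      by (simp add: minus_one_power_iff rconst_1 rconst_uminus)
    note neg = this
    have 2: "rconst ((- 1) ^ card I * (bracket_m_plus (- int (card I)) * of_real c)) * base_change H =
        (- 1) ^ card I * rconst (bracket_m_plus (- int (card I))) * E I * scal x y N
            (Poly_Mapping.single m (of_real c))"
      by (simp add: H_def base_change_mult base_change_E base_change_scal_monom scal_single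
          rconst_mult mult.assoc
          rconst_left_commute[of "E I"] neg)
    have 3: "rconst ((- 1) ^ card I * ((real M - real (card I)) * c)) * H =
        (- 1) ^ card I * rconst (real M - real (card I)) * E I * scal x y N (Poly_Mapping.single m c)"
      by (simp add: H_def scal_single rconst_mult mult.assoc rconst_left_commute[of "E I"] neg)
    show ?thesis
      using classical_limit_add[OF 1 classical_limit_scalar_derivative_single[OF
          coeff_limit_q_m_plus[of M "card I"], of "E J" m c]] True
      unfolding 2 3 by (simp add: twisted_term_def map base_change_E rconst_1 I_def)
  qed
qed

lemma classical_limit_radial_derivative:
  "has_classical_limit M x y N (relative_q_derivative x y N (base_change F)) (radial_derivative M F)"
proof -
  let ?Q = "twisted_term (scalar_q_derivative x y N) (\<lambda>p. bracket_m_plus (- int p)) (\<lambda>p. q_m_plus (-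
      int p))"
  have lin: "poly_linear (?Q J)" for J
    by (rule poly_linear_twisted_term[OF poly_linear_scalar_q_derivative])
  have "(base_change F :: ('v, bcoeff) radial) = comb (\<lambda>J. Poly_Mapping.map of_real (coords F J))"
    using base_change_comb[of "coords F"] by (simp add: comb_coords)
  then have "relative_q_derivative x y N (base_change F) =
      (\<Sum>J\<in>Pow {..N}. extend ?Q (E J * scal x y N (Poly_Mapping.map of_real (coords F J))))"
    unfolding relative_q_derivative_eq comb_def
        by (simp only: radial_linear_sum[OF extend_linear[OF lin]])
  also have "\<dots> = (\<Sum>J\<in>Pow {..N}. ?Q J (Poly_Mapping.map of_real (coords F J)))"
    by (intro sum.cong refl extend_basis[OF lin] map_of_real_scalar_polys coords_scalar_polys) auto
  finally show ?thesis
    unfolding radial_derivative_def extend_def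
    by (simp only:) (intro classical_limit_sum classical_limit_twisted_term coords_scalar_polys)
qed

end

section \<open>Clifford realizations\<close>

lemma cconst_0: "cconst 0 = 0"
  by transfer (simp add: ideal_cong_refl)

lemma cconst_1: "cconst 1 = 1"
  by transfer (simp add: ideal_cong_refl)

lemma cconst_add: "cconst (a + b) = cconst a + cconst b"
  by transfer (simp add: ideal_cong_refl single_add)

lemma cconst_mult: "cconst (a * b) = cconst a * cconst b"
  by transfer (simp add: ideal_cong_refl mult_single)

lemma cconst_of_nat: "cconst (of_nat n) = of_nat n"
  by (induction n) (simp_all add: cconst_0 cconst_1 cconst_add)

lemma cconst_central: "cconst c * a = a * cconst c"
  by transfer (simp add: mword_const_central ideal_cong_refl)

lemma acomm_cgen: "acomm (cgen i) (cgen j) = (if i = j then - 2 else 0)"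
proof -
  have "cgen i * cgen j + cgen j * cgen i + (if i = j then 2 else 0) = 0"
  proof (cases "i = j")
    case True
    have "cgen i * cgen i + cgen i * cgen i + (1 + 1) = 0"
    proof transfer
      fix i :: 'a
      let ?r = "letter i * letter i + letter i * letter i + (1 + 1) :: 'a mword \<Rightarrow>\<^sub>0 real"
      have "?r \<in> clifford_relations" by (force simp: clifford_relations_def)
      then have "1 * ?r * 1 \<in> two_sided_ideal clifford_relations" by (rule two_sided_ideal.gen)
      then show "ideal_cong clifford_relations ?r 0" by (simp add: ideal_cong_def)
    qed
    then show ?thesis using True by simp
  next
    case False
    then have "cgen i * cgen j + cgen j * cgen i = 0"
    proof transfer
      fix i j :: 'a assume "i \<noteq> j"
      let ?r = "letter i * letter j + letter j * letter i :: 'a mword \<Rightarrow>\<^sub>0 real"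
      have "?r \<in> clifford_relations" using \<open>i \<noteq> j\<close> by (force simp: clifford_relations_def)
      then have "1 * ?r * 1 \<in> two_sided_ideal clifford_relations" by (rule two_sided_ideal.gen)
      then show "ideal_cong clifford_relations ?r 0" by (simp add: ideal_cong_def)
    qed
    then show ?thesis using False by simp
  qed
  then show ?thesis by (auto simp: acomm_def add_eq_0_iff2 split: if_splits)
qed

section \<open>Vectors in Clifford-valued polynomials\<close>

definition cpoly :: "('m + 'w, real) mpoly \<Rightarrow> ('m::finite, 'w) clifford_poly"
  where "cpoly p = Poly_Mapping.map cconst p"

lemma lookup_cpoly: "Poly_Mapping.lookup (cpoly p) m = cconst (Poly_Mapping.lookup p m)"
  by (simp add: cpoly_def map.rep_eq when_def cconst_0)

lemma cpoly_single: "cpoly (Poly_Mapping.single m c) = Poly_Mapping.single m (cconst c)"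
  by (rule poly_mapping_eqI) (simp add: lookup_cpoly lookup_single when_def cconst_0)

lemma cpoly_add: "cpoly (p + q) = cpoly p + cpoly q"
  by (rule poly_mapping_eqI) (simp add: lookup_cpoly lookup_add cconst_add)

lemma cpoly_central: "central (cpoly p)"
proof (rule centralI)
  fix F
  show "cpoly p * F = F * cpoly p"
  proof (induction p rule: poly_mapping_single_induct)
    case (single m c)
    show ?case
      by (induction F rule: poly_mapping_single_induct)
        (simp_all add: cpoly_single mult_single cconst_central add.commute distrib_left distrib_right)
  next
    case (add p q)
    then show ?case by (simp add: cpoly_add distrib_left distrib_right)
  qed
qed

lemma central_add: "central z \<Longrightarrow> central w \<Longrightarrow> central (z + w)"
  by (simp add: central_def distrib_left distrib_right)

lemma central_sum: "(\<And>i. i \<in> I \<Longrightarrow> central (f i)) \<Longrightarrow> central (sum f I)"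
  by (induction I rule: infinite_finite_induct) (simp_all add: central_add, simp_all add: central_def)

definition evec :: "'m::finite \<Rightarrow> ('m, 'w) clifford_poly"
  where "evec j = Poly_Mapping.single 0 (cgen j)"

lemma acomm_evec: "acomm (evec i) (evec j) = (if i = j then - 2 else 0)"
proof -
  have "acomm (evec i) (evec j) = Poly_Mapping.single 0 (acomm (cgen i) (cgen j))"
    by (simp add: acomm_def evec_def mult_single single_add)
  also have "\<dots> = (if i = j then - 2 else 0)"
    by (simp add: acomm_cgen single_uminus)
  finally show ?thesis .
qed

definition cvec :: "('m \<Rightarrow> ('m + 'w, real) mpoly) \<Rightarrow> ('m::finite, 'w) clifford_poly"
  where "cvec p = (\<Sum>j\<in>UNIV. cpoly (p j) * evec j)"

lemma acomm_sum_left: "acomm (sum f I) b = (\<Sum>i\<in>I. acomm (f i) b)"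
  by (simp add: acomm_def sum_distrib_left sum_distrib_right sum.distrib)

lemma acomm_central_left: "central z \<Longrightarrow> acomm (z * a) b = z * acomm a b"
  using central_left_commute[of z b a] by (simp add: acomm_def distrib_left mult.assoc)

lemma acomm_cvec_evec: "acomm (cvec p) (evec k) = cpoly (p k) * (- 2)"
proof -
  have "acomm (cvec p) (evec k) = (\<Sum>j\<in>UNIV. if j = k then cpoly (p k) * (- 2) else 0)"
    unfolding cvec_def acomm_sum_left
    by (intro sum.cong refl) (auto simp: acomm_central_left[OF cpoly_central] acomm_evec)
  then show ?thesis by simp
qed

lemma central_minus_two: "central (- 2 :: 'a::ring_1)"
  by (simp add: central_def mult_2 mult_2_right)

lemma acomm_cvec_evec_central: "central (acomm (cvec p) (evec k))"
  unfolding acomm_cvec_evec by (intro central_mult cpoly_central central_minus_two)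

text \<open>Contraction with the frame e_k gives the vector back up to the -2 of the Clifford
  relations. This is the source of the factors 2 in the derivatives of r and s_i.\<close>

lemma sum_acomm_cvec_evec: "(\<Sum>k\<in>UNIV. acomm (cvec p) (evec k) * evec k) = - 2 * cvec p"
  unfolding acomm_cvec_evec unfolding cvec_def sum_distrib_left
  by (intro sum.cong refl) (simp only: mult.assoc central_left_commute[OF central_minus_two])

lemma acomm_cvec_central: "central (acomm (cvec p) (cvec q))"
proof -
  have "acomm (cvec p) (cvec q) = (\<Sum>k\<in>UNIV. cpoly (q k) * acomm (cvec p) (evec k))"
    unfolding acomm_commute[of "cvec p"] cvec_def[of q] acomm_sum_left
    by (intro sum.cong refl acomm_central_left cpoly_central)
  then show ?thesis
    by (simp only:) (intro central_sum central_mult cpoly_central acomm_cvec_evec_central)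
qed

lemma clifford_poly_of_nat_cancel:
  fixes a b :: "('m::finite, 'w) clifford_poly"
  assumes "0 < n" "of_nat n * a = of_nat n * b"
  shows "a = b"
proof -
  have "1 / real n * real n = 1" using assms(1) by simp
  then have "cconst (1 / real n) * of_nat n = (1 :: 'm clifford)"
    by (metis cconst_1 cconst_mult cconst_of_nat)
  then have "Poly_Mapping.single 0 (cconst (1 / real n)) * Poly_Mapping.single 0 (of_nat n) =
      (1 :: ('m, 'w) clifford_poly)"
    by (simp only: mult_single add_0 single_one)
  then have "Poly_Mapping.single 0 (cconst (1 / real n)) * of_nat n = (1 :: ('m, 'w) clifford_poly)"
    by (simp only: single_of_nat)
  note inverse = this
  have "Poly_Mapping.single 0 (cconst (1 / real n)) * of_nat n * a =
      Poly_Mapping.single 0 (cconst (1 / real n)) * of_nat n * b"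
    by (simp only: mult.assoc assms(2))
  then show ?thesis by (simp only: inverse mult_1)
qed

lemma evec_square: "evec k * evec k = - (1 :: ('m::finite, 'w) clifford_poly)"
proof -
  have "evec k * evec k + evec k * evec k = - (2 :: ('m, 'w) clifford_poly)"
    using acomm_evec[of k k] by (simp add: acomm_def)
  then have "of_nat 2 * (evec k * evec k) = of_nat 2 * (- (1 :: ('m, 'w) clifford_poly))"
    by (simp add: mult_2)
  then show ?thesis by (rule clifford_poly_of_nat_cancel[rotated]) simp
qed

lemma mpderiv_0: "mpderiv u 0 = 0"
  by (simp add: mpderiv_def)

lemma mpderiv_const: "mpderiv u (Poly_Mapping.single 0 c) = 0"
  by (simp add: mpderiv_single)

lemma mpderiv_uminus: "mpderiv u (- f) = - mpderiv u f"
  using mpderiv_add[of u f "- f"] by (simp add: mpderiv_0 eq_neg_iff_add_eq_0 add.commute)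

lemma mpderiv_diff: "mpderiv u (f - g) = mpderiv u f - mpderiv u g"
  using mpderiv_add[of u f "- g"] by (simp add: mpderiv_uminus)

lemma mpderiv_sum: "mpderiv u (sum f I) = (\<Sum>i\<in>I. mpderiv u (f i))"
  by (induction I rule: infinite_finite_induct) (simp_all add: mpderiv_0 mpderiv_add)

lemma mpderiv_of_nat_mult: "mpderiv u (of_nat n * f) = of_nat n * mpderiv u f"
  using mpderiv_const_mult[of u "of_nat n" f] by simp

lemma mpderiv_two_mult: "mpderiv u (2 * f) = 2 * mpderiv u f"
  using mpderiv_of_nat_mult[of u 2 f] by simp

lemma mpderiv_sg_mult: "mpderiv u (sg J j * f) = sg J j * mpderiv u f"
proof -
  consider "sg J j = (1 :: ('a, 'b) mpoly)" | "sg J j = (- 1 :: ('a, 'b) mpoly)"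
    using sg_cases by blast
  then show ?thesis by cases (simp_all add: mpderiv_uminus)
qed

lemma mpderiv_mvar: "mpderiv u (mvar v) = (if u = v then 1 else 0)"
  by (auto simp: mvar_def mpderiv_single lookup_single)

lemma mpderiv_acomm: "mpderiv u (acomm f g) = acomm (mpderiv u f) g + acomm f (mpderiv u g)"
  by (simp add: acomm_def mpderiv_add mpderiv_mult add_ac)

section \<open>The right Clifford derivative\<close>

abbreviation (input) crd :: "('m::finite, 'w) clifford_poly \<Rightarrow> ('m, 'w) clifford_poly"
  where "crd \<equiv> clifford_right_derivative"

lemma crd_eq: "crd F = - (\<Sum>j\<in>UNIV. mpderiv (Inl j) F * evec j)"
  by (simp add: clifford_right_derivative_def evec_def)

lemma crd_add: "crd (F + G) = crd F + crd G"
  by (simp add: crd_eq mpderiv_add distrib_right sum.distrib)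

lemma crd_0: "crd 0 = 0"
  by (simp add: crd_eq mpderiv_0)

lemma crd_sum: "crd (sum f I) = (\<Sum>i\<in>I. crd (f i))"
  by (induction I rule: infinite_finite_induct) (simp_all add: crd_0 crd_add)

text \<open>The e_j stand on the right, so a right factor has to let them pass; a central one
  does.\<close>

lemma crd_mult_central:
  assumes "central Z"
  shows "crd (F * Z) = crd F * Z + F * crd Z"
proof -
  have "a * Z * evec j = a * evec j * Z" for a j
    by (simp add: mult.assoc centralD[OF assms])
  then show ?thesis
    by (simp add: crd_eq mpderiv_mult distrib_right sum.distrib sum_distrib_left sum_distrib_right
        mult.assoc)
qed

section \<open>Images of generators and wedges under a realization\<close>

locale clifford_frame = radial_frame x y N
  for x :: 'v and y :: "nat \<Rightarrow> 'v" and N :: nat +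
  fixes \<phi> :: "('v, real) radial \<Rightarrow> ('m::finite, 'w) clifford_poly"
  assumes realization: "clifford_realization x y N \<phi>"
begin

lemma phi_1: "\<phi> 1 = 1"
  and phi_add: "\<phi> (F + G) = \<phi> F + \<phi> G"
  and phi_mult: "\<phi> (F * G) = \<phi> F * \<phi> G"
  and phi_rconst_mult: "\<phi> (rconst c * F) = Poly_Mapping.single 0 (cconst c) * \<phi> F"
  using realization unfolding clifford_realization_def by blast+

lemma phi_rconst: "\<phi> (rconst c) = Poly_Mapping.single 0 (cconst c)"
  using phi_rconst_mult[of c 1] by (simp add: phi_1)

lemma phi_0: "\<phi> 0 = 0"
  using phi_rconst[of 0] by (simp add: rconst_0 cconst_0)

lemma phi_uminus: "\<phi> (- F) = - \<phi> F"
  using phi_add[of F "- F"] by (simp add: phi_0 eq_neg_iff_add_eq_0 add.commute)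

lemma phi_sum: "\<phi> (sum f I) = (\<Sum>i\<in>I. \<phi> (f i))"
  by (induction I rule: infinite_finite_induct) (simp_all add: phi_0 phi_add)

lemma phi_of_nat: "\<phi> (of_nat n) = of_nat n"
  by (induction n) (simp_all add: phi_0 phi_1 phi_add)

lemma phi_sg: "\<phi> (sg J j) = sg J j"
  by (simp add: sg_def minus_one_power_iff phi_1 phi_uminus)

lemma phi_acomm: "\<phi> (acomm F G) = acomm (\<phi> F) (\<phi> G)"
  by (simp add: acomm_def phi_add phi_mult)

abbreviation g :: "nat \<Rightarrow> ('m, 'w) clifford_poly"
  where "g i \<equiv> \<phi> (vgen (gv i))"

lemma g_0: "g 0 = cvec (\<lambda>j. mvar (Inl j))"
  using realization unfolding clifford_realization_def
  by (simp add: frame_def cvec_def evec_def cpoly_single mvar_def cconst_1)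

lemma g_y:
  assumes "1 \<le> i" "i \<le> N"
  obtains p where "g i = cvec p" "\<And>u j. mpderiv (Inl u) (cpoly (p j)) = 0"
proof -
  obtain yc :: "nat \<Rightarrow> 'm \<Rightarrow> ('m + 'w, real) mpoly" where
    yc: "\<forall>i\<in>{1..N}. \<forall>j. \<forall>m\<in>Poly_Mapping.keys (yc i j). \<forall>k. Poly_Mapping.lookup m (Inl k) = 0"
    "\<forall>i\<in>{1..N}. \<phi> (vgen (y i)) = (\<Sum>j\<in>UNIV. Poly_Mapping.map cconst (yc i j) * Poly_Mapping.single 0
        (cgen j))"
    using realization unfolding clifford_realization_def by blast
  have "mpderiv (Inl u) (cpoly (yc i j)) = 0" for u j
  proof -
    have keys: "m \<in> Poly_Mapping.keys (yc i j)" if "m \<in> Poly_Mapping.keys (cpoly (yc i j))" for m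
      using that by (auto simp: in_keys_iff lookup_cpoly cconst_0)
    have "Poly_Mapping.lookup m (Inl u) = 0" if "m \<in> Poly_Mapping.keys (cpoly (yc i j))" for m
      using yc(1)[rule_format, OF _ keys[OF that]] assms by simp
    then show ?thesis
      unfolding mpderiv_def by (intro sum.neutral) simp
  qed
  moreover have "g i = cvec (yc i)"
    using yc(2) assms by (simp add: frame_def cvec_def evec_def cpoly_def)
  ultimately show ?thesis using that by blast
qed

text \<open>The wedge locale ranges over all natural indices. Beyond N, \<open>gv i\<close> is still
  one of the generators, hence equal to some \<open>gv k\<close> with k \<le> N.\<close>

lemma g_cvec: obtains p where "g i = cvec p"
proof -
  have "\<exists>k\<le>N. gv i = gv k"
    using idx_le gv_idx by metis
  then obtain k where k: "k \<le> N" "g i = g k" by metis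
  show ?thesis
  proof (cases "k = 0")
    case True
    then show ?thesis using that k g_0 by metis
  next
    case False
    then show ?thesis using that g_y[of k] k by (metis less_one not_le)
  qed
qed

lemma acomm_g_central: "central (acomm (g i) (g j))"
proof -
  obtain p q where "g i = cvec p" "g j = cvec q" using g_cvec by metis
  then show ?thesis by (simp only: acomm_cvec_central)
qed

lemma acomm_g_evec_central: "central (acomm (g i) (evec k))"
proof -
  obtain p where "g i = cvec p" by (rule g_cvec)
  then show ?thesis by (simp only: acomm_cvec_evec_central)
qed

lemma sum_acomm_g_evec: "(\<Sum>k\<in>UNIV. acomm (g i) (evec k) * evec k) = - 2 * g i"
proof -
  obtain p where "g i = cvec p" by (rule g_cvec)
  then show ?thesis by (simp only: sum_acomm_cvec_evec)
qed

lemma mpderiv_evec: "mpderiv u (evec j) = 0"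
  by (simp add: evec_def mpderiv_const)

lemma mpderiv_g_0: "mpderiv (Inl k) (g 0) = evec k"
proof -
  have "mpderiv (Inl k) (cpoly (mvar (Inl j) :: ('m + 'w, real) mpoly)) = (if j = k then 1 else 0)"
      for j
    using mpderiv_mvar[of "Inl k :: 'm + 'w" "Inl j"]
    by (auto simp: mvar_def cpoly_single cconst_1 mpderiv_single lookup_single)
  then have "mpderiv (Inl k) (g 0) = (\<Sum>j\<in>UNIV. if j = k then evec k else 0)"
    unfolding g_0 cvec_def mpderiv_sum mpderiv_mult mpderiv_evec by (intro sum.cong) auto
  then show ?thesis by simp
qed

lemma mpderiv_g_y: "1 \<le> i \<Longrightarrow> i \<le> N \<Longrightarrow> mpderiv (Inl k) (g i) = 0"
  using g_y[of i] by (metis (no_types, lifting) cvec_def add_0 mpderiv_evec mpderiv_mult mpderiv_sum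
      mult_zero_left mult_zero_right sum.neutral)

text \<open>The recursion is carried over by \<phi>, whether or not the wedges stay independent.
  Centrality of the anticommutators is established in the target, as the image of \<phi> need not be
  all of it.\<close>

lemma clifford_wedge_system: "wedge_system g (\<lambda>J. \<phi> (E J))"
proof
  show "\<phi> (E {}) = 1" by (simp add: wedge_set_empty phi_1)
  fix J :: "nat set" assume "finite J"
  from arg_cong[OF wedge_set_laplace[OF this, of "\<lambda>i. vgen (gv i)"], of \<phi>]
  show "of_nat (card J) * \<phi> (E J) = (\<Sum>j\<in>J. sg J j * (g j * \<phi> (E (J - {j}))))"
    by (simp add: phi_mult phi_of_nat phi_sum phi_sg)
next
  fix n :: nat and a b :: "('m, 'w) clifford_poly"
  assume "0 < n" "of_nat n * a = of_nat n * b"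
  then show "a = b" by (rule clifford_poly_of_nat_cancel)
next
  fix i j
  show "central (acomm (g i) (g j))" by (rule acomm_g_central)
qed

text \<open>The recursion involves only the y_i, which do not depend on the x_j; the factor
  \<open>card I\<close> is cancelled at the end.\<close>

lemma mpderiv_E:
  assumes "I \<subseteq> {1..N}"
  shows "mpderiv (Inl k) (\<phi> (E I)) = 0"
proof -
  have "finite I" using assms by (rule finite_subset) simp
  then show ?thesis using assms
  proof (induction I rule: finite_psubset_induct)
    case (psubset I)
    show ?case
    proof (cases "I = {}")
      case True
      then show ?thesis using mpderiv_const[of "Inl k" 1] by (simp add: wedge_set_empty phi_1)
    next
      case False
      have "of_nat (card I) * mpderiv (Inl k) (\<phi> (E I)) =
          (\<Sum>j\<in>I. sg I j * mpderiv (Inl k) (g j * \<phi> (E (I - {j}))))"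
        by (simp only: mpderiv_of_nat_mult[symmetric]
            wedge_system.E_laplace[OF clifford_wedge_system psubset(1)]
            mpderiv_sum mpderiv_sg_mult)
      also have "\<dots> = 0"
      proof (rule sum.neutral, rule ballI)
        fix j assume j: "j \<in> I"
        then have I: "I - {j} \<subset> I" "I - {j} \<subseteq> {1..N}" "1 \<le> j" "j \<le> N"
          using psubset.prems by auto
        have "mpderiv (Inl k) (\<phi> (E (I - {j}))) = 0" by (rule psubset.IH[OF I(1,2)])
        moreover have "mpderiv (Inl k) (g j) = 0" by (rule mpderiv_g_y[OF I(3,4)])
        ultimately show "sg I j * mpderiv (Inl k) (g j * \<phi> (E (I - {j}))) = 0"
          by (simp add: mpderiv_mult)
      qed
      finally have "of_nat (card I) * mpderiv (Inl k) (\<phi> (E I)) = of_nat (card I) * 0" by simp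
      moreover have "0 < card I" using False psubset(1) by (simp add: card_gt_0_iff)
      ultimately show ?thesis by (rule clifford_poly_of_nat_cancel[rotated])
    qed
  qed
qed

lemma crd_E: "I \<subseteq> {1..N} \<Longrightarrow> crd (\<phi> (E I)) = 0"
  by (simp add: crd_eq mpderiv_E)

text \<open>Twice the wedge is 2 x y_I minus a sum with anticommutators {y_j, x}; differentiating in
  x_k replaces x by e_k. With p = card I, the sum of all e_k y_I e_k is -(-1)^p (M - 2 p) y_I, and
  half the contraction term corrects M - 2 p to M - p.\<close>

lemma crd_E_insert_0:
  assumes I: "I \<subseteq> {1..N}"
  shows "crd (\<phi> (E (insert 0 I))) =
    (- 1) ^ card I * ((of_nat CARD('m) - of_nat (card I)) * \<phi> (E I))"
proof -
  note W = clifford_wedge_system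
  define Y where "Y = \<phi> (E I)"
  define Z where "Z j = \<phi> (E (I - {j}))" for j
  define X where "X = (\<Sum>j\<in>I. sg I j * (Z j * g j))"
  define e :: "'m \<Rightarrow> ('m, 'w) clifford_poly" where "e = evec"
  have fin: "finite I" "0 \<notin> I" using I finite_subset by auto
  \<comment> \<open>Contraction replaces {y_j, e_k} e_k by -2 y_j on the right, so \<open>X\<close>
    is a Laplace sum along the last factor.\<close>
  have contract: "(\<Sum>k\<in>UNIV. (\<Sum>j\<in>I. sg I j * (acomm (g j) (e k) * Z j)) * e k) = - 2 * X"
  proof -
    have "acomm (g j) (e k) * Z j * e k = Z j * (acomm (g j) (e k) * e k)" for j k
      unfolding e_def by (simp only: mult.assoc central_left_commute[OF acomm_g_evec_central])
    then have "(\<Sum>k\<in>UNIV. (\<Sum>j\<in>I. sg I j * (acomm (g j) (e k) * Z j)) * e k) =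
        (\<Sum>k\<in>UNIV. \<Sum>j\<in>I. sg I j * (Z j * (acomm (g j) (e k) * e k)))"
      by (simp add: sum_distrib_right mult.assoc)
    also have "\<dots> = (\<Sum>j\<in>I. sg I j * (Z j * (\<Sum>k\<in>UNIV. acomm (g j) (e k) * e k)))"
      by (subst sum.swap) (simp add: sum_distrib_left)
    also have "\<dots> = (\<Sum>j\<in>I. - 2 * (sg I j * (Z j * g j)))"
    proof (intro sum.cong refl)
      fix j
      have "sg I j * (Z j * (- 2 * g j)) = - 2 * (sg I j * (Z j * g j))"
        by (simp only: central_left_commute[OF central_minus_two])
      then show "sg I j * (Z j * (\<Sum>k\<in>UNIV. acomm (g j) (e k) * e k)) = - 2 * (sg I j * (Z j * g j))"
        unfolding e_def by (simp only: sum_acomm_g_evec)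
    qed
    finally show ?thesis by (simp only: X_def sum_distrib_left)
  qed
  have "(\<Sum>k\<in>UNIV. e k * Y * e k) =
      (\<Sum>k\<in>UNIV. (- 1) ^ card I * (Y * (e k * e k)) + (\<Sum>j\<in>I. sg I j * (acomm (g j) (e k) * Z j)) * e k)"
  proof (intro sum.cong refl)
    fix k
    have "e k * Y = (- 1) ^ card I * (Y * e k) + (\<Sum>j\<in>I. sg I j * (acomm (g j) (e k) * Z j))"
      unfolding Y_def Z_def e_def
      by (rule wedge_system.vector_wedge_commute[OF W fin(1)]) (rule acomm_g_evec_central)
    then show "e k * Y * e k = (- 1) ^ card I * (Y * (e k * e k)) + (\<Sum>j\<in>I. sg I j * (acomm (g j) (e
        k) * Z j)) * e k"
      by (simp add: distrib_right mult.assoc)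
  qed
  also have "\<dots> = - ((- 1) ^ card I * (of_nat CARD('m) * Y)) + - 2 * X"
    unfolding sum.distrib contract
    by (simp add: e_def evec_square wedge_system.mult_of_nat_left[OF W, of "(- 1) ^ card I"])
  finally have sandwich: "(\<Sum>k\<in>UNIV. e k * Y * e k) = - ((- 1) ^ card I * (of_nat CARD('m) * Y)) +
      - 2 * X" .
  have "2 * mpderiv (Inl k) (\<phi> (E (insert 0 I))) =
      2 * (e k * Y) - (\<Sum>j\<in>I. sg I j * (acomm (g j) (e k) * Z j))" for k
  proof -
    have "2 * mpderiv (Inl k) (\<phi> (E (insert 0 I))) = mpderiv (Inl k) (2 * \<phi> (E (insert 0 I)))"
      by (simp only: mpderiv_two_mult)
    also have "\<dots> = mpderiv (Inl k) (2 * (g 0 * Y) - (\<Sum>j\<in>I. sg I j * (acomm (g j) (g 0) * Z j)))"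
      unfolding wedge_system.wedge_insert_zero[OF W fin] Y_def Z_def ..
    also have "\<dots> = 2 * (e k * Y) - (\<Sum>j\<in>I. sg I j * (acomm (g j) (e k) * Z j))"
    proof -
      have "mpderiv (Inl k) Y = 0" "mpderiv (Inl k) (Z j) = 0" for j
        unfolding Y_def Z_def by (rule mpderiv_E; use I in blast)+
      moreover have "mpderiv (Inl k) (acomm (g j) (g 0)) = acomm (g j) (e k)" if "j \<in> I" for j
      proof -
        have "mpderiv (Inl k) (g j) = 0" using I that by (intro mpderiv_g_y) auto
        then show ?thesis unfolding mpderiv_acomm mpderiv_g_0 e_def by (simp add: acomm_def)
      qed
      ultimately have "mpderiv (Inl k) (g 0 * Y) = e k * Y"
        "\<And>j. j \<in> I \<Longrightarrow> mpderiv (Inl k) (acomm (g j) (g 0) * Z j) = acomm (g j) (e k) * Z j"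
        by (simp_all add: mpderiv_mult mpderiv_g_0 e_def)
      then show ?thesis
        unfolding mpderiv_diff mpderiv_two_mult mpderiv_sum mpderiv_sg_mult by simp
    qed
    finally show ?thesis .
  qed
  then have "2 * (mpderiv (Inl k) (\<phi> (E (insert 0 I))) * e k) =
      2 * (e k * Y * e k) - (\<Sum>j\<in>I. sg I j * (acomm (g j) (e k) * Z j)) * e k" for k
    by (simp add: left_diff_distrib flip: mult.assoc)
  then have "2 * (\<Sum>k\<in>UNIV. mpderiv (Inl k) (\<phi> (E (insert 0 I))) * e k) =
      2 * (\<Sum>k\<in>UNIV. e k * Y * e k) - (\<Sum>k\<in>UNIV. (\<Sum>j\<in>I. sg I j * (acomm (g j) (e k) * Z j)) * e k)"
    by (simp only: sum_distrib_left sum_subtractf)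
  also have "\<dots> = 2 * (- ((- 1) ^ card I * (of_nat CARD('m) * Y)) - X)"
    unfolding contract sandwich by (simp add: algebra_simps) (simp flip: distrib_right)
  finally have "of_nat 2 * (- crd (\<phi> (E (insert 0 I)))) = of_nat 2 * (- ((- 1) ^ card I * (of_nat
      CARD('m) * Y)) - X)"
    by (simp only: crd_eq e_def of_nat_numeral minus_minus)
  then have "- crd (\<phi> (E (insert 0 I))) = - ((- 1) ^ card I * (of_nat CARD('m) * Y)) - X"
    by (rule clifford_poly_of_nat_cancel[rotated]) simp
  then have crd: "crd (\<phi> (E (insert 0 I))) = (- 1) ^ card I * (of_nat CARD('m) * Y) + X"
    using eq_add_if_diff_eq[of 0 _ _ X X] by simp
  \<comment> \<open>By \<open>laplace_last\<close>, whose sign (-1)^(p - 1) accounts for the minus;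
    for empty I both sides are 0.\<close>
  have "X = - ((- 1) ^ card I * (of_nat (card I) * Y))"
  proof (cases "I = {}")
    case True
    then show ?thesis by (simp add: X_def)
  next
    case False
    then obtain p where "card I = Suc p"
      using fin(1) by (metis card_eq_0_iff not0_implies_Suc)
    then show ?thesis
      using wedge_system.laplace_last[OF W fin(1) False] by (simp add: X_def Y_def Z_def)
  qed
  then show ?thesis
    unfolding crd Y_def by (simp add: left_diff_distrib right_diff_distrib)
qed

section \<open>Derivatives of the images of scalars\<close>

lemma scalar_derivative_mult:
  "scalar_derivative x y N (A * B) = scalar_derivative x y N A * scal x y N B +
      scalar_derivative x y N B * scal x y N A"
proof -
  have "v * scal x y N (mpderiv u (A * B)) =
      v * scal x y N (mpderiv u A) * scal x y N B + v * scal x y N (mpderiv u B) * scal x y N A" for u v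
    by (simp add: mpderiv_mult scal_add scal_mult distrib_left mult.assoc centralD[OF scal_central,
        of x y N A])
  then show ?thesis
    unfolding scalar_derivative_def
    by (simp add: distrib_right distrib_left sum.distrib sum_distrib_right mult.assoc add_ac)
qed

text \<open>Centrality in the radial algebra gives commutation only with the image of \<phi>. Here
  it must hold against all Clifford polynomials, in particular the e_j, and it rests on the central
  anticommutators of vectors.\<close>

lemma phi_scal_central: "central (\<phi> (scal x y N A))" if "A \<in> scalar_polys N"
  using that
proof (induction rule: scalar_polys_induct)
  case (const c)
  then show ?case using cpoly_central[of "Poly_Mapping.single 0 c"] by (simp add: scal_const
      phi_rconst cpoly_single)
next
  case (mvar v)
  have VR: "central (g 0 * g 0)"
  proof (rule centralI)
    fix a
    have "of_nat 2 * (g 0 * g 0 * a) = of_nat 2 * (a * (g 0 * g 0))"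
      using centralD[OF acomm_g_central[of 0 0], of a] by (simp add: acomm_def mult_2 distrib_left
          distrib_right)
    then show "g 0 * g 0 * a = a * (g 0 * g 0)"
      by (rule clifford_poly_of_nat_cancel[rotated]) simp
  qed
  have "vgen x = vgen (gv 0)" "1 \<le> i \<Longrightarrow> vgen (y i) = vgen (gv i)" for i
    by (simp_all add: frame_def)
  note vgen_eq = this
  show ?case using mvar VR
    by (auto simp: vgen_eq svars_def scal_VR scal_VS scal_VC phi_mult phi_acomm acomm_g_central)
next
  case (add A B)
  then show ?case by (simp add: scal_add phi_add central_add)
next
  case (mult A B)
  then show ?case by (simp add: scal_mult phi_mult central_mult)
qed

text \<open>Serves r and s_i alike: in x_k the derivative of x^2 is {x, e_k}, and that of {x, y_i}
  is {y_i, e_k}.\<close>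

lemma crd_vector_acomm:
  assumes "\<And>k. mpderiv (Inl k) F = acomm (g i) (evec k)"
  shows "crd F = 2 * g i"
  unfolding crd_eq assms sum_acomm_g_evec by simp

lemma crd_phi_scal:
  assumes "A \<in> scalar_polys N"
  shows "crd (\<phi> (scal x y N A)) = \<phi> (scalar_derivative x y N A)"
proof -
  \<comment> \<open>Centrality is carried along for the product rule, which asks for a central right
    factor; both sides then obey the same product rule and are compared on r, s_i and c_ij.\<close>
  have "crd (\<phi> (scal x y N A)) = \<phi> (scalar_derivative x y N A) \<and> central (\<phi> (scal x y N A))"
    using assms
  proof (induction rule: scalar_polys_induct)
    case (const c)
    then show ?case
      using phi_scal_central[OF scalar_polys_const]
      by (simp add: scal_const phi_rconst crd_eq mpderiv_const scalar_derivative_def scal_0 phi_0)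
  next
    case (mvar v)
    have gx: "vgen x = vgen (gv 0)" and gy: "\<And>i. 1 \<le> i \<Longrightarrow> vgen (y i) = vgen (gv i)"
      by (simp_all add: frame_def)
    have two: "\<phi> (2 * F) = 2 * \<phi> F" for F
      by (simp add: mult_2 phi_add)
    consider "v = VR" | i where "v = VS i" "1 \<le> i" "i \<le> N" | i j where "v = VC i j" "1 \<le> i" "i \<le> j"
        "j \<le> N"
      using mvar by (auto simp: svars_def)
    then have "crd (\<phi> (scal x y N (mvar v))) = \<phi> (scalar_derivative x y N (mvar v))"
    proof cases
      case 1
      have "crd (\<phi> (scal x y N (mvar v))) = 2 * g 0"
        using 1 by (intro crd_vector_acomm) (simp add: scal_VR gx phi_mult mpderiv_mult mpderiv_g_0
            acomm_def add.commute)
      moreover have "scalar_derivative x y N (mvar v) = 2 * vgen (gv 0)"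
        using 1 by (simp add: scalar_derivative_def mpderiv_mvar scal_0 scal_1 gx)
      ultimately show ?thesis by (simp add: two)
    next
      case (2 i)
      have "crd (\<phi> (scal x y N (mvar v))) = 2 * g i"
        using 2 by (intro crd_vector_acomm)
          (simp add: scal_VS gx gy phi_acomm mpderiv_acomm mpderiv_g_0 mpderiv_g_y, simp
              add: acomm_def add.commute)
      moreover have "scalar_derivative x y N (mvar v) = 2 * vgen (gv i)"
      proof -
        have "(\<Sum>j = 1..N. vgen (y j) * scal x y N (mpderiv (VS j) (mvar v))) =
            (\<Sum>j = 1..N. if j = i then vgen (y i) else (0 :: ('v, real) radial))"
          using 2 by (intro sum.cong refl) (auto simp: mpderiv_mvar scal_0 scal_1)
        then show ?thesis
          using 2 by (simp add: scalar_derivative_def mpderiv_mvar scal_0 gy)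
      qed
      ultimately show ?thesis by (simp add: two)
    next
      case (3 i j)
      have "mpderiv (Inl k) (g i) = 0" "mpderiv (Inl k) (g j) = 0" for k
        using 3 by (intro mpderiv_g_y; simp)+
      then have "crd (\<phi> (scal x y N (mvar v))) = 0"
        using 3 by (simp add: scal_VC gy phi_acomm crd_eq mpderiv_acomm, simp add: acomm_def)
      moreover have "scalar_derivative x y N (mvar v) = 0"
        using 3 by (simp add: scalar_derivative_def mpderiv_mvar scal_0)
      ultimately show ?thesis by (simp add: phi_0)
    qed
    then show ?case using phi_scal_central[OF scalar_polys_mvar[OF mvar]] by simp
  next
    case (add A B)
    then show ?case
      using poly_linear_scalar_derivative[of x y N]
      by (simp add: poly_linear_def scal_add phi_add crd_add central_add)
  next
    case (mult A B)
    then have "crd (\<phi> (scal x y N A) * \<phi> (scal x y N B)) =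
        \<phi> (scalar_derivative x y N A) * \<phi> (scal x y N B) + \<phi> (scalar_derivative x y N B) * \<phi> (scal x
            y N A)"
      using centralD[of "\<phi> (scal x y N A)" "\<phi> (scalar_derivative x y N B)"]
          by (simp add: crd_mult_central)
    then show ?case
      using mult by (simp add: scal_mult phi_mult scalar_derivative_mult phi_add central_mult)
  qed
  then show ?thesis ..
qed

text \<open>F is expanded in its coordinates. On each term the central scalar splits off by the
  product rule, and the wedge contributes 0 or (-1)^p (M - p) y_I.\<close>

lemma crd_phi: "\<phi> (radial_derivative CARD('m) F) = crd (\<phi> F)"
proof -
  let ?T = "twisted_term (scalar_derivative x y N) (\<lambda>p. real CARD('m) - real p) (\<lambda>p. 1)"
  have "\<phi> (?T J A) = crd (\<phi> (E J * scal x y N A))" if J: "J \<subseteq> {..N}" and A: "A \<in> scalar_polys N" for J A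
  proof -
    have crd: "crd (\<phi> (E J * scal x y N A)) =
        crd (\<phi> (E J)) * \<phi> (scal x y N A) + \<phi> (E J) * \<phi> (scalar_derivative x y N A)"
      by (simp add: phi_mult crd_mult_central[OF phi_scal_central[OF A]] crd_phi_scal[OF A])
    from J show ?thesis
    proof (cases rule: subset_cases)
      case (1 I)
      then show ?thesis unfolding crd by (simp add: twisted_term_def crd_E phi_mult)
    next
      case (2 I)
      have "\<phi> ((- 1) ^ n) = (- 1) ^ n" for n
        by (simp add: minus_one_power_iff phi_1 phi_uminus)
      moreover have "\<phi> (rconst (real CARD('m) - real n)) = of_nat CARD('m) - of_nat n" for n
      proof -
        have "\<phi> (rconst (real CARD('m) - real n)) + \<phi> (rconst (real n)) = \<phi> (rconst (real CARD('m)))"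
          by (simp flip: phi_add rconst_add)
        then show ?thesis by (simp add: rconst_of_nat phi_of_nat eq_diff_eq)
      qed
      moreover have "insert 0 I - {0} = I" using 2 by simp
      ultimately show ?thesis
        unfolding crd unfolding 2(2) crd_E_insert_0[OF 2(1)]
        by (simp add: twisted_term_def phi_add phi_mult rconst_1 mult.assoc)
    qed
  qed
  then have "\<phi> (radial_derivative CARD('m) F) = (\<Sum>J\<in>Pow {..N}. crd (\<phi> (E J * scal x y N (coords F J))))"
    unfolding radial_derivative_def extend_def phi_sum
    by (intro sum.cong refl) (simp add: coords_scalar_polys)
  also have "\<dots> = crd (\<phi> (comb (coords F)))"
    by (simp only: comb_def phi_sum crd_sum)
  finally show ?thesis by (simp only: comb_coords)
qed

end

theorem proposition3p3:
  fixes x :: 'v and y :: "nat \<Rightarrow> 'v" and N M :: nat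
  assumes generators: "bij_betw y {1..N} (UNIV - {x})"
    and M: "M = CARD('m::finite)"
  shows "\<exists>D :: ('v, real) radial \<Rightarrow> ('v, real) radial.
     is_radial_right_derivative M x y N D \<and>
     (\<forall>D'. is_radial_right_derivative M x y N D' \<longrightarrow> D' = D) \<and>
     (\<forall>F. has_classical_limit M x y N (relative_q_derivative x y N (base_change F)) (D F)) \<and>
     (\<forall>\<phi> :: ('v, real) radial \<Rightarrow> ('m, 'w) clifford_poly.
        clifford_realization x y N \<phi> \<longrightarrow>
        (\<forall>F. \<phi> (D F) = clifford_right_derivative (\<phi> F)))"
proof -
  interpret radial_frame x y N by unfold_locales (rule generators)
  have "\<phi> (radial_derivative M F) = clifford_right_derivative (\<phi> F)"
    if "clifford_realization x y N \<phi>" for \<phi> :: "('v, real) radial \<Rightarrow> ('m, 'w) clifford_poly" and F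
  proof -
    interpret clifford_frame x y N \<phi> by unfold_locales (rule that)
    show ?thesis unfolding M by (rule crd_phi)
  qed
  then show ?thesis
    by (intro exI[of _ "radial_derivative M"])
      (simp add: is_radial_right_derivative_iff classical_limit_radial_derivative)
qed

end
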